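(* There exists a rational cuspidal curve $C\subset\mathbb{C}P^2$ of degree $d=8$ with exactly three singular points, whose semigroups are $\Gamma_1=\langle 6,7\rangle$, $\Gamma_2=\langle 2,9\rangle$ and $\Gamma_3=\langle 2,5\rangle$ (equivalently, whose multiplicity sequences are $[6]$, $[2,2,2,2]$ and $[2,2]$). For this curve the inequality $F(jd)\le \frac{(j+1)(j+2)}{2}$ fails for $j=1$ and $j=4$: one has $F(8)=4>3$ and $F(32)=16>15$. Consequently not all coefficients of the polynomial $R(t)$ associated with $C$ are non-positive, i.e. it is not true that for every rational cuspidal plane curve all coefficients of $R(t)$ are non-positive.
   Context: A rational cuspidal curve is an irreducible projective plane curve of geometric genus $0$ all of whose singularities $(C,P_1),\dots,(C,P_\nu)$ are locally irreducible (cusps). $\Gamma_i\subset\mathbb{Z}_{\ge0}$ is the semigroup of the plane curve singularity $(C,P_i)$ (the set of local intersection multiplicities at $P_i$ of $C$ with curve germs not containing $(C,P_i)$), $\langle a,b\rangle$ denotes the semigroup generated by $a,b$ (including $0$), $\delta_i=\#(\mathbb{Z}_{\ge0}\setminus\Gamma_i)$ and $\delta=\sum_i\delta_i$; for a degree $d$ rational cuspidal curve $2\delta=(d-1)(d-2)$. Let $\Delta_i(t)=(1-t)\sum_{k\in\Gamma_i}t^k$ (the Alexander polynomial of the singularity, normalized by $\Delta_i(1)=1$) and $\Delta=\Delta_1\cdots\Delta_\nu$. Put $$R(t)=\frac1d\sum_{\xi^d=1}\frac{\Delta(\xi t)}{(1-\xi t)^2}-\frac{1-t^{d^2}}{(1-t^d)^3}.$$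 This is a polynomial, and $R(t)=\sum_{j=0}^{d-3}\big(q_{(d-3-j)d}-\frac{(j+1)(j+2)}2\big)t^{(d-3-j)d}$, where $Q(t)=\sum_jq_jt^j$ is the polynomial determined by $\Delta(t)=1+\delta(t-1)+(t-1)^2Q(t)$. Let $H_i(k)=\#\{s\in\Gamma_i: s<k\}$ and $h^{(i)}_j=H_i(j+1)$ for $j\ge0$. For a sequence $a=\{a_j\}_{j\ge0}$ put $(\partial a)_j=a_j-a_{j-1}$ with $a_{-1}=0$, $(\varSigma a)_j=a_0+\dots+a_j$, and let $*$ be convolution, $(a*b)_j=\sum_{k=0}^ja_kb_{j-k}$. Define $F(j)=\big(\varSigma\varSigma(\partial\partial h^{(1)}*\cdots*\partial\partial h^{(\nu)})\big)_j$. One has $q_{2\delta-2-j}=F(j)$ for $0\le j\le2\delta-2$, so the coefficient of $t^{(d-3-j)d}$ in $R(t)$ is $F(jd)-\frac{(j+1)(j+2)}2$. *)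

theory Defs
  imports
    "HOL-Analysis.Analysis"
    "HOL-Computational_Algebra.Computational_Algebra"
begin

section \<open>Ternary forms and the complex projective plane\<close>

text \<open>
  A polynomial in \<open>x, y, z\<close> is an iterated univariate polynomial; the coefficient of
  \<open>x^i y^j z^k\<close> in \<open>F\<close> is \<open>coeff (coeff (coeff F k) j) i\<close>.
\<close>

type_synonym poly3 = "complex poly poly poly"

definition form :: "nat \<Rightarrow> poly3 \<Rightarrow> bool" where
  "form d F \<longleftrightarrow> (\<forall>i j k. coeff (coeff (coeff F k) j) i \<noteq> 0 \<longrightarrow> i + j + k = d)"

text \<open>Substitution of elements of a commutative \<open>\<complex>\<close>-algebra with structure map \<open>e\<close>.\<close>

definition eval3 :: "(complex \<Rightarrow> 'a::comm_ring_1) \<Rightarrow> poly3 \<Rightarrow> 'a \<Rightarrow> 'a \<Rightarrow> 'a \<Rightarrow> 'a" where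
  "eval3 e F x y z =
     poly (map_poly (\<lambda>G. poly (map_poly (\<lambda>H. poly (map_poly e H) x) G) y) F) z"

definition dx :: "poly3 \<Rightarrow> poly3" where "dx F = map_poly (map_poly pderiv) F"
definition dy :: "poly3 \<Rightarrow> poly3" where "dy F = map_poly pderiv F"
definition dz :: "poly3 \<Rightarrow> poly3" where "dz F = pderiv F"

fun proj_rel :: "complex \<times> complex \<times> complex \<Rightarrow> complex \<times> complex \<times> complex \<Rightarrow> bool" where
  "proj_rel (x, y, z) (x', y', z') \<longleftrightarrow>
     (x, y, z) \<noteq> (0, 0, 0) \<and> (\<exists>c. c \<noteq> 0 \<and> x' = c * x \<and> y' = c * y \<and> z' = c * z)"

quotient_type cp2 = "complex \<times> complex \<times> complex" / partial: proj_rel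
proof (rule part_equivpI)
  have "proj_rel (1, 0, 0) (1, 0, 0)" by (auto intro: exI[of _ 1])
  then show "\<exists>p. proj_rel p p" by blast
  show "symp proj_rel"
  proof (rule sympI)
    fix p q assume "proj_rel p q"
    moreover obtain x y z where p: "p = (x, y, z)" by (cases p)
    moreover obtain x' y' z' where q: "q = (x', y', z')" by (cases q)
    ultimately obtain c where c: "(x, y, z) \<noteq> (0, 0, 0)" "c \<noteq> 0"
      "x' = c * x" "y' = c * y" "z' = c * z" by auto
    then have "x = inverse c * x'" "y = inverse c * y'" "z = inverse c * z'" by simp_all
    moreover have "(x', y', z') \<noteq> (0, 0, 0)" using c by auto
    moreover have "inverse c \<noteq> 0" using c by simp
    ultimately show "proj_rel q p" unfolding p q proj_rel.simps by blast
  qed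
  show "transp proj_rel"
  proof (rule transpI)
    fix p q r assume "proj_rel p q" "proj_rel q r"
    moreover obtain x y z where p: "p = (x, y, z)" by (cases p)
    moreover obtain x' y' z' where q: "q = (x', y', z')" by (cases q)
    moreover obtain x'' y'' z'' where r: "r = (x'', y'', z'')" by (cases r)
    ultimately obtain b c where *: "(x, y, z) \<noteq> (0, 0, 0)" "b \<noteq> 0" "c \<noteq> 0"
      "x' = c * x" "y' = c * y" "z' = c * z"
      "x'' = b * x'" "y'' = b * y'" "z'' = b * z'" by auto
    then have "x'' = (b * c) * x" "y'' = (b * c) * y" "z'' = (b * c) * z" "b * c \<noteq> 0"
      by simp_all
    then show "proj_rel p r" using * unfolding p r proj_rel.simps by blast
  qed
qed

text \<open>
  For a form \<open>F\<close> the following does not depend on the representative \<open>rep_cp2 P\<close>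
  of homogeneous coordinates.
\<close>

definition vanishes_at :: "poly3 \<Rightarrow> cp2 \<Rightarrow> bool" where
  "vanishes_at F P \<longleftrightarrow> (case rep_cp2 P of (x, y, z) \<Rightarrow> eval3 (\<lambda>c. c) F x y z = 0)"

definition sing :: "poly3 \<Rightarrow> cp2 set" where
  "sing F = {P. vanishes_at F P \<and> vanishes_at (dx F) P \<and> vanishes_at (dy F) P \<and> vanishes_at (dz F) P}"


section \<open>Dimension of a quotient of complex vector spaces\<close>

text \<open>
  \<open>V\<close> and \<open>W \<subseteq> V\<close> are subspaces of a commutative ring on which \<open>\<complex>\<close> acts through the ring
  homomorphism \<open>e\<close>; the relation says that \<open>V / W\<close> has a basis with \<open>n\<close> elements.
\<close>

definition quotient_dim :: "(complex \<Rightarrow> 'a::comm_ring_1) \<Rightarrow> 'a set \<Rightarrow> 'a set \<Rightarrow> nat \<Rightarrow> bool" where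
  "quotient_dim e V W n \<longleftrightarrow>
     (\<exists>B. finite B \<and> card B = n \<and> B \<subseteq> V \<and>
       (\<forall>v\<in>V. \<exists>!c. c \<in> B \<rightarrow>\<^sub>E UNIV \<and> v - (\<Sum>b\<in>B. e (c b) * b) \<in> W))"


section \<open>Plane curve germs\<close>

text \<open>
  A power series in two local coordinates \<open>u, v\<close> is an iterated power series; the coefficient
  of \<open>u^i v^j\<close> is \<open>germ_coeff g i j\<close>. The ring \<open>\<complex>{u, v}\<close> consists of those converging
  absolutely on some polydisc.
\<close>

type_synonym series2 = "complex fps fps"

definition germ_coeff :: "series2 \<Rightarrow> nat \<Rightarrow> nat \<Rightarrow> complex" where
  "germ_coeff g i j = fps_nth (fps_nth g j) i"

definition germs :: "series2 set" where
  "germs = {g. \<exists>r>0. (\<lambda>(i, j). norm (germ_coeff g i j) * r ^ (i + j)) summable_on UNIV}"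

definition germ_const :: "complex \<Rightarrow> series2" where
  "germ_const c = fps_const (fps_const c)"

definition germ_unit :: "series2 \<Rightarrow> bool" where
  "germ_unit g \<longleftrightarrow> g \<in> germs \<and> (\<exists>h\<in>germs. g * h = 1)"

definition germ_dvd :: "series2 \<Rightarrow> series2 \<Rightarrow> bool" where
  "germ_dvd f g \<longleftrightarrow> (\<exists>h\<in>germs. g = f * h)"

definition germ_irreducible :: "series2 \<Rightarrow> bool" where
  "germ_irreducible f \<longleftrightarrow> f \<in> germs \<and> f \<noteq> 0 \<and> \<not> germ_unit f \<and>
     (\<forall>a\<in>germs. \<forall>b\<in>germs. f = a * b \<longrightarrow> germ_unit a \<or> germ_unit b)"

text \<open>\<open>n = dim \<complex>{u, v} / (f, g)\<close>\<close>

definition intersection_mult :: "series2 \<Rightarrow> series2 \<Rightarrow> nat \<Rightarrow> bool" where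
  "intersection_mult f g n \<longleftrightarrow>
     quotient_dim germ_const germs {a * f + b * g | a b. a \<in> germs \<and> b \<in> germs} n"

text \<open>
  Local equation of the curve \<open>F = 0\<close> at \<open>P\<close>, in the affine coordinates centred at \<open>P\<close> of the
  last standard chart containing \<open>P\<close>.
\<close>

definition local_eq :: "poly3 \<Rightarrow> cp2 \<Rightarrow> series2" where
  "local_eq F P =
     (let u = fps_const fps_X; v = fps_X in
      case rep_cp2 P of (x, y, z) \<Rightarrow>
        if z \<noteq> 0 then eval3 germ_const F (germ_const (x / z) + u) (germ_const (y / z) + v) 1
        else if y \<noteq> 0 then eval3 germ_const F (germ_const (x / y) + u) 1 v
        else eval3 germ_const F 1 u v)"

definition germ_semigroup :: "series2 \<Rightarrow> nat set" where
  "germ_semigroup f = {n. \<exists>g\<in>germs. \<not> germ_dvd f g \<and> intersection_mult f g n}"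

definition cusp_semigroup :: "poly3 \<Rightarrow> cp2 \<Rightarrow> nat set" where
  "cusp_semigroup F P = germ_semigroup (local_eq F P)"

definition generated2 :: "nat \<Rightarrow> nat \<Rightarrow> nat set" where
  "generated2 a b = {k * a + l * b | k l. True}"


section \<open>Multiplicity sequences\<close>

definition germ_mult :: "series2 \<Rightarrow> nat" where
  "germ_mult f = (LEAST n. \<exists>i j. i + j = n \<and> germ_coeff f i j \<noteq> 0)"

definition germ_swap :: "series2 \<Rightarrow> series2" where
  "germ_swap f = Abs_fps (\<lambda>j. Abs_fps (\<lambda>i. germ_coeff f j i))"

text \<open>
  Strict transform \<open>f (u, u * (v + c)) / u ^ m\<close>, where \<open>m\<close> is the multiplicity of \<open>f\<close>,
  expanded coefficientwise.
\<close>

definition blow_up :: "complex \<Rightarrow> series2 \<Rightarrow> series2" where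
  "blow_up c f = Abs_fps (\<lambda>k. Abs_fps (\<lambda>n.
     \<Sum>j\<le>n + germ_mult f.
       germ_coeff f (n + germ_mult f - j) j * of_nat (j choose k) * c ^ (j - k)))"

text \<open>
  The strict transform of \<open>f\<close>, localized at one of its points on the exceptional line. For
  irreducible \<open>f\<close> there is only one such point. The second chart is only needed for the
  direction of the \<open>v\<close>-axis.
\<close>

definition strict_transform :: "series2 \<Rightarrow> series2 \<Rightarrow> bool" where
  "strict_transform f f' \<longleftrightarrow>
     germ_coeff f' 0 0 = 0 \<and> ((\<exists>c. f' = blow_up c f) \<or> f' = blow_up 0 (germ_swap f))"

text \<open>Trailing multiplicities 1 are omitted.\<close>

fun multiplicity_sequence :: "series2 \<Rightarrow> nat list \<Rightarrow> bool" where
  "multiplicity_sequence f [] \<longleftrightarrow> germ_mult f = 1"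
| "multiplicity_sequence f (m # ms) \<longleftrightarrow> germ_mult f = m \<and> m \<ge> 2 \<and>
     (\<exists>f'. strict_transform f f' \<and> multiplicity_sequence f' ms)"


section \<open>Geometric genus\<close>

text \<open>
  The function field of the irreducible curve \<open>F = 0\<close> is the residue field
  \<open>fun_ring F / fun_ideal F\<close> of the local ring of the plane at the generic point of the curve.
\<close>

definition fun_ring :: "poly3 \<Rightarrow> poly3 fract set" where
  "fun_ring F = {Fract G H | G H n. form n G \<and> form n H \<and> \<not> F dvd H}"

definition fun_ideal :: "poly3 \<Rightarrow> poly3 fract set" where
  "fun_ideal F = {Fract G H | G H n. form n G \<and> form n H \<and> \<not> F dvd H \<and> F dvd G}"

definition fun_const :: "complex \<Rightarrow> poly3 fract" where
  "fun_const c = Fract [:[:[:c:]:]:] 1"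

text \<open>
  Places of the function field over \<open>\<complex>\<close>, given by their normalized discrete valuations,
  which are lifted to \<open>fun_ring F\<close> and extended by 0 to a total function.
  As \<open>\<complex>\<close> is algebraically closed, every place has degree 1.
\<close>

definition places :: "poly3 \<Rightarrow> (poly3 fract \<Rightarrow> int) set" where
  "places F =
     (let U = fun_ring F - fun_ideal F in
      {w. (\<forall>a. a \<notin> U \<longrightarrow> w a = 0) \<and>
          (\<forall>a\<in>U. \<forall>b\<in>U. a - b \<in> fun_ideal F \<longrightarrow> w a = w b) \<and>
          (\<forall>a\<in>U. \<forall>b\<in>U. w (a * b) = w a + w b) \<and>
          (\<forall>a\<in>U. \<forall>b\<in>U. a + b \<in> U \<longrightarrow> w (a + b) \<ge> min (w a) (w b)) \<and>
          (\<forall>c. c \<noteq> 0 \<longrightarrow> w (fun_const c) = 0) \<and>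
          (\<exists>a\<in>U. w a = 1)})"

definition divisors :: "poly3 \<Rightarrow> ((poly3 fract \<Rightarrow> int) \<Rightarrow> int) set" where
  "divisors F = {D. finite {w. D w \<noteq> 0} \<and> {w. D w \<noteq> 0} \<subseteq> places F}"

definition divisor_degree :: "((poly3 fract \<Rightarrow> int) \<Rightarrow> int) \<Rightarrow> int" where
  "divisor_degree D = (\<Sum>w\<in>{w. D w \<noteq> 0}. D w)"

definition riemann_roch_space ::
  "poly3 \<Rightarrow> ((poly3 fract \<Rightarrow> int) \<Rightarrow> int) \<Rightarrow> poly3 fract set" where
  "riemann_roch_space F D =
     {a \<in> fun_ring F. a \<in> fun_ideal F \<or> (\<forall>w\<in>places F. w a + D w \<ge> 0)}"

text \<open>The genus of the function field is the maximum of \<open>deg D + 1 - l(D)\<close> over all divisors.\<close>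

definition geometric_genus :: "poly3 \<Rightarrow> int \<Rightarrow> bool" where
  "geometric_genus F g \<longleftrightarrow>
     (let l = (\<lambda>D. quotient_dim fun_const (riemann_roch_space F D) (fun_ideal F)) in
      (\<forall>D\<in>divisors F. \<exists>n. l D n \<and> divisor_degree D + 1 - int n \<le> g) \<and>
      (\<exists>D\<in>divisors F. \<exists>n. l D n \<and> divisor_degree D + 1 - int n = g))"

definition rational_cuspidal_curve :: "nat \<Rightarrow> poly3 \<Rightarrow> bool" where
  "rational_cuspidal_curve d F \<longleftrightarrow>
     form d F \<and> irreducible F \<and> geometric_genus F 0 \<and>
     (\<forall>P\<in>sing F. germ_irreducible (local_eq F P))"


section \<open>The function \<open>F(j)\<close> and the polynomial \<open>R(t)\<close>\<close>

definition diff_seq :: "(nat \<Rightarrow> int) \<Rightarrow> nat \<Rightarrow> int" where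
  "diff_seq a j = a j - (if j = 0 then 0 else a (j - 1))"

definition sum_seq :: "(nat \<Rightarrow> int) \<Rightarrow> nat \<Rightarrow> int" where
  "sum_seq a j = (\<Sum>k\<le>j. a k)"

definition conv :: "(nat \<Rightarrow> int) \<Rightarrow> (nat \<Rightarrow> int) \<Rightarrow> nat \<Rightarrow> int" where
  "conv a b j = (\<Sum>k\<le>j. a k * b (j - k))"

definition semigroup_count :: "nat set \<Rightarrow> nat \<Rightarrow> nat" where
  "semigroup_count S k = card {s \<in> S. s < k}"

definition h_seq :: "nat set \<Rightarrow> nat \<Rightarrow> int" where
  "h_seq S j = int (semigroup_count S (j + 1))"

text \<open>The start value of the fold is the neutral element of the convolution.\<close>

definition F_fun :: "nat set list \<Rightarrow> nat \<Rightarrow> int" where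
  "F_fun Ss = sum_seq (sum_seq
     (foldr conv (map (\<lambda>S. diff_seq (diff_seq (h_seq S))) Ss) (\<lambda>j. if j = 0 then 1 else 0)))"

definition alexander :: "nat set \<Rightarrow> complex fps" where
  "alexander S = (1 - fps_X) * Abs_fps (\<lambda>k. if k \<in> S then 1 else 0)"

definition R_series :: "nat \<Rightarrow> nat set list \<Rightarrow> complex fps" where
  "R_series d Ss =
     fps_const (1 / of_nat d) *
       (\<Sum>\<xi> | \<xi> ^ d = 1.
          fps_compose (prod_list (map alexander Ss)) (fps_const \<xi> * fps_X)
            / (1 - fps_const \<xi> * fps_X) ^ 2)
     - (1 - fps_X ^ (d ^ 2)) / (1 - fps_X ^ d) ^ 3"

text \<open>\<open>R(t)\<close> is a polynomial with real (indeed integral) coefficients.\<close>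

definition is_R_poly :: "nat \<Rightarrow> nat set list \<Rightarrow> real poly \<Rightarrow> bool" where
  "is_R_poly d Ss p \<longleftrightarrow> fps_of_poly (map_poly complex_of_real p) = R_series d Ss"

end

theory Submission
  imports Defs
begin

text \<open>
  The curve. A curve of degree 8 with a cusp \<open>P1\<close> of multiplicity 6 is a double cover of the
  pencil of lines through \<open>P1\<close>. If the curve is rational, this cover has two ramified fibres, and
  at these the two cusps of multiplicity 2 must sit. In coordinates with \<open>P1 = (0:1:0)\<close>, ramified
  fibres \<open>X = 0\<close> and \<open>X + 4Z = 0\<close>, and tangent \<open>Z = 0\<close> at \<open>P1\<close>, the curve has a parameter \<open>t\<close>
  with \<open>t^2 = 1 + 4Z/X\<close>, and the two points over \<open>Z = 0\<close> are \<open>t = 1\<close>, which shall be the cusp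
  \<open>P1\<close>, and \<open>t = -1\<close>, where \<open>Y/X\<close> shall be finite. For cusps of type \<open>(2, 9)\<close> and \<open>(2, 5)\<close> at
  \<open>t = 0\<close> and \<open>t = \<infinity>\<close>, the odd part of \<open>(Z/X)^6 Y/X\<close> has to be a multiple of \<open>t^9\<close>. Finiteness at
  \<open>t = -1\<close> then forces the even part: up to a change of \<open>Y\<close> it is the Taylor polynomial of degree
  5 of \<open>(1 + 4w)^(9/2)\<close> in \<open>w = Z/X\<close>. With its homogenization \<open>e(X, Z)\<close> the curve is
  \<open>(Z^6 Y - X^2 e)^2 = X^5 (X + 4Z)^9\<close>, divided by \<open>Z^6\<close>; with \<open>t = 1 + 2s\<close> it is parametrized by
  \<open>(s^6 : q(s) : s^7 (s + 1))\<close> for a quartic polynomial \<open>q\<close>. The cusps are at \<open>s = 0\<close>,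
  \<open>s = -1/2\<close> and \<open>s = \<infinity>\<close>.

  The cusps. In the affine charts at all three of them, the local equation is a Weierstrass
  polynomial \<open>f\<close> of degree \<open>m\<close> in the second coordinate, and there is a formal parametrization
  \<open>(\<alpha>, \<beta>)\<close> with \<open>ord \<alpha> = m\<close> along which some coordinate has order \<open>k\<close> prime to \<open>m\<close>. Substitution
  of the parametrization is a ring homomorphism \<open>\<Phi>\<close> from germs to power series. By Weierstrass
  division every germ is, modulo \<open>f\<close>, a combination of \<open>m\<close> terms whose orders along the branch are
  distinct modulo \<open>m\<close>, hence cannot cancel. So \<open>\<Phi>\<close> has kernel \<open>(f)\<close>, which makes \<open>f\<close> irreducible,
  and the orders that occur are the elements of \<open>\<langle>m, k\<rangle>\<close>. Finally \<open>dim \<complex>{u, v} / (f, g)\<close> is the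
  number of orders of germs that are not orders of elements of \<open>(f, g)\<close>, and this number is
  \<open>ord (\<Phi> g)\<close>. All this is in the locale \<open>branch\<close>. It suffices that the parametrization is formal;
  convergence enters only in the Weierstrass division.

  Irreducibility and genus. The same count of orders modulo 6, with the cone over the curve in place
  of the branch at \<open>P1\<close>, shows that every polynomial that vanishes on the cone is divisible by the
  equation. Hence the equation is irreducible and the function field of the curve is \<open>\<complex>(s)\<close>. The
  places are the points of the projective line, and the space of a divisor is a space of polynomials
  of bounded degree, so that the genus is 0.

  The coefficients. The second differences of the counting functions are the coefficients of the
  Alexander polynomials, so \<open>F\<close> has the generating function \<open>\<Delta>(t) / (1 - t)^2\<close>, and averaging over
  the roots of unity retains the coefficients whose index is a multiple of 8. The result is
  \<open>R(t) = t^8 - t^16 - t^24 + t^32\<close>.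
\<close>

unbundle no vec_syntax

section \<open>Linear algebra with orders of power series\<close>

text \<open>
  The summand of least order has no partner to cancel with. This is used for the branches and again
  for the cone over the whole curve.
\<close>

lemma subdegree_sum_distinct:
  fixes f :: "'i \<Rightarrow> 'a::idom fps"
  assumes "finite I" "I \<noteq> {}" "\<And>i. i \<in> I \<Longrightarrow> f i \<noteq> 0" "inj_on (\<lambda>i. subdegree (f i)) I"
  shows "(\<Sum>i\<in>I. f i) \<noteq> 0 \<and> subdegree (\<Sum>i\<in>I. f i) = Min ((\<lambda>i. subdegree (f i)) ` I)"
proof -
  let ?d = "\<lambda>i. subdegree (f i)"
  have "Min (?d ` I) \<in> ?d ` I" using assms by (intro Min_in) auto
  then obtain k where k: "k \<in> I" "?d k = Min (?d ` I)" by auto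
  have less: "?d k < ?d i" if "i \<in> I" "i \<noteq> k" for i
  proof -
    have "?d k \<le> ?d i" using k that assms(1) by simp
    moreover have "?d k \<noteq> ?d i" using assms(4) that k(1) by (auto dest: inj_onD)
    ultimately show ?thesis by simp
  qed
  have "(\<Sum>i\<in>I. f i) $ ?d k = (\<Sum>i\<in>I. if i = k then f k $ ?d k else 0)"
    unfolding fps_sum_nth by (intro sum.cong) (auto simp: less nth_less_subdegree_zero)
  also have "\<dots> = f k $ ?d k" using k assms(1) by simp
  finally have top: "(\<Sum>i\<in>I. f i) $ ?d k \<noteq> 0" using assms(3)[OF k(1)] by simp
  have low: "(\<Sum>i\<in>I. f i) $ n = 0" if "n < ?d k" for n
    unfolding fps_sum_nth
  proof (intro sum.neutral ballI)
    fix i assume "i \<in> I"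
    then have "?d k \<le> ?d i" using less by (cases "i = k") (auto simp: less_imp_le)
    then show "f i $ n = 0" using that by (intro nth_less_subdegree_zero) simp
  qed
  from top have "(\<Sum>i\<in>I. f i) \<noteq> 0" by auto
  moreover have "subdegree (\<Sum>i\<in>I. f i) = ?d k"
    using top low by (intro subdegreeI) auto
  ultimately show ?thesis using k by simp
qed

text \<open>
  More vectors than coordinates over an integral domain are linearly dependent. The coefficients
  stay in the given subring \<open>R\<close>, since elimination with a pivot can be done without division;
  this matters for convergent power series.
\<close>

lemma exists_linear_relation:
  fixes x :: "'k \<Rightarrow> 'b \<Rightarrow> 'a::idom"
  assumes "finite I" "finite K" "card I < card K"
    and "\<And>k i. k \<in> K \<Longrightarrow> i \<in> I \<Longrightarrow> x k i \<in> R"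
    and R: "0 \<in> R" "1 \<in> R" "\<And>a b. a \<in> R \<Longrightarrow> b \<in> R \<Longrightarrow> a * b \<in> R"
      "\<And>a b. a \<in> R \<Longrightarrow> b \<in> R \<Longrightarrow> a - b \<in> R"
  shows "\<exists>c. (\<forall>k\<in>K. c k \<in> R) \<and> (\<exists>k\<in>K. c k \<noteq> 0) \<and> (\<forall>i\<in>I. (\<Sum>k\<in>K. c k * x k i) = 0)"
  using assms(1-4)
proof (induction I arbitrary: K x rule: finite_induct)
  case empty
  then have "K \<noteq> {}" by auto
  then show ?case using R by (intro exI[of _ "\<lambda>_. 1"]) auto
next
  case (insert j I)
  have uminus: "- a \<in> R" if "a \<in> R" for a using R(4)[OF R(1) that] by simp
  have plus: "a + b \<in> R" if "a \<in> R" "b \<in> R" for a b using R(4)[OF that(1) uminus[OF that(2)]] by simp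
  have sum: "sum h L \<in> R" if "\<And>k. k \<in> L \<Longrightarrow> h k \<in> R" for h :: "'k \<Rightarrow> 'a" and L
    using that by (induction L rule: infinite_finite_induct) (auto intro: plus R)
  show ?case
  proof (cases "\<forall>k\<in>K. x k j = 0")
    case True
    have "\<exists>c. (\<forall>k\<in>K. c k \<in> R) \<and> (\<exists>k\<in>K. c k \<noteq> 0) \<and> (\<forall>i\<in>I. (\<Sum>k\<in>K. c k * x k i) = 0)"
      using insert.prems insert.hyps by (intro insert.IH) auto
    then show ?thesis using True by (auto intro!: exI)
  next
    case False
    then obtain p where p: "p \<in> K" "x p j \<noteq> 0" by auto
    define K' where "K' = K - {p}"
    have K: "K = insert p K'" "p \<notin> K'" "finite K'" using p insert.prems by (auto simp: K'_def)
    define y where "y = (\<lambda>k i. x p j * x k i - x k j * x p i)"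
    have "\<exists>c. (\<forall>k\<in>K'. c k \<in> R) \<and> (\<exists>k\<in>K'. c k \<noteq> 0) \<and> (\<forall>i\<in>I. (\<Sum>k\<in>K'. c k * y k i) = 0)"
      using insert.prems insert.hyps K
      by (intro insert.IH) (auto simp: y_def intro!: R)
    then obtain c where c: "\<forall>k\<in>K'. c k \<in> R" "\<exists>k\<in>K'. c k \<noteq> 0"
      "\<forall>i\<in>I. (\<Sum>k\<in>K'. c k * y k i) = 0" by auto
    define d where "d = (\<lambda>k. if k = p then - (\<Sum>k\<in>K'. c k * x k j) else x p j * c k)"
    have relation: "(\<Sum>k\<in>K. d k * x k i) = (\<Sum>k\<in>K'. c k * y k i)" for i
    proof -
      have "(\<Sum>k\<in>K. d k * x k i) = d p * x p i + (\<Sum>k\<in>K'. d k * x k i)"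
        using K by simp
      also have "(\<Sum>k\<in>K'. d k * x k i) = (\<Sum>k\<in>K'. x p j * c k * x k i)"
        using K by (intro sum.cong) (auto simp: d_def)
      also have "d p * x p i = (\<Sum>k\<in>K'. - (c k * x k j * x p i))"
        by (simp add: d_def sum_distrib_right sum_negf)
      finally show ?thesis
        by (simp add: y_def flip: sum.distrib) (intro sum.cong; simp add: algebra_simps)
    qed
    have "(\<forall>k\<in>K. d k \<in> R)"
      using c(1) K insert.prems p by (auto simp: d_def intro!: uminus sum R(3))
    moreover have "\<exists>k\<in>K. d k \<noteq> 0"
      using c(2) K p by (auto simp: d_def)
    moreover have "(\<Sum>k\<in>K. d k * x k i) = 0" if "i \<in> insert j I" for i
      unfolding relation using that c(3) by (auto simp: y_def mult.commute)
    ultimately show ?thesis by blast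
  qed
qed

text \<open>
  The relation \<open>quotient_dim\<close> asks for a basis; that the number of its elements is an invariant
  is needed to read off the intersection multiplicity.
\<close>

lemma quotient_dim_unique:
  fixes e :: "complex \<Rightarrow> 'a::comm_ring_1"
  assumes e: "e 0 = 0" "\<And>a b. e (a + b) = e a + e b" "\<And>a b. e (a * b) = e a * e b"
    and V: "0 \<in> V"
    and W: "0 \<in> W" "\<And>a b. a \<in> W \<Longrightarrow> b \<in> W \<Longrightarrow> a + b \<in> W" "\<And>c a. a \<in> W \<Longrightarrow> e c * a \<in> W"
    and "quotient_dim e V W n" "quotient_dim e V W n'"
  shows "n = n'"
proof -
  have no_less: "\<not> a < b" if dims: "quotient_dim e V W a" "quotient_dim e V W b" for a b
  proof
    assume less: "a < b"
    define Q where "Q = (\<lambda>B v. \<exists>!c. c \<in> B \<rightarrow>\<^sub>E UNIV \<and> v - (\<Sum>b\<in>B. e (c b) * b) \<in> W)"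
    have dim: "quotient_dim e V W n \<longleftrightarrow> (\<exists>B. finite B \<and> card B = n \<and> B \<subseteq> V \<and> (\<forall>v\<in>V. Q B v))" for n
      unfolding quotient_dim_def Q_def ..
    obtain B where B: "finite B" "card B = a" "B \<subseteq> V" "\<And>v. v \<in> V \<Longrightarrow> Q B v"
      using dims(1) unfolding dim by blast
    obtain K where K: "finite K" "card K = b" "K \<subseteq> V" "\<And>v. v \<in> V \<Longrightarrow> Q K v"
      using dims(2) unfolding dim by blast
    have "\<forall>k\<in>K. \<exists>c. k - (\<Sum>b\<in>B. e (c b) * b) \<in> W"
      using B(4) K(3) unfolding Q_def by blast
    then obtain x where x: "\<And>k. k \<in> K \<Longrightarrow> k - (\<Sum>b\<in>B. e (x k b) * b) \<in> W" by metis
    have "\<exists>c. (\<forall>k\<in>K. c k \<in> UNIV) \<and> (\<exists>k\<in>K. c k \<noteq> 0) \<and> (\<forall>i\<in>B. (\<Sum>k\<in>K. c k * x k i) = 0)"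
      using B(1,2) K(1,2) less by (intro exists_linear_relation) auto
    then obtain c where c: "\<exists>k\<in>K. c k \<noteq> 0" "\<And>i. i \<in> B \<Longrightarrow> (\<Sum>k\<in>K. c k * x k i) = 0"
      by blast
    have sumW: "sum h L \<in> W" if "\<And>k. k \<in> L \<Longrightarrow> h k \<in> W" for h :: "'a \<Rightarrow> 'a" and L
      using that by (induction L rule: infinite_finite_induct) (auto intro: W)
    have esum: "e (sum h L) = (\<Sum>k\<in>L. e (h k))" for h :: "'a \<Rightarrow> complex" and L
      by (induction L rule: infinite_finite_induct) (auto simp: e)
    have "(\<Sum>k\<in>K. e (c k) * (k - (\<Sum>b\<in>B. e (x k b) * b))) \<in> W"
      by (intro sumW W x)
    also have "(\<Sum>k\<in>K. e (c k) * (k - (\<Sum>b\<in>B. e (x k b) * b)))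
        = (\<Sum>k\<in>K. e (c k) * k) - (\<Sum>k\<in>K. \<Sum>b\<in>B. e (c k * x k b) * b)"
      by (simp add: right_diff_distrib sum_subtractf sum_distrib_left e mult.assoc)
    also have "(\<Sum>k\<in>K. \<Sum>b\<in>B. e (c k * x k b) * b) = (\<Sum>b\<in>B. e (\<Sum>k\<in>K. c k * x k b) * b)"
      by (subst sum.swap) (simp add: esum sum_distrib_right)
    also have "\<dots> = 0" by (simp add: c(2) e(1))
    finally have inW: "(\<Sum>k\<in>K. e (c k) * k) \<in> W" by simp
    have eneg: "e (- a) = - e a" for a
      using e(2)[of a "- a"] e(1) by (simp add: eq_neg_iff_add_eq_0 add.commute)
    define c0 where "c0 = restrict (\<lambda>_. 0 :: complex) K"
    define c1 where "c1 = restrict (\<lambda>k. - c k) K"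
    have "c0 \<in> K \<rightarrow>\<^sub>E UNIV" "c1 \<in> K \<rightarrow>\<^sub>E UNIV" by (auto simp: c0_def c1_def)
    moreover have "0 - (\<Sum>b\<in>K. e (c0 b) * b) \<in> W" by (simp add: c0_def e W)
    moreover have "0 - (\<Sum>b\<in>K. e (c1 b) * b) \<in> W"
      using inW by (simp add: c1_def eneg sum_negf)
    ultimately have "c0 = c1" using K(4)[OF V] unfolding Q_def by blast
    then have "c k = 0" if "k \<in> K" for k
      using that by (auto simp: c0_def c1_def fun_eq_iff restrict_def split: if_splits)
    then show False using c(1) by auto
  qed
  show ?thesis using no_less[OF assms(8,9)] no_less[OF assms(9,8)] by simp
qed

text \<open>
  If the elements of \<open>V\<close> are measured by the order of a power series, and the ones of high order all
  lie in \<open>W\<close>, then \<open>V / W\<close> has one basis element for each order that occurs in \<open>V\<close> but not in \<open>W\<close>: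
  subtracting multiples of elements of the same order raises the order step by step until the
  remainder is absorbed by \<open>W\<close>.
\<close>

lemma quotient_dim_by_orders:
  fixes e :: "complex \<Rightarrow> 'a::comm_ring_1" and \<phi> :: "'a \<Rightarrow> complex fps"
  assumes e: "e 0 = 0" "\<And>a b. e (a + b) = e a + e b" "e 1 = 1"
    and \<phi>: "\<And>a b. \<phi> (a + b) = \<phi> a + \<phi> b" "\<And>c a. \<phi> (e c * a) = fps_const c * \<phi> a"
    and V: "0 \<in> V" "\<And>a b. a \<in> V \<Longrightarrow> b \<in> V \<Longrightarrow> a + b \<in> V" "\<And>c a. a \<in> V \<Longrightarrow> e c * a \<in> V"
    and W: "W \<subseteq> V" "0 \<in> W" "\<And>a b. a \<in> W \<Longrightarrow> b \<in> W \<Longrightarrow> a + b \<in> W"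
      "\<And>c a. a \<in> W \<Longrightarrow> e c * a \<in> W"
    and ordV: "\<And>v. v \<in> V \<Longrightarrow> \<phi> v \<noteq> 0 \<Longrightarrow> subdegree (\<phi> v) \<in> \<Gamma>"
    and ordW: "\<And>w. w \<in> W \<Longrightarrow> \<phi> w \<noteq> 0 \<Longrightarrow> subdegree (\<phi> w) \<in> \<Gamma>'"
    and exV: "\<And>n. n \<in> \<Gamma> \<Longrightarrow> \<exists>v\<in>V. \<phi> v \<noteq> 0 \<and> subdegree (\<phi> v) = n"
    and exW: "\<And>n. n \<in> \<Gamma>' \<Longrightarrow> \<exists>w\<in>W. \<phi> w \<noteq> 0 \<and> subdegree (\<phi> w) = n"
    and high: "\<And>v. v \<in> V \<Longrightarrow> \<phi> v = 0 \<or> subdegree (\<phi> v) \<ge> N \<Longrightarrow> v \<in> W"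
    and fin: "finite (\<Gamma> - \<Gamma>')"
  shows "quotient_dim e V W (card (\<Gamma> - \<Gamma>'))"
proof -
  define S where "S = \<Gamma> - \<Gamma>'"
  have eneg: "e (- a) = - e a" for a
    using e(2)[of a "- a"] e(1) by (simp add: eq_neg_iff_add_eq_0 add.commute)
  have \<phi>0: "\<phi> 0 = 0" using \<phi>(2)[of 0 0] e(1) by simp
  have \<phi>neg: "\<phi> (- a) = - \<phi> a" for a
    using \<phi>(1)[of a "- a"] \<phi>0 by (simp add: eq_neg_iff_add_eq_0 add.commute)
  have \<phi>diff: "\<phi> (a - b) = \<phi> a - \<phi> b" for a b
    using \<phi>(1)[of a "- b"] \<phi>neg by simp
  have \<phi>sum: "\<phi> (sum h L) = (\<Sum>k\<in>L. \<phi> (h k))" for h :: "nat \<Rightarrow> 'a" and L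
    by (induction L rule: infinite_finite_induct) (auto simp: \<phi>0 \<phi>(1))
  have Vsum: "sum h L \<in> V" if "\<And>k. k \<in> L \<Longrightarrow> h k \<in> V" for h :: "nat \<Rightarrow> 'a" and L
    using that by (induction L rule: infinite_finite_induct) (auto intro: V)
  have Wdiff: "a - b \<in> W" if "a \<in> W" "b \<in> W" for a b
    using W(3)[OF that(1) W(4)[OF that(2), of "-1"]] by (simp add: eneg e)
  have Vdiff: "a - b \<in> V" if "a \<in> V" "b \<in> V" for a b
    using V(2)[OF that(1) V(3)[OF that(2), of "-1"]] by (simp add: eneg e)
  obtain b where b: "\<And>n. n \<in> \<Gamma> \<Longrightarrow> b n \<in> V \<and> \<phi> (b n) \<noteq> 0 \<and> subdegree (\<phi> (b n)) = n"
    using exV by metis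
  have bS: "b n \<in> V" "\<phi> (b n) \<noteq> 0" "subdegree (\<phi> (b n)) = n" if "n \<in> S" for n
    using b that by (auto simp: S_def)
  \<comment> \<open>killing the leading coefficient raises the order\<close>
  have reduce: "\<phi> (v - e c * a) = 0 \<or> subdegree (\<phi> (v - e c * a)) > subdegree (\<phi> v)"
    if "\<phi> v \<noteq> 0" "\<phi> a \<noteq> 0" "subdegree (\<phi> a) = subdegree (\<phi> v)"
      "c = \<phi> v $ subdegree (\<phi> v) / \<phi> a $ subdegree (\<phi> a)" for v a c
  proof -
    have eq: "\<phi> (v - e c * a) = \<phi> v - fps_const c * \<phi> a" by (simp add: \<phi>diff \<phi>(2))
    have "(\<phi> v - fps_const c * \<phi> a) $ n = 0" if "n \<le> subdegree (\<phi> v)" for n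
    proof (cases "n = subdegree (\<phi> v)")
      case True
      moreover have "\<phi> a $ subdegree (\<phi> a) \<noteq> 0" using \<open>\<phi> a \<noteq> 0\<close> by simp
      ultimately show ?thesis
        using \<open>c = _\<close> \<open>subdegree (\<phi> a) = _\<close> by simp
    next
      case False
      then have "n < subdegree (\<phi> v)" "n < subdegree (\<phi> a)"
        using that \<open>subdegree (\<phi> a) = _\<close> by linarith+
      then have "\<phi> v $ n = 0" "\<phi> a $ n = 0" by (auto intro: nth_less_subdegree_zero)
      then show ?thesis by simp
    qed
    then show ?thesis unfolding eq by (meson not_le_imp_less nth_subdegree_zero_iff)
  qed
  have span: "\<exists>c. v - (\<Sum>n\<in>S. e (c n) * b n) \<in> W" if "v \<in> V" for v
    using that
  proof (induction "N - subdegree (\<phi> v)" arbitrary: v rule: less_induct)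
    case less
    show ?case
    proof (cases "\<phi> v = 0 \<or> subdegree (\<phi> v) \<ge> N")
      case True
      then show ?thesis using high less.prems
        by (intro exI[of _ "\<lambda>_. 0"]) (simp add: e)
    next
      case False
      then have v: "\<phi> v \<noteq> 0" "subdegree (\<phi> v) < N" by auto
      let ?n = "subdegree (\<phi> v)"
      have n: "?n \<in> \<Gamma>" using ordV less.prems v by blast
      have step: "\<exists>c. (v - x) - (\<Sum>n\<in>S. e (c n) * b n) \<in> W"
        if x: "x \<in> V" "\<phi> (v - x) = 0 \<or> subdegree (\<phi> (v - x)) > ?n" for x
      proof -
        have xV: "v - x \<in> V" using Vdiff less.prems x(1) .
        show ?thesis
        proof (cases "\<phi> (v - x) = 0")
          case True
          then show ?thesis using high xV by (intro exI[of _ "\<lambda>_. 0"]) (simp add: e)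
        next
          case False
          then have "N - subdegree (\<phi> (v - x)) < N - ?n" using x v by auto
          then show ?thesis using less.hyps xV by blast
        qed
      qed
      show ?thesis
      proof (cases "?n \<in> \<Gamma>'")
        case True
        then obtain w where w: "w \<in> W" "\<phi> w \<noteq> 0" "subdegree (\<phi> w) = ?n" using exW by blast
        define c where "c = \<phi> v $ ?n / \<phi> w $ subdegree (\<phi> w)"
        obtain d where d: "(v - e c * w) - (\<Sum>n\<in>S. e (d n) * b n) \<in> W"
          using step[of "e c * w"] reduce[OF v(1) w(2,3) c_def] V(3) W(1) w(1) by blast
        have "(v - e c * w) - (\<Sum>n\<in>S. e (d n) * b n) + e c * w \<in> W"
          using d W w by blast
        then show ?thesis by (intro exI[of _ d]) (simp add: algebra_simps)
      next
        case False
        then have nS: "?n \<in> S" using n by (auto simp: S_def)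
        define c where "c = \<phi> v $ ?n / \<phi> (b ?n) $ subdegree (\<phi> (b ?n))"
        obtain d where d: "(v - e c * b ?n) - (\<Sum>n\<in>S. e (d n) * b n) \<in> W"
          using step[of "e c * b ?n"] reduce[OF v(1) bS(2,3)[OF nS] c_def] V(3) bS(1)[OF nS] by blast
        define d' where "d' = (\<lambda>i. d i + (if i = ?n then c else 0))"
        have "(\<Sum>n\<in>S. e (d' n) * b n)
            = (\<Sum>n\<in>S. e (d n) * b n) + (\<Sum>n\<in>S. if n = ?n then e c * b ?n else 0)"
          unfolding sum.distrib[symmetric]
          by (intro sum.cong) (auto simp: d'_def e algebra_simps)
        also have "(\<Sum>n\<in>S. if n = ?n then e c * b ?n else 0) = e c * b ?n"
          using nS fin by (simp add: S_def)
        finally show ?thesis using d by (intro exI[of _ d']) (simp add: algebra_simps)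
      qed
    qed
  qed
  have indep: "c n = 0" if c: "(\<Sum>n\<in>S. e (c n) * b n) \<in> W" and "n \<in> S" for c n
  proof (rule ccontr)
    assume "c n \<noteq> 0"
    define T where "T = {i\<in>S. c i \<noteq> 0}"
    have T: "finite T" "T \<noteq> {}" using fin \<open>c n \<noteq> 0\<close> \<open>n \<in> S\<close> by (auto simp: T_def S_def[symmetric])
    have sd: "subdegree (fps_const (c i) * \<phi> (b i)) = i" "fps_const (c i) * \<phi> (b i) \<noteq> 0" if "i \<in> T" for i
      using that bS[of i] by (auto simp: T_def)
    have eq: "\<phi> (\<Sum>n\<in>S. e (c n) * b n) = (\<Sum>i\<in>T. fps_const (c i) * \<phi> (b i))"
      unfolding \<phi>sum \<phi>(2) using fin
      by (intro sum.mono_neutral_right) (auto simp: T_def S_def)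
    have *: "(\<Sum>i\<in>T. fps_const (c i) * \<phi> (b i)) \<noteq> 0 \<and>
        subdegree (\<Sum>i\<in>T. fps_const (c i) * \<phi> (b i)) = Min ((\<lambda>i. subdegree (fps_const (c i) * \<phi> (b i))) ` T)"
      using T sd by (intro subdegree_sum_distinct) (auto simp: inj_on_def)
    have "Min ((\<lambda>i. subdegree (fps_const (c i) * \<phi> (b i))) ` T) \<in> (\<lambda>i. subdegree (fps_const (c i) * \<phi> (b i))) ` T"
      using T by (intro Min_in) auto
    also have "\<dots> \<subseteq> T" using sd by auto
    finally have "subdegree (\<phi> (\<Sum>n\<in>S. e (c n) * b n)) \<in> S" using * eq by (auto simp: T_def)
    moreover have "subdegree (\<phi> (\<Sum>n\<in>S. e (c n) * b n)) \<in> \<Gamma>'" using ordW[OF c] * eq by simp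
    ultimately show False by (auto simp: S_def)
  qed
  have injb: "inj_on b S" by (metis inj_onI bS(3))
  define B where "B = b ` S"
  have sumB: "(\<Sum>x\<in>B. e (c x) * x) = (\<Sum>n\<in>S. e (c (b n)) * b n)" for c
    unfolding B_def by (subst sum.reindex[OF injb]) simp
  have basis: "\<exists>!c. c \<in> B \<rightarrow>\<^sub>E UNIV \<and> v - (\<Sum>b\<in>B. e (c b) * b) \<in> W" if v: "v \<in> V" for v
  proof -
    obtain c where c: "v - (\<Sum>n\<in>S. e (c n) * b n) \<in> W" using span[OF v] by blast
    define c' where "c' = restrict (\<lambda>x. c (the_inv_into S b x)) B"
    have "(\<Sum>b\<in>B. e (c' b) * b) = (\<Sum>n\<in>S. e (c n) * b n)"
      unfolding sumB by (intro sum.cong) (auto simp: c'_def B_def the_inv_into_f_f[OF injb])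
    then have "c' \<in> B \<rightarrow>\<^sub>E UNIV \<and> v - (\<Sum>b\<in>B. e (c' b) * b) \<in> W"
      using c by (auto simp: c'_def)
    moreover have "x = y" if x: "x \<in> B \<rightarrow>\<^sub>E UNIV" "v - (\<Sum>b\<in>B. e (x b) * b) \<in> W"
      and y: "y \<in> B \<rightarrow>\<^sub>E UNIV" "v - (\<Sum>b\<in>B. e (y b) * b) \<in> W" for x y
    proof -
      have ediff: "e (a - b) = e a - e b" for a b using e(2)[of a "- b"] eneg[of b] by simp
      have "(v - (\<Sum>b\<in>B. e (y b) * b)) - (v - (\<Sum>b\<in>B. e (x b) * b)) \<in> W"
        by (intro Wdiff x y)
      then have "(\<Sum>n\<in>S. e (x (b n) - y (b n)) * b n) \<in> W"
        unfolding sumB by (simp add: ediff sum_subtractf algebra_simps)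
      then have "x (b n) - y (b n) = 0" if "n \<in> S" for n
        using indep[of "\<lambda>n. x (b n) - y (b n)"] that by blast
      then show ?thesis using x y by (intro PiE_ext[of x B _ y]) (auto simp: B_def)
    qed
    ultimately show ?thesis by blast
  qed
  have B: "finite B" "card B = card S" "B \<subseteq> V"
    using fin injb bS by (auto simp: B_def S_def card_image)
  show ?thesis unfolding quotient_dim_def S_def[symmetric]
    by (intro exI[of _ B] conjI ballI B basis)
qed

section \<open>The ring of convergent germs\<close>

lemma geometric_sum_le:
  fixes x :: real assumes "0 \<le> x" "x \<le> 1/2"
  shows "(\<Sum>k\<in>{1..n}. x ^ k) \<le> 2 * x"
proof -
  have "(\<Sum>k\<in>{1..n}. x ^ k) \<le> 2 * x - 2 * (x ^ n * x)"
  proof (induction n)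
    case (Suc n)
    have "x ^ n * x * (2 * x - 1) \<le> 0" using assms by (intro mult_nonneg_nonpos) auto
    then have "x ^ Suc n + (2 * x - 2 * (x ^ n * x)) \<le> 2 * x - 2 * (x ^ Suc n * x)" by (simp add: algebra_simps)
    moreover have "(\<Sum>k\<in>{1..Suc n}. x ^ k) = x ^ Suc n + (\<Sum>k\<in>{1..n}. x ^ k)" by simp
    ultimately show ?case using Suc by linarith
  qed (use assms in auto)
  also have "\<dots> \<le> 2 * x" using assms by simp
  finally show ?thesis .
qed

text \<open>
  Summability on some polydisc is equivalent to geometric growth of the coefficients (Cauchy's
  estimate). In this form the closure properties and the Weierstrass division are plain inductions.
\<close>

definition majorized :: "real \<Rightarrow> real \<Rightarrow> series2 \<Rightarrow> bool" where
  "majorized C R g \<longleftrightarrow> C \<ge> 0 \<and> R \<ge> 1 \<and> (\<forall>i j. norm (germ_coeff g i j) \<le> C * R ^ (i + j))"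

lemma majorized_mono:
  assumes "majorized C R g" "C \<le> C'" "R \<le> R'" shows "majorized C' R' g"
proof -
  have "C * R ^ (i + j) \<le> C' * R' ^ (i + j)" for i j
    using assms by (intro mult_mono power_mono) (auto simp: majorized_def)
  then show ?thesis using assms unfolding majorized_def by (meson order_trans)
qed

lemma germs_iff: "g \<in> germs \<longleftrightarrow> (\<exists>C R. majorized C R g)"
proof
  assume "g \<in> germs"
  then obtain r where r: "r > 0"
    "(\<lambda>(i, j). norm (germ_coeff g i j) * r ^ (i + j)) summable_on UNIV"
    by (auto simp: germs_def)
  define S where "S = infsum (\<lambda>(i, j). norm (germ_coeff g i j) * r ^ (i + j)) UNIV"
  have le: "norm (germ_coeff g i j) * r ^ (i + j) \<le> S" for i j
    using finite_sum_le_infsum[OF r(2), of "{(i, j)}"] r(1) by (auto simp: S_def)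
  have S0: "S \<ge> 0" using le[of 0 0] by (meson norm_ge_zero mult_nonneg_nonneg order_trans r(1) less_imp_le zero_le_power)
  have "norm (germ_coeff g i j) \<le> S * (max 1 (1 / r)) ^ (i + j)" for i j
  proof -
    have "norm (germ_coeff g i j) \<le> S * (1 / r) ^ (i + j)"
      using le[of i j] r(1) by (simp add: field_simps power_one_over)
    also have "\<dots> \<le> S * (max 1 (1 / r)) ^ (i + j)"
      using S0 r(1) by (intro mult_left_mono power_mono) auto
    finally show ?thesis .
  qed
  then show "\<exists>C R. majorized C R g" using S0 unfolding majorized_def
    by (intro exI[of _ S] exI[of _ "max 1 (1/r)"]) auto
next
  assume "\<exists>C R. majorized C R g"
  then obtain C R where CR: "C \<ge> 0" "R \<ge> 1" "\<And>i j. norm (germ_coeff g i j) \<le> C * R ^ (i + j)"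
    by (auto simp: majorized_def)
  \<comment> \<open>at radius \<open>1 / (2 * R)\<close> the terms are bounded by a geometric series of ratio 1/2 in each variable\<close>
  let ?f = "\<lambda>(i, j). norm (germ_coeff g i j) * (1 / (2 * R)) ^ (i + j)"
  have le: "?f (i, j) \<le> C * ((1/2) ^ i * (1/2) ^ j)" for i j
  proof -
    have "?f (i, j) \<le> C * R ^ (i + j) * (1 / (2 * R)) ^ (i + j)"
      using CR by (simp add: mult_right_mono)
    also have "\<dots> = C * ((1/2) ^ i * (1/2) ^ j)"
      using CR(2) by (simp add: power_add power_mult_distrib power_divide field_simps)
    finally show ?thesis .
  qed
  have geo: "(\<Sum>k\<le>N. (1/2) ^ k) \<le> (2::real)" for N
    using geometric_sum_le[of "1/2" N] by (simp add: atMost_atLeast0 sum.atLeast_Suc_atMost)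
  have "?f summable_on UNIV"
  proof (rule nonneg_bdd_above_summable_on)
    show "?f x \<ge> 0" for x using CR by (auto simp: case_prod_beta)
    have "sum ?f F \<le> C * (2 * 2)" if "finite F" for F :: "(nat \<times> nat) set"
    proof -
      have "finite (fst ` F \<union> snd ` F)" using that by simp
      then obtain N where "\<forall>x\<in>fst ` F \<union> snd ` F. x \<le> N"
        unfolding finite_nat_set_iff_bounded_le by blast
      then have N: "F \<subseteq> {..N} \<times> {..N}" by force
      have "sum ?f F \<le> sum ?f ({..N} \<times> {..N})"
        using N CR by (intro sum_mono2) (auto simp: case_prod_beta)
      also have "\<dots> \<le> (\<Sum>(i, j)\<in>{..N} \<times> {..N}. C * ((1/2) ^ i * (1/2) ^ j))"
        using le by (intro sum_mono) auto
      also have "\<dots> = C * ((\<Sum>i\<le>N. (1/2) ^ i) * (\<Sum>j\<le>N. (1/2) ^ j))"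
        unfolding sum.cartesian_product[symmetric] sum_product by (simp add: sum_distrib_left)
      also have "\<dots> \<le> C * (2 * 2)"
        using CR(1) geo by (intro mult_left_mono mult_mono) (auto intro: sum_nonneg)
      finally show ?thesis .
    qed
    then show "bdd_above (sum ?f ` {F. F \<subseteq> UNIV \<and> finite F})"
      by (intro bdd_aboveI[of _ "C * (2 * 2)"]) auto
  qed
  then show "g \<in> germs" using CR(2) unfolding germs_def
    by (intro CollectI exI[of _ "1 / (2 * R)"]) auto
qed

lemma germs_common_majorant:
  assumes "g \<in> germs" "h \<in> germs"
  obtains C R where "majorized C R g" "majorized C R h"
proof -
  obtain C R C' R' where "majorized C R g" "majorized C' R' h"
    using assms by (auto simp: germs_iff)
  then have "majorized (max C C') (max R R') g" "majorized (max C C') (max R R') h"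
    by (auto intro: majorized_mono)
  then show ?thesis by (rule that)
qed

lemma germ_coeff_simps [simp]:
  "germ_coeff (g + h) i j = germ_coeff g i j + germ_coeff h i j"
  "germ_coeff (g - h) i j = germ_coeff g i j - germ_coeff h i j"
  "germ_coeff (- g) i j = - germ_coeff g i j"
  by (auto simp: germ_coeff_def)

lemma germ_coeff_mult:
  "germ_coeff (g * h) i j = (\<Sum>b\<le>j. \<Sum>a\<le>i. germ_coeff g a b * germ_coeff h (i - a) (j - b))"
  by (simp add: germ_coeff_def fps_mult_nth fps_sum_nth atMost_atLeast0)

lemma germs_add: assumes "g \<in> germs" "h \<in> germs" shows "g + h \<in> germs"
proof -
  obtain C R where CR: "majorized C R g" "majorized C R h" using germs_common_majorant assms by blast
  have "norm (germ_coeff (g + h) i j) \<le> (2 * C) * R ^ (i + j)" for i j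
  proof -
    have "norm (germ_coeff (g + h) i j) \<le> norm (germ_coeff g i j) + norm (germ_coeff h i j)"
      by (simp add: norm_triangle_ineq)
    also have "\<dots> \<le> C * R ^ (i + j) + C * R ^ (i + j)"
      using CR by (intro add_mono) (auto simp: majorized_def)
    finally show ?thesis by simp
  qed
  then have "majorized (2 * C) R (g + h)" using CR(1) by (auto simp: majorized_def)
  then show ?thesis by (auto simp: germs_iff)
qed

lemma germs_mult: assumes "g \<in> germs" "h \<in> germs" shows "g * h \<in> germs"
proof -
  obtain C R where CR: "majorized C R g" "majorized C R h" using germs_common_majorant assms by blast
  then have C: "C \<ge> 0" "R \<ge> 1" by (auto simp: majorized_def)
  have "norm (germ_coeff (g * h) i j) \<le> (C * C) * (2 * R) ^ (i + j)" for i j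
  proof -
    have "norm (germ_coeff (g * h) i j)
        \<le> (\<Sum>b\<le>j. \<Sum>a\<le>i. norm (germ_coeff g a b * germ_coeff h (i - a) (j - b)))"
      unfolding germ_coeff_mult by (intro order_trans[OF norm_sum] sum_mono norm_sum)
    also have "\<dots> \<le> (\<Sum>b\<le>j. \<Sum>a\<le>i. C * C * R ^ (i + j))"
    proof (intro sum_mono)
      fix a b assume ab: "b \<in> {..j}" "a \<in> {..i}"
      have "norm (germ_coeff g a b * germ_coeff h (i - a) (j - b))
          \<le> (C * R ^ (a + b)) * (C * R ^ ((i - a) + (j - b)))"
        unfolding norm_mult using CR by (intro mult_mono) (auto simp: majorized_def)
      also have "\<dots> = C * C * R ^ ((a + b) + ((i - a) + (j - b)))"
        by (simp only: power_add) simp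
      also have "(a + b) + ((i - a) + (j - b)) = i + j" using ab by auto
      finally show "norm (germ_coeff g a b * germ_coeff h (i - a) (j - b)) \<le> C * C * R ^ (i + j)" .
    qed
    also have "\<dots> = (C * C * R ^ (i + j)) * (real (j + 1) * real (i + 1))" by simp
    also have "\<dots> \<le> (C * C * R ^ (i + j)) * (2 ^ j * 2 ^ i)"
    proof (intro mult_left_mono mult_mono)
      have *: "real (n + 1) \<le> 2 ^ n" for n by (induction n) auto
      show "real (j + 1) \<le> 2 ^ j" "real (i + 1) \<le> 2 ^ i" by (rule *)+
    qed (use C in auto)
    also have "\<dots> = (C * C) * (2 * R) ^ (i + j)"
      by (simp add: power_mult_distrib power_add)
    finally show ?thesis .
  qed
  then have "majorized (C * C) (2 * R) (g * h)" using C by (auto simp: majorized_def)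
  then show ?thesis by (auto simp: germs_iff)
qed

lemma germs_fps_const_iff:
  "fps_const c \<in> germs \<longleftrightarrow> (\<exists>C R. C \<ge> 0 \<and> R \<ge> 1 \<and> (\<forall>n. norm (c $ n) \<le> C * R ^ n))"
proof -
  have "majorized C R (fps_const c) \<longleftrightarrow> C \<ge> 0 \<and> R \<ge> 1 \<and> (\<forall>n. norm (c $ n) \<le> C * R ^ n)" for C R
  proof -
    have "C * R ^ (i + j) \<ge> 0" if "C \<ge> 0" "R \<ge> 1" for i j :: nat using that by simp
    then show ?thesis unfolding majorized_def germ_coeff_def
      by (auto simp: fps_const_def split: if_splits)
  qed
  then show ?thesis by (simp add: germs_iff)
qed

lemma germs_fps_const_poly: "fps_const (fps_of_poly p) \<in> germs"
proof -
  define C where "C = (\<Sum>n\<le>degree p. norm (coeff p n))"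
  have "norm (coeff p n) \<le> C * 1 ^ n" for n
  proof (cases "n \<le> degree p")
    case True then show ?thesis unfolding C_def by (auto intro!: member_le_sum)
  qed (auto simp: C_def coeff_eq_0 intro: sum_nonneg)
  moreover have "C \<ge> 0" by (auto simp: C_def intro: sum_nonneg)
  ultimately show ?thesis unfolding germs_fps_const_iff
    by (intro exI[of _ C] exI[of _ 1]) auto
qed

lemma germ_const_in_germs: "germ_const c \<in> germs"
  using germs_fps_const_poly[of "[:c:]"] by (simp add: germ_const_def fps_of_poly_const)

lemma germs_X: "fps_X \<in> germs"
proof -
  have "majorized 1 1 fps_X" by (auto simp: majorized_def germ_coeff_def fps_X_def)
  then show ?thesis by (auto simp: germs_iff)
qed

lemma germs_u: "fps_const fps_X \<in> germs"
  using germs_fps_const_poly[of "[:0, 1:]"] by (simp add: fps_of_poly_pCons)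

lemma germs_0: "0 \<in> germs" and germs_1: "1 \<in> germs"
  using germ_const_in_germs[of 0] germ_const_in_germs[of 1] by (simp_all add: germ_const_def)

lemma germs_uminus: "g \<in> germs \<Longrightarrow> - g \<in> germs"
  using germs_mult[OF germ_const_in_germs[of "-1"], of g] by (simp add: germ_const_def flip: fps_const_neg)

lemma germs_diff: "g \<in> germs \<Longrightarrow> h \<in> germs \<Longrightarrow> g - h \<in> germs"
  using germs_add[OF _ germs_uminus, of g h] by simp

lemma germs_power: "g \<in> germs \<Longrightarrow> g ^ n \<in> germs"
  by (induction n) (auto intro: germs_1 germs_mult)

lemma germs_sum: "(\<And>i. i \<in> I \<Longrightarrow> g i \<in> germs) \<Longrightarrow> sum g I \<in> germs"
  by (induction I rule: infinite_finite_induct) (auto intro: germs_0 germs_add)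

lemmas germs_intros = germs_0 germs_1 germs_add germs_diff germs_uminus germs_mult germs_power
  germs_sum germs_X germs_u germ_const_in_germs

lemma germs_fps_const_nth:
  assumes "g \<in> germs" shows "fps_const (g $ j) \<in> germs"
proof -
  obtain C R where "majorized C R g" using assms by (auto simp: germs_iff)
  then have CR: "C \<ge> 0" "R \<ge> 1" "\<And>i j. norm (g $ j $ i) \<le> C * R ^ (i + j)"
    by (auto simp: majorized_def germ_coeff_def)
  have "norm (g $ j $ n) \<le> (C * R ^ j) * R ^ n" for n
    using CR(3)[of j n] by (simp add: power_add mult_ac)
  then show ?thesis unfolding germs_fps_const_iff using CR
    by (intro exI[of _ "C * R ^ j"] exI[of _ R]) auto
qed

text \<open>
  Induction along the recursion for the coefficients of the inverse; the growth rate \<open>S\<close> is so large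
  that the sum over the earlier coefficients stays below the bound.
\<close>

lemma germs_fps_const_inverse:
  assumes "fps_const c \<in> germs" "c $ 0 \<noteq> 0" shows "fps_const (inverse c) \<in> germs"
proof -
  obtain C R where CR: "C \<ge> 0" "R \<ge> 1" "\<And>n. norm (c $ n) \<le> C * R ^ n"
    using assms(1) by (auto simp: germs_fps_const_iff)
  define K where "K = C / norm (c $ 0)"
  define S where "S = R * (2 + 2 * K)"
  define D where "D = 1 / norm (c $ 0)"
  have K: "K \<ge> 0" "S \<ge> R" "S > 0" "D \<ge> 0"
    using CR by (auto simp: K_def S_def D_def intro!: mult_pos_pos divide_nonneg_nonneg add_pos_nonneg)
  have "norm (inverse c $ n) \<le> D * S ^ n" for n
  proof (induction n rule: less_induct)
    case (less n)
    show ?case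
    proof (cases "n = 0")
      case True then show ?thesis by (simp add: D_def norm_inverse divide_inverse)
    next
      case False
      have "(c * inverse c) $ n = 0" using False assms(2) by (simp add: inverse_mult_eq_1')
      then have "c $ 0 * inverse c $ n = - (\<Sum>k\<in>{1..n}. c $ k * inverse c $ (n - k))"
        by (simp add: fps_mult_nth sum.atLeast_Suc_atMost eq_neg_iff_add_eq_0)
      then have "norm (c $ 0) * norm (inverse c $ n) = norm (\<Sum>k\<in>{1..n}. c $ k * inverse c $ (n - k))"
        by (metis norm_minus_cancel norm_mult)
      also have "\<dots> \<le> (\<Sum>k\<in>{1..n}. (C * R ^ k) * (D * S ^ (n - k)))"
        using less.IH CR by (intro order_trans[OF norm_sum] sum_mono) (auto simp: norm_mult intro!: mult_mono)
      also have "\<dots> = (\<Sum>k\<in>{1..n}. (C * D * S ^ n) * (R / S) ^ k)"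
        using K by (intro sum.cong refl) (simp add: power_diff power_divide field_simps)
      also have "\<dots> = (C * D * S ^ n) * (\<Sum>k\<in>{1..n}. (R / S) ^ k)" by (simp add: sum_distrib_left)
      also have "\<dots> \<le> (C * D * S ^ n) * (2 * (R / S))"
      proof (intro mult_left_mono geometric_sum_le)
        show "R / S \<le> 1 / 2" using CR K by (simp add: S_def field_simps)
      qed (use CR K in auto)
      also have "\<dots> = (D * S ^ n) * (C * (2 * (R / S)))" by simp
      also have "\<dots> \<le> (D * S ^ n) * norm (c $ 0)"
      proof (intro mult_left_mono)
        have "2 * (R / S) = 1 / (1 + K)" using CR(2) K(1) by (simp add: S_def divide_simps add_eq_0_iff)
        then have "C * (2 * (R / S)) = C / (1 + K)" by simp
        also have "\<dots> \<le> norm (c $ 0)"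
        proof -
          have "C = K * norm (c $ 0)" using assms(2) by (simp add: K_def)
          then have "C \<le> norm (c $ 0) * (1 + K)" by (simp add: algebra_simps)
          then show ?thesis using K(1) by (simp add: divide_le_eq)
        qed
        finally show "C * (2 * (R / S)) \<le> norm (c $ 0)" .
      qed (use K in auto)
      finally show ?thesis using assms(2) by (simp add: mult.commute)
    qed
  qed
  then show ?thesis unfolding germs_fps_const_iff using K CR(2)
    by (intro exI[of _ D] exI[of _ S]) auto
qed

section \<open>Weierstrass division\<close>

text \<open>
  Comparison of the coefficients of \<open>v^(j+m)\<close> in \<open>h = q * (v^m - A) + r\<close>. As the coefficients of
  \<open>A\<close> vanish at \<open>u = 0\<close>, the right-hand side only contains coefficients of \<open>q\<close> of lower degree
  in \<open>u\<close>, although their degree in \<open>v\<close> may be larger.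
\<close>

fun weierstrass_quotient :: "series2 \<Rightarrow> series2 \<Rightarrow> nat \<Rightarrow> nat \<Rightarrow> nat \<Rightarrow> complex" where
  "weierstrass_quotient h A m i j = germ_coeff h i (j + m) +
     (\<Sum>b<m. \<Sum>a\<in>{1..i}. germ_coeff A a b * weierstrass_quotient h A m (i - a) (j + m - b))"

declare weierstrass_quotient.simps [simp del]

text \<open>
  The growth rates in the two directions are chosen differently: the one in \<open>v\<close> is that of the data,
  and the rate \<open>T\<close> in \<open>u\<close> is so large that the recursive part of the definition takes up at most half
  of the bound.
\<close>

lemma weierstrass_quotient_majorized:
  assumes "majorized C S h" "majorized C S A"
  shows "\<exists>D T. majorized D T (Abs_fps (\<lambda>j. Abs_fps (\<lambda>i. weierstrass_quotient h A m i j)))"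
proof -
  let ?q = "weierstrass_quotient h A m"
  have C: "C \<ge> 0" "S \<ge> 1" "\<And>i j. norm (germ_coeff h i j) \<le> C * S ^ (i + j)"
    "\<And>i j. norm (germ_coeff A i j) \<le> C * S ^ (i + j)" using assms by (auto simp: majorized_def)
  define K where "K = C * S ^ m * real m"
  have K: "K \<ge> 0" using C by (simp add: K_def)
  define T where "T = S * (2 + 4 * K)"
  define D where "D = 2 * C * S ^ m"
  have T: "T \<ge> S" "T \<ge> 1" "T > 0" "D \<ge> 0"
  proof -
    have "S * 1 \<le> T" unfolding T_def using C K by (intro mult_left_mono) auto
    then show "T \<ge> S" "T \<ge> 1" "T > 0" using C by auto
  qed (use C in \<open>auto simp: D_def\<close>)
  have x: "0 \<le> S / T" "S / T \<le> 1 / 2" "K * (2 * (S / T)) \<le> 1 / 2"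
  proof -
    have *: "S / T = 1 / (2 + 4 * K)" using C K by (simp add: T_def)
    show "0 \<le> S / T" "S / T \<le> 1 / 2" "K * (2 * (S / T)) \<le> 1 / 2"
      unfolding * using K by (auto simp: field_simps)
  qed
  have bound: "norm (?q i j) \<le> D * (T ^ i * S ^ j)" for i j
  proof (induction i arbitrary: j rule: less_induct)
    case (less i)
    have "norm (\<Sum>b<m. \<Sum>a\<in>{1..i}. germ_coeff A a b * ?q (i - a) (j + m - b))
        \<le> (\<Sum>b<m. \<Sum>a\<in>{1..i}. (C * S ^ (a + b)) * (D * (T ^ (i - a) * S ^ (j + m - b))))"
      using less.IH C T
      by (intro order_trans[OF norm_sum] sum_mono) (auto simp: norm_mult intro!: mult_mono)
    also have "\<dots> = (\<Sum>b<m. \<Sum>a\<in>{1..i}. (C * D * S ^ (j + m) * T ^ i) * (S / T) ^ a)"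
    proof (intro sum.cong refl)
      fix a b assume ab: "b \<in> {..<m}" "a \<in> {1..i}"
      have "S ^ b * S ^ (j + m - b) = S ^ (j + m)" using ab by (simp flip: power_add)
      moreover have "T ^ (i - a) = T ^ i / T ^ a" using ab T by (simp add: power_diff)
      ultimately show "(C * S ^ (a + b)) * (D * (T ^ (i - a) * S ^ (j + m - b))) =
          (C * D * S ^ (j + m) * T ^ i) * (S / T) ^ a"
        by (simp add: power_add power_divide mult_ac)
    qed
    also have "\<dots> = (D * (T ^ i * S ^ j)) * (K * (\<Sum>a\<in>{1..i}. (S / T) ^ a))"
      by (simp add: K_def power_add sum_distrib_left[symmetric])
    also have "\<dots> \<le> (D * (T ^ i * S ^ j)) * (1 / 2)"
    proof (intro mult_left_mono)
      have "K * (\<Sum>a\<in>{1..i}. (S / T) ^ a) \<le> K * (2 * (S / T))"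
        using K x by (intro mult_left_mono geometric_sum_le) auto
      then show "K * (\<Sum>a\<in>{1..i}. (S / T) ^ a) \<le> 1 / 2" using x by simp
    qed (use T C in auto)
    finally have 1: "norm (\<Sum>b<m. \<Sum>a\<in>{1..i}. germ_coeff A a b * ?q (i - a) (j + m - b))
      \<le> (D * (T ^ i * S ^ j)) / 2" by simp
    have "norm (germ_coeff h i (j + m)) \<le> C * S ^ (i + (j + m))" by (rule C)
    also have "\<dots> = (C * S ^ m * S ^ j) * S ^ i" by (simp add: power_add)
    also have "\<dots> \<le> (C * S ^ m * S ^ j) * T ^ i" using C T by (intro mult_left_mono power_mono) auto
    also have "\<dots> = (D * (T ^ i * S ^ j)) / 2" by (simp add: D_def)
    finally have 2: "norm (germ_coeff h i (j + m)) \<le> (D * (T ^ i * S ^ j)) / 2" .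
    show ?case unfolding weierstrass_quotient.simps[of h A m i j]
      using order_trans[OF norm_triangle_ineq add_mono[OF 2 1]] by (simp add: mult_ac)
  qed
  have "norm (?q i j) \<le> D * T ^ (i + j)" for i j
  proof -
    have "D * (T ^ i * S ^ j) \<le> D * (T ^ i * T ^ j)"
      using T C by (intro mult_left_mono power_mono) auto
    then show ?thesis using bound[of i j] by (simp add: power_add)
  qed
  then have "majorized D T (Abs_fps (\<lambda>j. Abs_fps (\<lambda>i. ?q i j)))"
    using T by (auto simp: majorized_def germ_coeff_def)
  then show ?thesis by blast
qed

lemma weierstrass_division:
  assumes "h \<in> germs" "A \<in> germs" and deg: "\<And>b. b \<ge> m \<Longrightarrow> A $ b = 0" and vanish: "\<And>b. A $ b $ 0 = 0"
  shows "\<exists>q\<in>germs. h - q * (fps_X ^ m - A) \<in> germs \<and> (\<forall>j\<ge>m. (h - q * (fps_X ^ m - A)) $ j = 0)"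
proof -
  define q where "q = Abs_fps (\<lambda>j. Abs_fps (\<lambda>i. weierstrass_quotient h A m i j))"
  obtain C R where "majorized C R h" "majorized C R A" using germs_common_majorant assms by blast
  then have q: "q \<in> germs" unfolding q_def germs_iff by (rule weierstrass_quotient_majorized)
  have "(h - q * (fps_X ^ m - A)) $ (j + m) = 0" for j
  proof (rule fps_ext)
    fix i
    have "(q * A) $ (j + m) = (\<Sum>b\<in>{0..j+m}. A $ b * q $ (j + m - b))"
      by (subst mult.commute) (simp add: fps_mult_nth)
    also have "\<dots> = (\<Sum>b<m. A $ b * q $ (j + m - b))"
      by (intro sum.mono_neutral_right) (auto simp: deg)
    finally have "(q * A) $ (j + m) $ i = (\<Sum>b<m. \<Sum>a\<in>{0..i}. A $ b $ a * q $ (j + m - b) $ (i - a))"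
      by (simp add: fps_sum_nth fps_mult_nth)
    also have "\<dots> = (\<Sum>b<m. \<Sum>a\<in>{1..i}. A $ b $ a * q $ (j + m - b) $ (i - a))"
      by (simp add: sum.atLeast_Suc_atMost vanish)
    finally have "q $ j $ i = h $ (j + m) $ i + (q * A) $ (j + m) $ i"
      by (simp add: q_def weierstrass_quotient.simps[of h A m i j] germ_coeff_def)
    moreover have "(q * fps_X ^ m) $ (j + m) = q $ j" by (simp add: fps_X_power_mult_right_nth)
    ultimately show "(h - q * (fps_X ^ m - A)) $ (j + m) $ i = 0 $ i"
      by (simp add: algebra_simps)
  qed
  then have "\<forall>j\<ge>m. (h - q * (fps_X ^ m - A)) $ j = 0"
    by (metis le_add_diff_inverse2)
  moreover have "h - q * (fps_X ^ m - A) \<in> germs" by (intro germs_intros assms q)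
  ultimately show ?thesis using q by blast
qed

section \<open>Substitution of a parametrization into germs\<close>

text \<open>
  The value of \<open>g\<close> at \<open>u = \<alpha>(t)\<close>, \<open>v = \<beta>(t)\<close>. As \<open>\<beta>\<close> has positive order, the coefficient of \<open>t^n\<close>
  only involves the terms with \<open>j \<le> n\<close>.
\<close>

definition germ_subst :: "complex fps \<Rightarrow> complex fps \<Rightarrow> series2 \<Rightarrow> complex fps" where
  "germ_subst \<alpha> \<beta> g = Abs_fps (\<lambda>n. (\<Sum>j\<le>n. (g $ j oo \<alpha>) * \<beta> ^ j) $ n)"

lemma mult_power_nth_low:
  assumes "\<beta> $ 0 = 0" "n < j" shows "(a * (\<beta>::complex fps) ^ j) $ n = 0"
  unfolding fps_mult_nth using startsby_zero_power_prefix[OF assms(1), of j] assms(2)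
  by (intro sum.neutral) auto

context
  fixes \<alpha> \<beta> :: "complex fps"
  assumes \<alpha>0: "\<alpha> $ 0 = 0" and \<beta>0: "\<beta> $ 0 = 0"
begin

text \<open>
  Any longer partial sum gives the same coefficient, which makes a common truncation possible for
  all factors in the proof of multiplicativity.
\<close>

lemma germ_subst_nth:
  assumes "n \<le> N" shows "germ_subst \<alpha> \<beta> g $ n = (\<Sum>j\<le>N. (g $ j oo \<alpha>) * \<beta> ^ j) $ n"
proof -
  have "(\<Sum>j\<le>N. ((g $ j oo \<alpha>) * \<beta> ^ j) $ n) = (\<Sum>j\<le>n. ((g $ j oo \<alpha>) * \<beta> ^ j) $ n)"
    using assms by (intro sum.mono_neutral_right) (auto intro: mult_power_nth_low \<beta>0)
  then show ?thesis by (simp add: germ_subst_def fps_sum_nth)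
qed

lemma germ_subst_add: "germ_subst \<alpha> \<beta> (g + h) = germ_subst \<alpha> \<beta> g + germ_subst \<alpha> \<beta> h"
  by (rule fps_ext)
     (simp add: germ_subst_def fps_compose_add_distrib distrib_right sum.distrib fps_sum_nth)

lemma germ_subst_mult: "germ_subst \<alpha> \<beta> (g * h) = germ_subst \<alpha> \<beta> g * germ_subst \<alpha> \<beta> h"
proof (rule fps_ext)
  fix n
  let ?T = "\<lambda>g. \<Sum>j\<le>n. (g $ j oo \<alpha>) * \<beta> ^ j"
  let ?t = "\<lambda>i j. (g $ i oo \<alpha>) * (h $ j oo \<alpha>) * \<beta> ^ (i + j)"
  have "(germ_subst \<alpha> \<beta> g * germ_subst \<alpha> \<beta> h) $ n = (?T g * ?T h) $ n"
    unfolding fps_mult_nth by (intro sum.cong refl arg_cong2[of _ _ _ _ "(*)"] germ_subst_nth) auto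
  also have "?T g * ?T h = (\<Sum>(i, j)\<in>{..n} \<times> {..n}. ?t i j)"
    by (simp add: sum_product sum.cartesian_product power_add mult_ac)
  also have "\<dots> $ n = (\<Sum>(i, j)\<in>{..n} \<times> {..n}. ?t i j $ n)"
    by (simp add: fps_sum_nth case_prod_beta)
  also have "\<dots> = (\<Sum>(i, j)\<in>{(i, j). i + j \<le> n}. ?t i j $ n)"
    by (intro sum.mono_neutral_right) (auto intro: mult_power_nth_low \<beta>0)
  also have "\<dots> = (\<Sum>k\<le>n. \<Sum>i\<le>k. ?t i (k - i) $ n)"
    by (rule sum.triangle_reindex_eq)
  also have "\<dots> = germ_subst \<alpha> \<beta> (g * h) $ n"
    by (simp add: germ_subst_def fps_sum_nth fps_mult_nth[of g h] fps_compose_sum_distrib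
        fps_compose_mult_distrib[OF \<alpha>0] sum_distrib_right atMost_atLeast0)
  finally show "germ_subst \<alpha> \<beta> (g * h) $ n = (germ_subst \<alpha> \<beta> g * germ_subst \<alpha> \<beta> h) $ n" by simp
qed

lemma germ_subst_const: "germ_subst \<alpha> \<beta> (fps_const c) = c oo \<alpha>"
proof (rule fps_ext)
  fix n
  have "(\<Sum>j\<le>n. ((fps_const c $ j oo \<alpha>) * \<beta> ^ j) $ n) = (\<Sum>j\<le>n. if j = 0 then (c oo \<alpha>) $ n else 0)"
    by (intro sum.cong) auto
  then show "germ_subst \<alpha> \<beta> (fps_const c) $ n = (c oo \<alpha>) $ n"
    by (simp add: germ_subst_def fps_sum_nth)
qed

lemma germ_subst_X: "germ_subst \<alpha> \<beta> fps_X = \<beta>"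
proof (rule fps_ext)
  fix n
  have "(\<Sum>j\<le>n. ((fps_X $ j oo \<alpha>) * \<beta> ^ j) $ n) = (\<Sum>j\<le>n. if j = 1 then \<beta> $ n else 0)"
    by (intro sum.cong) auto
  then show "germ_subst \<alpha> \<beta> fps_X $ n = \<beta> $ n"
    using \<beta>0 by (cases "n = 0") (auto simp: germ_subst_def fps_sum_nth)
qed

lemma germ_subst_germ_const: "germ_subst \<alpha> \<beta> (germ_const c) = fps_const c"
  by (simp add: germ_const_def germ_subst_const)

lemma germ_subst_0: "germ_subst \<alpha> \<beta> 0 = 0" and germ_subst_1: "germ_subst \<alpha> \<beta> 1 = 1"
  using germ_subst_germ_const[of 0] germ_subst_germ_const[of 1] by (simp_all add: germ_const_def)

lemma germ_subst_uminus: "germ_subst \<alpha> \<beta> (- g) = - germ_subst \<alpha> \<beta> g"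
  using germ_subst_add[of g "- g"] by (simp add: germ_subst_0 eq_neg_iff_add_eq_0 add.commute)

lemma germ_subst_diff: "germ_subst \<alpha> \<beta> (g - h) = germ_subst \<alpha> \<beta> g - germ_subst \<alpha> \<beta> h"
  using germ_subst_add[of g "- h"] by (simp add: germ_subst_uminus)

lemma germ_subst_power: "germ_subst \<alpha> \<beta> (g ^ n) = germ_subst \<alpha> \<beta> g ^ n"
  by (induction n) (auto simp: germ_subst_1 germ_subst_mult)

lemma germ_subst_sum: "germ_subst \<alpha> \<beta> (sum g I) = (\<Sum>i\<in>I. germ_subst \<alpha> \<beta> (g i))"
  by (induction I rule: infinite_finite_induct) (auto simp: germ_subst_0 germ_subst_add)

lemmas germ_subst_simps = germ_subst_0 germ_subst_1 germ_subst_add germ_subst_diff germ_subst_uminus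
  germ_subst_mult germ_subst_power germ_subst_sum germ_subst_X germ_subst_const germ_subst_germ_const

end

section \<open>Numerical semigroups\<close>

lemma generated2_cofinite:
  assumes "coprime m k" "m > 0" "x \<ge> m * k"
  shows "x \<in> generated2 m k"
proof (cases "k = 0")
  case True
  then have "m = 1" using assms by simp
  then have "x = x * m + 0 * k" by simp
  then show ?thesis unfolding generated2_def by blast
next
  case False
  then obtain a b where ab: "k * a = m * b + 1"
    using assms(1,2) coprime_bezout_strong[of k m] by (metis coprime_commute mult.commute One_nat_def bezout_nat coprime_imp_gcd_eq_1)
  define l where "l = (a * x) mod m"
  have l: "l < m" using assms(2) by (simp add: l_def)
  have "(k * l) mod m = (k * (a * x)) mod m" by (simp add: l_def mod_mult_right_eq)
  also have "k * (a * x) = m * (b * x) + x" using ab by (metis add_mult_distrib mult.assoc mult_1)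
  finally have eq: "(k * l) mod m = x mod m" by simp
  have "k * l \<le> m * k" using mult_le_mono2[of l m k] l by (simp add: mult.commute)
  then have le: "k * l \<le> x" using assms(3) by (rule order_trans)
  have "m dvd x - k * l" by (rule iffD1[OF mod_eq_dvd_iff_nat[OF le] eq[symmetric]])
  then obtain c where "x - k * l = m * c" by blast
  then have "x = c * m + l * k" using le by (simp add: mult.commute)
  then show ?thesis by (auto simp: generated2_def)
qed

lemma generated2_add: "x \<in> generated2 m k \<Longrightarrow> y \<in> generated2 m k \<Longrightarrow> x + y \<in> generated2 m k"
proof -
  assume "x \<in> generated2 m k" "y \<in> generated2 m k"
  then obtain a b c d where "x = a * m + b * k" "y = c * m + d * k" by (auto simp: generated2_def)
  then have "x + y = (a + c) * m + (b + d) * k" by (simp add: algebra_simps)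
  then show ?thesis unfolding generated2_def by blast
qed

text \<open>
  Below a large bound \<open>c + n\<close> the semigroup has exactly \<open>n\<close> more elements than its shift by \<open>n\<close>,
  and above the bound they agree.
\<close>

lemma card_semigroup_minus_shift:
  fixes \<Gamma> :: "nat set"
  assumes cofinite: "\<And>x. x \<ge> c \<Longrightarrow> x \<in> \<Gamma>" and closed: "\<And>x. x \<in> \<Gamma> \<Longrightarrow> n + x \<in> \<Gamma>"
  shows "finite (\<Gamma> - (+) n ` \<Gamma>)" "card (\<Gamma> - (+) n ` \<Gamma>) = n"
proof -
  let ?S = "(+) n ` \<Gamma>"
  have bound: "\<Gamma> - ?S \<subseteq> {..<c + n}"
  proof
    fix x assume x: "x \<in> \<Gamma> - ?S"
    show "x \<in> {..<c + n}"
    proof (rule ccontr)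
      assume "x \<notin> {..<c + n}"
      then have "x = n + (x - n)" "x - n \<in> \<Gamma>" using cofinite by auto
      then show False using x by blast
    qed
  qed
  then show "finite (\<Gamma> - ?S)" by (rule finite_subset) simp
  have sub: "?S \<subseteq> \<Gamma>" using closed by auto
  have "\<Gamma> \<inter> {..<c + n} = (\<Gamma> - ?S) \<union> (?S \<inter> {..<c + n})" using bound sub by auto
  then have "card (\<Gamma> \<inter> {..<c + n}) = card ((\<Gamma> - ?S) \<union> (?S \<inter> {..<c + n}))" by simp
  also have "\<dots> = card (\<Gamma> - ?S) + card (?S \<inter> {..<c + n})"
    using bound by (intro card_Un_disjoint) (auto intro: finite_subset)
  also have "?S \<inter> {..<c + n} = (+) n ` (\<Gamma> \<inter> {..<c})" by auto
  also have "card \<dots> = card (\<Gamma> \<inter> {..<c})" by (intro card_image) simp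
  finally have 1: "card (\<Gamma> \<inter> {..<c + n}) = card (\<Gamma> - ?S) + card (\<Gamma> \<inter> {..<c})" .
  have "\<Gamma> \<inter> {..<c + n} = (\<Gamma> \<inter> {..<c}) \<union> {c..<c + n}" using cofinite by auto
  then have "card (\<Gamma> \<inter> {..<c + n}) = card ((\<Gamma> \<inter> {..<c}) \<union> {c..<c + n})" by simp
  also have "\<dots> = card (\<Gamma> \<inter> {..<c}) + n" by (subst card_Un_disjoint) auto
  finally show "card (\<Gamma> - ?S) = n" using 1 by simp
qed

section \<open>Branches given by a Weierstrass polynomial and a parametrization\<close>

lemma germs_fps_const_shift:
  assumes "fps_const c \<in> germs" shows "fps_const (fps_shift M c) \<in> germs"
proof -
  obtain C R where CR: "C \<ge> 0" "R \<ge> 1" "\<And>n. norm (c $ n) \<le> C * R ^ n"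
    using assms by (auto simp: germs_fps_const_iff)
  have "norm (fps_shift M c $ n) \<le> (C * R ^ M) * R ^ n" for n
    using CR(3)[of "n + M"] by (simp add: power_add mult_ac)
  then show ?thesis unfolding germs_fps_const_iff using CR
    by (intro exI[of _ "C * R ^ M"] exI[of _ R]) auto
qed

lemma fps_X_power_shift:
  fixes c :: "complex fps"
  assumes "c = 0 \<or> M \<le> subdegree c" shows "c = fps_X ^ M * fps_shift M c"
proof (rule fps_ext)
  fix n
  have "c $ n = 0" if "n < M"
  proof (cases "c = 0")
    case False
    then have "n < subdegree c" using assms that by linarith
    then show ?thesis by (rule nth_less_subdegree_zero)
  qed simp
  then show "c $ n = (fps_X ^ M * fps_shift M c) $ n" by (simp add: fps_X_power_mult_nth)
qed

text \<open>
  The branch \<open>f = v^m - A\<close> is a Weierstrass polynomial with formal parametrization \<open>(\<alpha>, \<beta>)\<close>. The germ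
  \<open>w\<close>, whose order \<open>k\<close> along the branch is prime to \<open>m\<close>, replaces \<open>v\<close>: at a double point it is
  \<open>v\<close> minus the even part of its expansion. The last assumption says that the powers of \<open>w\<close> span
  the same remainders as those of \<open>v\<close>.
\<close>

locale branch =
  fixes A w :: series2 and m k :: nat and \<alpha> \<beta> :: "complex fps"
  assumes m: "m > 0" and coprime: "coprime m k"
    and A: "A \<in> germs" "\<And>b. b \<ge> m \<Longrightarrow> A $ b = 0" "\<And>b. A $ b $ 0 = 0"
    and \<alpha>: "subdegree \<alpha> = m" and \<beta>: "\<beta> $ 0 = 0"
    and on_curve: "germ_subst \<alpha> \<beta> (fps_X ^ m - A) = 0"
    and w: "w \<in> germs" "germ_subst \<alpha> \<beta> w \<noteq> 0" "subdegree (germ_subst \<alpha> \<beta> w) = k"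
    and basis: "\<And>r. r \<in> germs \<Longrightarrow> (\<And>j. j \<ge> m \<Longrightarrow> r $ j = 0) \<Longrightarrow>
      \<exists>\<rho>. (\<forall>i. fps_const (\<rho> i) \<in> germs) \<and> r = (\<Sum>i<m. fps_const (\<rho> i) * w ^ i)"
begin

abbreviation "f \<equiv> fps_X ^ m - A"
abbreviation "\<Phi> \<equiv> germ_subst \<alpha> \<beta>"
abbreviation "\<Gamma> \<equiv> generated2 m k"

lemma \<alpha>0: "\<alpha> $ 0 = 0" and \<alpha>_nz: "\<alpha> \<noteq> 0"
  using \<alpha> m by (auto intro: nth_less_subdegree_zero)

lemmas \<Phi>_simps = germ_subst_simps[OF \<alpha>0 \<beta>]

lemma f_germ: "f \<in> germs" by (intro germs_intros A)

lemma \<Phi>_f_mult: "\<Phi> (f * g) = 0" "\<Phi> (g * f) = 0"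
  using on_curve by (simp_all add: germ_subst_mult[OF \<alpha>0 \<beta>])

lemma subdegree_u: "c \<noteq> 0 \<Longrightarrow> (c oo \<alpha>) \<noteq> 0 \<and> subdegree (c oo \<alpha>) = subdegree c * m"
  using \<alpha>0 \<alpha>_nz \<alpha> by (simp add: fps_compose_eq_0_iff)

lemma distinct_residues:
  assumes "i < m" "j < m" "x * m + i * k = y * m + j * k" shows "i = j"
proof -
  have aux: False if "i < j" "j < m" "x * m + i * k = y * m + j * k" for i j x y
  proof -
    have "x * m = y * m + (j - i) * k"
      using that by (simp add: diff_mult_distrib)
    then have "m dvd y * m + (j - i) * k" by (metis dvd_triv_right)
    then have "m dvd (j - i) * k" by (simp add: dvd_add_right_iff)
    then have "m dvd j - i" using coprime by (simp add: coprime_dvd_mult_left_iff)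
    then show False using that by (auto dest: dvd_imp_le)
  qed
  show ?thesis using aux[of i j x y] aux[of j i y x] assms by (metis linorder_neqE_nat)
qed

text \<open>
  The \<open>i\<close>-th summand has order congruent to \<open>i * k\<close> modulo \<open>m\<close>, so no two summands have the same
  order.
\<close>

lemma order_normal_form:
  assumes "r = (\<Sum>i<m. fps_const (\<rho> i) * w ^ i)" "i0 < m" "\<rho> i0 \<noteq> 0"
  shows "\<Phi> r \<noteq> 0" "subdegree (\<Phi> r) \<in> \<Gamma>"
    "\<And>i. i < m \<Longrightarrow> \<rho> i \<noteq> 0 \<Longrightarrow> subdegree (\<Phi> r) \<le> subdegree (\<rho> i) * m + i * k"
proof -
  define I where "I = {i. i < m \<and> \<rho> i \<noteq> 0}"
  define t where "t i = (\<rho> i oo \<alpha>) * \<Phi> w ^ i" for i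
  have I: "finite I" "I \<noteq> {}" using assms by (auto simp: I_def)
  have t: "t i \<noteq> 0" "subdegree (t i) = subdegree (\<rho> i) * m + i * k" if "i \<in> I" for i
    using subdegree_u[of "\<rho> i"] that w(2,3) by (auto simp: t_def I_def subdegree_power)
  have "\<Phi> r = (\<Sum>i<m. t i)" by (simp add: assms(1) \<Phi>_simps t_def)
  also have "\<dots> = (\<Sum>i\<in>I. t i)"
    by (intro sum.mono_neutral_right) (auto simp: I_def t_def)
  finally have sum: "\<Phi> r = (\<Sum>i\<in>I. t i)" .
  have "inj_on (\<lambda>i. subdegree (t i)) I"
    using t(2) distinct_residues by (auto simp: inj_on_def I_def)
  then have *: "(\<Sum>i\<in>I. t i) \<noteq> 0 \<and> subdegree (\<Sum>i\<in>I. t i) = Min ((\<lambda>i. subdegree (t i)) ` I)"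
    using I t by (intro subdegree_sum_distinct) auto
  then show "\<Phi> r \<noteq> 0" using sum by simp
  have "Min ((\<lambda>i. subdegree (t i)) ` I) \<in> (\<lambda>i. subdegree (t i)) ` I" using I by (intro Min_in) auto
  then show "subdegree (\<Phi> r) \<in> \<Gamma>"
    using * sum t(2) by (auto simp: generated2_def)
  fix i assume "i < m" "\<rho> i \<noteq> 0"
  then have i: "i \<in> I" by (auto simp: I_def)
  then have "Min ((\<lambda>i. subdegree (t i)) ` I) \<le> subdegree (t i)" using I by (intro Min_le) auto
  then show "subdegree (\<Phi> r) \<le> subdegree (\<rho> i) * m + i * k" using * sum t(2)[OF i] by simp
qed

lemma normal_form:
  assumes "h \<in> germs"
  obtains q \<rho> where "q \<in> germs" "\<And>i. fps_const (\<rho> i) \<in> germs"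
    "h = q * f + (\<Sum>i<m. fps_const (\<rho> i) * w ^ i)"
proof -
  obtain q where q: "q \<in> germs" "h - q * f \<in> germs" "\<forall>j\<ge>m. (h - q * f) $ j = 0"
    using weierstrass_division[OF assms A(1), of m] A(2,3) by blast
  then obtain \<rho> where "\<forall>i. fps_const (\<rho> i) \<in> germs" "h - q * f = (\<Sum>i<m. fps_const (\<rho> i) * w ^ i)"
    using basis[of "h - q * f"] by blast
  then show ?thesis using q by (intro that[of q \<rho>]) (auto simp: algebra_simps)
qed

lemma kernel:
  assumes "h \<in> germs" "\<Phi> h = 0" shows "germ_dvd f h"
proof -
  obtain q \<rho> where q: "q \<in> germs" "h = q * f + (\<Sum>i<m. fps_const (\<rho> i) * w ^ i)"
    using normal_form[OF assms(1)] by metis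
  have "\<Phi> (\<Sum>i<m. fps_const (\<rho> i) * w ^ i) = 0"
    using assms(2) unfolding q(2) by (simp add: germ_subst_add[OF \<alpha>0 \<beta>] \<Phi>_f_mult)
  then have "\<forall>i<m. \<rho> i = 0" using order_normal_form(1)[OF refl] by blast
  then show ?thesis using q by (auto simp: germ_dvd_def mult.commute)
qed

lemma germ_dvd_iff: assumes "h \<in> germs" shows "germ_dvd f h \<longleftrightarrow> \<Phi> h = 0"
  using kernel[OF assms] \<Phi>_f_mult by (auto simp: germ_dvd_def)

lemma order_in_semigroup:
  assumes "h \<in> germs" "\<Phi> h \<noteq> 0" shows "subdegree (\<Phi> h) \<in> \<Gamma>"
proof -
  obtain q \<rho> where q: "q \<in> germs" "h = q * f + (\<Sum>i<m. fps_const (\<rho> i) * w ^ i)"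
    using normal_form[OF assms(1)] by metis
  have eq: "\<Phi> h = \<Phi> (\<Sum>i<m. fps_const (\<rho> i) * w ^ i)"
    unfolding q(2) by (simp add: germ_subst_add[OF \<alpha>0 \<beta>] \<Phi>_f_mult)
  have "\<exists>i<m. \<rho> i \<noteq> 0"
  proof (rule ccontr)
    assume "\<not> (\<exists>i<m. \<rho> i \<noteq> 0)"
    then show False using assms(2) eq by (simp add: \<Phi>_simps)
  qed
  then show ?thesis using order_normal_form(2)[OF refl] unfolding eq by blast
qed

text \<open>
  The power series ring is a domain, so one factor of \<open>f\<close> is in the kernel of \<open>\<Phi>\<close> and hence a
  multiple of \<open>f\<close>; the other one is a unit.
\<close>

lemma irreducible: "germ_irreducible f"
proof -
  have f0: "f $ 0 $ 0 = 0" using m A(3) by simp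
  have nonunit: "\<not> germ_unit f"
  proof
    assume "germ_unit f"
    then obtain h where "f * h = 1" by (auto simp: germ_unit_def)
    then have "(f * h) $ 0 $ 0 = 1" by simp
    then show False using f0 by (simp add: fps_mult_nth)
  qed
  have "f $ m = 1" using A(2) by simp
  then have nz: "f \<noteq> 0" by (metis fps_zero_nth zero_neq_one)
  have unit: "germ_unit b" if ab: "a \<in> germs" "b \<in> germs" "f = a * b" "\<Phi> a = 0" for a b
  proof -
    obtain h where h: "h \<in> germs" "a = f * h" using kernel[OF ab(1,4)] by (auto simp: germ_dvd_def)
    have "f = f * (h * b)" using ab(3) h(2) by (simp only: mult.assoc)
    then have "h * b = 1" using nz by (metis mult_left_cancel mult_1_right)
    then have "b * h = 1" by (simp add: mult.commute)
    then show ?thesis using ab(2) h(1) unfolding germ_unit_def by blast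
  qed
  have "germ_unit a \<or> germ_unit b" if ab: "a \<in> germs" "b \<in> germs" "f = a * b" for a b
  proof -
    have "\<Phi> a * \<Phi> b = 0" using on_curve ab(3) by (simp add: germ_subst_mult[OF \<alpha>0 \<beta>])
    then show ?thesis using unit[of a b] unit[of b a] ab by (auto simp: mult.commute)
  qed
  then show ?thesis using f_germ nz nonunit by (auto simp: germ_irreducible_def)
qed

text \<open>
  Modulo \<open>f\<close> the germs are a free module of rank \<open>m\<close> over \<open>\<complex>{u}\<close>, so the \<open>m + 1\<close> powers
  \<open>1, g, ..., g^m\<close> satisfy a linear relation over \<open>\<complex>{u}\<close>. After cancelling a power of \<open>g\<close>, which
  is possible as \<open>\<Phi> g\<close> is not 0, its constant term is nonzero and, modulo \<open>f\<close>, a multiple of \<open>g\<close>;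
  it is a power of \<open>u\<close> times a unit.
\<close>

lemma u_power_in_ideal:
  assumes g: "g \<in> germs" "\<Phi> g \<noteq> 0"
  obtains M a b where "a \<in> germs" "b \<in> germs" "fps_const (fps_X ^ M) = a * f + b * g"
proof -
  have "\<exists>q \<rho>. q \<in> germs \<and> (\<forall>i. fps_const (\<rho> i) \<in> germs) \<and> g ^ n = q * f + (\<Sum>i<m. fps_const (\<rho> i) * w ^ i)" for n
    by (rule normal_form[OF germs_power[OF g(1), of n]]) blast
  then have "\<forall>n. \<exists>q \<rho>. q \<in> germs \<and> (\<forall>i. fps_const (\<rho> i) \<in> germs) \<and> g ^ n = q * f + (\<Sum>i<m. fps_const (\<rho> i) * w ^ i)"
    by blast
  from choice[OF this] obtain q where
    "\<forall>n. \<exists>\<rho>. q n \<in> germs \<and> (\<forall>i. fps_const (\<rho> i) \<in> germs) \<and> g ^ n = q n * f + (\<Sum>i<m. fps_const (\<rho> i) * w ^ i)"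
    by blast
  from choice[OF this] obtain \<rho> where q: "\<And>n. q n \<in> germs" "\<And>n i. fps_const (\<rho> n i) \<in> germs"
    "\<And>n. g ^ n = q n * f + (\<Sum>i<m. fps_const (\<rho> n i) * w ^ i)" by blast
  let ?R = "{c. fps_const c \<in> germs}"
  have "\<exists>c. (\<forall>n\<in>{..m}. c n \<in> ?R) \<and> (\<exists>n\<in>{..m}. c n \<noteq> 0) \<and> (\<forall>i\<in>{..<m}. (\<Sum>n\<in>{..m}. c n * \<rho> n i) = 0)"
  proof (intro exists_linear_relation)
    show "a * b \<in> ?R" "a - b \<in> ?R" if "a \<in> ?R" "b \<in> ?R" for a b
      using germs_mult[of "fps_const a" "fps_const b"] germs_diff[of "fps_const a" "fps_const b"] that by auto
  qed (use q germs_0 germs_1 in auto)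
  then obtain c where c: "\<And>n. n \<le> m \<Longrightarrow> fps_const (c n) \<in> germs" "\<exists>n\<le>m. c n \<noteq> 0"
    "\<And>i. i < m \<Longrightarrow> (\<Sum>n\<le>m. c n * \<rho> n i) = 0" by auto
  \<comment> \<open>the smallest power of \<open>g\<close> in the relation, which can be cancelled\<close>
  define n0 where "n0 = (LEAST n. n \<le> m \<and> c n \<noteq> 0)"
  have n0: "n0 \<le> m" "c n0 \<noteq> 0" using LeastI_ex[OF c(2)] by (auto simp: n0_def)
  have below: "c n = 0" if "n < n0" for n using not_less_Least[of n "\<lambda>n. n \<le> m \<and> c n \<noteq> 0"] that n0(1)
    by (auto simp: n0_def)
  define s where "s = (\<Sum>n\<in>{Suc n0..m}. fps_const (c n) * g ^ (n - Suc n0))"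
  have s_germ: "s \<in> germs" unfolding s_def by (intro germs_intros g c) auto
  have "(fps_const (c n0) + s * g) * g ^ n0 = (\<Sum>n\<le>m. fps_const (c n) * g ^ n)"
  proof -
    have "(\<Sum>n\<le>m. fps_const (c n) * g ^ n) = (\<Sum>n\<in>{n0..m}. fps_const (c n) * g ^ n)"
      by (intro sum.mono_neutral_right) (auto intro: below)
    also have "\<dots> = fps_const (c n0) * g ^ n0 + (\<Sum>n\<in>{Suc n0..m}. fps_const (c n) * g ^ n)"
      using n0 by (simp add: sum.atLeast_Suc_atMost)
    also have "(\<Sum>n\<in>{Suc n0..m}. fps_const (c n) * g ^ n) = s * g * g ^ n0"
      unfolding s_def sum_distrib_right
    proof (intro sum.cong refl)
      fix n assume "n \<in> {Suc n0..m}"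
      then have "n = (n - Suc n0) + 1 + n0" by auto
      then have "g ^ n = g ^ (n - Suc n0) * g * g ^ n0" by (metis power_add power_one_right)
      then show "fps_const (c n) * g ^ n = fps_const (c n) * g ^ (n - Suc n0) * g * g ^ n0"
        by (simp add: mult.assoc)
    qed
    finally show ?thesis by (simp add: distrib_right)
  qed
  also have "\<dots> = (\<Sum>n\<le>m. fps_const (c n) * q n) * f + (\<Sum>n\<le>m. \<Sum>i<m. fps_const (c n * \<rho> n i) * w ^ i)"
    by (simp add: q(3) distrib_left sum.distrib sum_distrib_left sum_distrib_right mult.assoc
        flip: fps_const_mult)
  also have "(\<Sum>n\<le>m. \<Sum>i<m. fps_const (c n * \<rho> n i) * w ^ i) = (\<Sum>i<m. fps_const (\<Sum>n\<le>m. c n * \<rho> n i) * w ^ i)"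
  proof (subst sum.swap, intro sum.cong refl)
    fix i
    have *: "(\<Sum>n\<in>N. fps_const (x n)) = fps_const (\<Sum>n\<in>N. x n)" for x :: "nat \<Rightarrow> complex fps" and N
      by (induction N rule: infinite_finite_induct) auto
    show "(\<Sum>n\<le>m. fps_const (c n * \<rho> n i) * w ^ i) = fps_const (\<Sum>n\<le>m. c n * \<rho> n i) * w ^ i"
      by (simp only: sum_distrib_right[symmetric] *)
  qed
  also have "\<dots> = 0" using c(3) by simp
  finally have "\<Phi> ((fps_const (c n0) + s * g) * g ^ n0) = 0" by (simp add: \<Phi>_f_mult)
  then have "\<Phi> (fps_const (c n0) + s * g) * \<Phi> g ^ n0 = 0"
    by (simp add: germ_subst_mult[OF \<alpha>0 \<beta>] germ_subst_power[OF \<alpha>0 \<beta>])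
  then have "\<Phi> (fps_const (c n0) + s * g) = 0" using g(2) by simp
  then obtain h where h: "h \<in> germs" "fps_const (c n0) + s * g = f * h"
    using kernel[of "fps_const (c n0) + s * g"] c(1)[OF n0(1)] s_germ g(1)
    by (auto simp: germ_dvd_def intro: germs_intros)
  define M where "M = subdegree (c n0)"
  define U where "U = fps_shift M (c n0)"
  have U: "c n0 = fps_X ^ M * U" unfolding U_def by (rule fps_X_power_shift) (simp add: M_def)
  have U0: "U $ 0 \<noteq> 0" using n0(2) by (simp add: U_def M_def)
  have U_germ: "fps_const (inverse U) \<in> germs"
    using germs_fps_const_inverse[OF germs_fps_const_shift] c(1)[OF n0(1)] U0 by (simp add: U_def)
  have "fps_const (fps_X ^ M) = fps_const (c n0) * fps_const (inverse U)"
    using U0 by (simp add: U mult.assoc inverse_mult_eq_1')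
  also have "fps_const (c n0) = f * h - s * g" using h(2) by (simp add: algebra_simps)
  finally have "fps_const (fps_X ^ M) = (h * fps_const (inverse U)) * f + (- (s * fps_const (inverse U))) * g"
    by (simp add: algebra_simps)
  then show ?thesis using h(1) s_germ U_germ
    by (intro that[of "h * fps_const (inverse U)" "- (s * fps_const (inverse U))" M])
       (auto intro: germs_intros)
qed

definition ideal :: "series2 \<Rightarrow> series2 set" where
  "ideal g = {a * f + b * g | a b. a \<in> germs \<and> b \<in> germs}"

lemma ideal_closed:
  assumes "g \<in> germs"
  shows "0 \<in> ideal g" "x \<in> ideal g \<Longrightarrow> y \<in> ideal g \<Longrightarrow> x + y \<in> ideal g"
    "x \<in> ideal g \<Longrightarrow> h \<in> germs \<Longrightarrow> h * x \<in> ideal g" "ideal g \<subseteq> germs"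
proof -
  show "0 \<in> ideal g" unfolding ideal_def
    by (intro CollectI exI[of _ 0]) (auto intro: germs_intros)
  show "x + y \<in> ideal g" if xy: "x \<in> ideal g" "y \<in> ideal g"
  proof -
    obtain a b c d where "a \<in> germs" "b \<in> germs" "c \<in> germs" "d \<in> germs"
      "x = a * f + b * g" "y = c * f + d * g" using xy by (auto simp: ideal_def)
    moreover from this have "x + y = (a + c) * f + (b + d) * g" by (simp only: distrib_right add_ac)
    ultimately show ?thesis unfolding ideal_def by (blast intro: germs_add)
  qed
  show "h * x \<in> ideal g" if xh: "x \<in> ideal g" "h \<in> germs"
  proof -
    obtain a b where "a \<in> germs" "b \<in> germs" "x = a * f + b * g" using xh by (auto simp: ideal_def)
    moreover from this have "h * x = (h * a) * f + (h * b) * g" by (simp only: distrib_left mult.assoc)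
    ultimately show ?thesis unfolding ideal_def using xh(2) by (blast intro: germs_mult)
  qed
  show "ideal g \<subseteq> germs" using assms f_germ by (auto simp: ideal_def intro!: germs_add germs_mult)
qed

text \<open>
  The germs of sufficiently high order lie in \<open>(f, g)\<close>, since in their normal form all coefficients are
  divisible by the power of \<open>u\<close> in \<open>(f, g)\<close>. So the dimension can be counted by orders; those of
  the elements of \<open>(f, g)\<close> are the semigroup shifted by the order of \<open>g\<close>.
\<close>

lemma intersection_mult_order:
  assumes g: "g \<in> germs" "\<Phi> g \<noteq> 0"
  shows "intersection_mult f g (subdegree (\<Phi> g))"
proof -
  let ?n = "subdegree (\<Phi> g)"
  obtain M a b where ab: "a \<in> germs" "b \<in> germs" "fps_const (fps_X ^ M) = a * f + b * g"
    using u_power_in_ideal[OF g] .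
  have uM: "fps_const (fps_X ^ M) \<in> ideal g" using ab by (auto simp: ideal_def)
  have g_in: "h * g \<in> ideal g" if "h \<in> germs" for h
    using that unfolding ideal_def by (intro CollectI exI[of _ 0] exI[of _ h]) (auto intro: germs_0)
  have high: "h \<in> ideal g" if h: "h \<in> germs" "\<Phi> h = 0 \<or> subdegree (\<Phi> h) \<ge> M * m + m * k" for h
  proof -
    obtain q \<rho> where q: "q \<in> germs" "\<And>i. fps_const (\<rho> i) \<in> germs"
      "h = q * f + (\<Sum>i<m. fps_const (\<rho> i) * w ^ i)" using normal_form[OF h(1)] by blast
    have \<Phi>h: "\<Phi> h = \<Phi> (\<Sum>i<m. fps_const (\<rho> i) * w ^ i)"
      unfolding q(3) by (simp add: germ_subst_add[OF \<alpha>0 \<beta>] \<Phi>_f_mult)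
    have "fps_const (\<rho> i) * w ^ i \<in> ideal g" if i: "i < m" for i
    proof -
      have "\<rho> i = 0 \<or> M \<le> subdegree (\<rho> i)"
      proof (rule ccontr)
        assume *: "\<not> (\<rho> i = 0 \<or> M \<le> subdegree (\<rho> i))"
        then have "\<Phi> h \<noteq> 0" "subdegree (\<Phi> h) \<le> subdegree (\<rho> i) * m + i * k"
          using order_normal_form(1,3)[OF refl i] i unfolding \<Phi>h by auto
        moreover have "subdegree (\<rho> i) * m < M * m" "i * k \<le> m * k" using * m i by auto
        ultimately show False using h(2) by linarith
      qed
      then have "fps_const (\<rho> i) = fps_const (fps_X ^ M) * fps_const (fps_shift M (\<rho> i))"
        using fps_X_power_shift[of "\<rho> i" M] by simp
      then have "fps_const (\<rho> i) * w ^ i = (fps_const (fps_shift M (\<rho> i)) * w ^ i) * fps_const (fps_X ^ M)"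
        by (simp only: mult_ac)
      moreover have "\<dots> \<in> ideal g"
        using germs_fps_const_shift[OF q(2)] w(1) uM
        by (intro ideal_closed(3)[OF g(1)] germs_intros) auto
      ultimately show ?thesis by (simp only:)
    qed
    then have "(\<Sum>i\<in>I. fps_const (\<rho> i) * w ^ i) \<in> ideal g" if "I \<subseteq> {..<m}" for I
      using that by (induction I rule: infinite_finite_induct) (auto intro: ideal_closed[OF g(1)])
    moreover have "q * f \<in> ideal g" unfolding ideal_def using q(1)
      by (intro CollectI exI[of _ q] exI[of _ 0]) (auto intro: germs_0)
    ultimately show ?thesis unfolding q(3) by (intro ideal_closed(2)[OF g(1)]) auto
  qed
  have monomial: "\<exists>v\<in>germs. \<Phi> v \<noteq> 0 \<and> subdegree (\<Phi> v) = n" if in_\<Gamma>: "n \<in> \<Gamma>" for n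
  proof -
    obtain a l where n: "n = a * m + l * k" using in_\<Gamma> by (auto simp: generated2_def)
    have "fps_const (fps_X ^ a) * w ^ l \<in> germs"
      using w(1) germs_u by (auto simp flip: fps_const_power intro!: germs_mult germs_power)
    moreover have "\<Phi> (fps_const (fps_X ^ a) * w ^ l) = (fps_X ^ a oo \<alpha>) * \<Phi> w ^ l"
      by (simp add: \<Phi>_simps)
    moreover have "(fps_X ^ a oo \<alpha>) \<noteq> 0" "subdegree (fps_X ^ a oo \<alpha>) = a * m"
      using subdegree_u[of "fps_X ^ a"] by auto
    ultimately show ?thesis using w(2,3) n
      by (intro bexI[of _ "fps_const (fps_X ^ a) * w ^ l"]) (auto simp: subdegree_power)
  qed
  have shift: "\<exists>v\<in>ideal g. \<Phi> v \<noteq> 0 \<and> subdegree (\<Phi> v) = n" if in_shift: "n \<in> (+) ?n ` \<Gamma>" for n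
  proof -
    obtain x where x: "x \<in> \<Gamma>" "n = ?n + x" using in_shift by auto
    then obtain v where "v \<in> germs" "\<Phi> v \<noteq> 0" "subdegree (\<Phi> v) = x" using monomial by blast
    then show ?thesis using g g_in x by (intro bexI[of _ "v * g"]) (auto simp: germ_subst_mult[OF \<alpha>0 \<beta>])
  qed
  have ordW: "subdegree (\<Phi> v) \<in> (+) ?n ` \<Gamma>" if v: "v \<in> ideal g" "\<Phi> v \<noteq> 0" for v
  proof -
    obtain a b where "a \<in> germs" "b \<in> germs" "v = a * f + b * g" using v by (auto simp: ideal_def)
    then have "\<Phi> v = \<Phi> b * \<Phi> g" "b \<in> germs"
      by (auto simp: germ_subst_add[OF \<alpha>0 \<beta>] \<Phi>_f_mult) (simp add: germ_subst_mult[OF \<alpha>0 \<beta>])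
    then show ?thesis using v(2) order_in_semigroup[of b] by auto
  qed
  have n: "?n \<in> \<Gamma>" by (rule order_in_semigroup[OF g])
  have "quotient_dim germ_const germs (ideal g) (card (\<Gamma> - (+) ?n ` \<Gamma>))"
  proof (rule quotient_dim_by_orders[where \<phi> = \<Phi> and N = "M * m + m * k"])
    show "finite (\<Gamma> - (+) ?n ` \<Gamma>)"
      using card_semigroup_minus_shift(1)[OF generated2_cofinite[OF coprime m] generated2_add[OF n]] .
  qed (use high monomial shift ordW order_in_semigroup ideal_closed[OF g(1)] in
      \<open>auto simp: germ_const_def \<Phi>_simps germ_const_in_germs[unfolded germ_const_def]
        simp flip: fps_const_add intro: germs_intros\<close>)
  moreover have "card (\<Gamma> - (+) ?n ` \<Gamma>) = ?n"
    using card_semigroup_minus_shift(2)[OF generated2_cofinite[OF coprime m] generated2_add[OF n]] .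
  ultimately show ?thesis by (simp add: intersection_mult_def ideal_def)
qed

lemma semigroup: "germ_semigroup f = \<Gamma>"
proof (intro equalityI subsetI)
  fix n assume "n \<in> germ_semigroup f"
  then obtain g where g: "g \<in> germs" "\<not> germ_dvd f g" "intersection_mult f g n"
    by (auto simp: germ_semigroup_def)
  then have nz: "\<Phi> g \<noteq> 0" using germ_dvd_iff by simp
  have "quotient_dim germ_const germs (ideal g) n"
    "quotient_dim germ_const germs (ideal g) (subdegree (\<Phi> g))"
    using g(3) intersection_mult_order[OF g(1) nz] by (simp_all add: intersection_mult_def ideal_def)
  then have "n = subdegree (\<Phi> g)"
    by (rule quotient_dim_unique[rotated -2])
       (use ideal_closed[OF g(1)] in \<open>auto simp: germ_const_def germ_const_in_germs[unfolded germ_const_def] intro: germs_0 simp flip: fps_const_add fps_const_mult\<close>)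
  then show "n \<in> \<Gamma>" using order_in_semigroup[OF g(1) nz] by simp
next
  fix n assume "n \<in> \<Gamma>"
  then obtain a l where n: "n = a * m + l * k" by (auto simp: generated2_def)
  define g where "g = fps_const (fps_X ^ a) * w ^ l"
  have g: "g \<in> germs"
    using w(1) germs_u unfolding g_def by (auto simp flip: fps_const_power intro!: germs_mult germs_power)
  have "\<Phi> g = (fps_X ^ a oo \<alpha>) * \<Phi> w ^ l" by (simp add: \<Phi>_simps g_def)
  moreover have "(fps_X ^ a oo \<alpha>) \<noteq> 0" "subdegree (fps_X ^ a oo \<alpha>) = a * m"
    using subdegree_u[of "fps_X ^ a"] by auto
  ultimately have "\<Phi> g \<noteq> 0" "subdegree (\<Phi> g) = n"
    using w(2,3) n by (auto simp: subdegree_power)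
  then show "n \<in> germ_semigroup f"
    using intersection_mult_order[OF g] g germ_dvd_iff[OF g] by (auto simp: germ_semigroup_def)
qed

end

section \<open>Ring homomorphisms and evaluation of polynomials\<close>

text \<open>
  Ring homomorphisms as a predicate on functions, so that evaluations, substitutions and embeddings
  can be composed freely and move through the polynomial expression of the curve.
\<close>

definition ring_map :: "('a::comm_ring_1 \<Rightarrow> 'b::comm_ring_1) \<Rightarrow> bool" where
  "ring_map h \<longleftrightarrow> h 1 = 1 \<and> (\<forall>a b. h (a + b) = h a + h b) \<and> (\<forall>a b. h (a * b) = h a * h b)"

lemma ring_mapI:
  "h 1 = 1 \<Longrightarrow> (\<And>a b. h (a + b) = h a + h b) \<Longrightarrow> (\<And>a b. h (a * b) = h a * h b) \<Longrightarrow> ring_map h"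
  by (simp add: ring_map_def)

context
  fixes h :: "'a::comm_ring_1 \<Rightarrow> 'b::comm_ring_1"
  assumes h: "ring_map h"
begin

lemma ring_map_1: "h 1 = 1" and ring_map_add: "h (a + b) = h a + h b"
  and ring_map_mult: "h (a * b) = h a * h b"
  using h by (auto simp: ring_map_def)

lemma ring_map_0: "h 0 = 0"
  using ring_map_add[of 0 0] by simp

lemma ring_map_uminus: "h (- a) = - h a"
  using ring_map_add[of a "- a"] by (simp add: ring_map_0 eq_neg_iff_add_eq_0 add.commute)

lemma ring_map_diff: "h (a - b) = h a - h b"
  using ring_map_add[of a "- b"] by (simp add: ring_map_uminus)

lemma ring_map_sum: "h (sum t I) = (\<Sum>i\<in>I. h (t i))"
  by (induction I rule: infinite_finite_induct) (auto simp: ring_map_0 ring_map_add)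

lemma ring_map_power: "h (a ^ n) = h a ^ n"
  by (induction n) (auto simp: ring_map_1 ring_map_mult)

lemma ring_map_of_nat: "h (of_nat n) = of_nat n"
  by (induction n) (auto simp: ring_map_0 ring_map_1 ring_map_add)

lemma ring_map_numeral: "h (numeral n) = numeral n"
  using ring_map_of_nat[of "numeral n"] by simp

lemma ring_map_map_poly: "ring_map (map_poly h)"
proof (rule ring_mapI)
  show "map_poly h 1 = 1" by (simp add: one_pCons map_poly_pCons ring_map_0 ring_map_1)
  fix P Q
  show "map_poly h (P + Q) = map_poly h P + map_poly h Q"
    by (rule poly_eqI) (simp add: coeff_map_poly ring_map_0 ring_map_add)
  show "map_poly h (P * Q) = map_poly h P * map_poly h Q"
    by (rule poly_eqI) (simp add: coeff_map_poly coeff_mult ring_map_0 ring_map_sum ring_map_mult)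
qed

lemma ring_map_eval: "ring_map (\<lambda>P. poly (map_poly h P) x)"
  using ring_map_map_poly by (simp add: ring_map_def)

lemmas ring_map_simps = ring_map_0 ring_map_1 ring_map_add ring_map_mult ring_map_uminus ring_map_diff
  ring_map_power ring_map_numeral

end

lemma ring_map_eval3: "ring_map e \<Longrightarrow> ring_map (\<lambda>F. eval3 e F x y z)"
  unfolding eval3_def by (intro ring_map_eval)

definition varX :: poly3 where "varX = [:[:[:0, 1:]:]:]"
definition varY :: poly3 where "varY = [:[:0, 1:]:]"
definition varZ :: poly3 where "varZ = [:0, 1:]"

lemma eval3_const: "ring_map e \<Longrightarrow> eval3 e [:[:[:c:]:]:] x y z = e c"
  by (simp add: eval3_def map_poly_pCons ring_map_0)

lemma eval3_vars:
  assumes "ring_map e"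
  shows "eval3 e varX x y z = x" "eval3 e varY x y z = y" "eval3 e varZ x y z = z"
  by (simp_all add: eval3_def varX_def varY_def varZ_def map_poly_pCons one_pCons ring_map_0[OF assms] ring_map_1[OF assms])

lemmas eval3_simps = ring_map_simps[OF ring_map_eval3] eval3_vars

section \<open>Partial derivatives\<close>

definition derivation :: "('a::comm_ring_1 \<Rightarrow> 'a) \<Rightarrow> bool" where
  "derivation D \<longleftrightarrow> (\<forall>a b. D (a + b) = D a + D b) \<and> (\<forall>a b. D (a * b) = a * D b + D a * b)"

lemma derivationD:
  assumes "derivation D"
  shows "D (a + b) = D a + D b" "D (a * b) = a * D b + D a * b" "D 0 = 0" "D 1 = 0"
    "D (- a) = - D a" "D (a - b) = D a - D b" "D (numeral n) = 0" "D (a ^ Suc m) = of_nat (Suc m) * a ^ m * D a"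
proof -
  show add: "D (a + b) = D a + D b" and mult: "D (a * b) = a * D b + D a * b" for a b
    using assms by (auto simp: derivation_def)
  show zero: "D 0 = 0" using add[of 0 0] by simp
  show one: "D 1 = 0" using mult[of 1 1] by simp
  show uminus: "D (- a) = - D a" for a
    using add[of a "- a"] zero by (simp add: eq_neg_iff_add_eq_0 add.commute)
  show "D (a - b) = D a - D b" using add[of a "- b"] uminus by simp
  have "D (of_nat k) = 0" for k by (induction k) (auto simp: zero one add)
  from this[of "numeral n"] show "D (numeral n) = 0" by simp
  show "D (a ^ Suc m) = of_nat (Suc m) * a ^ m * D a"
    by (induction m) (auto simp: mult algebra_simps)
qed

text \<open>
  This turns each of the three partial derivatives into a derivation, so that they can be computed from
  the expression of the curve instead of its coefficients.
\<close>

lemma derivation_map_poly: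
  assumes "derivation D" shows "derivation (map_poly D)"
proof -
  note D = derivationD[OF assms]
  have sum: "D (sum t I) = (\<Sum>i\<in>I. D (t i))" for t :: "nat \<Rightarrow> 'a" and I
    by (induction I rule: infinite_finite_induct) (auto simp: D)
  show ?thesis unfolding derivation_def
    by (intro conjI allI poly_eqI)
       (simp_all add: coeff_map_poly D coeff_mult sum sum.distrib)
qed

lemma derivation_pderiv: "derivation (pderiv :: 'a::idom poly \<Rightarrow> 'a poly)"
  by (auto simp: derivation_def pderiv_add pderiv_mult)

lemma derivation_partial: "derivation dx" "derivation dy" "derivation dz"
  unfolding dx_def dy_def dz_def
  by (intro derivation_map_poly derivation_pderiv)+

lemma partial_vars:
  "dx varX = 1" "dx varY = 0" "dx varZ = 0" "dy varX = 0" "dy varY = 1" "dy varZ = 0"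
  "dz varX = 0" "dz varY = 0" "dz varZ = 1"
  by (simp_all add: dx_def dy_def dz_def varX_def varY_def varZ_def map_poly_pCons pderiv_pCons one_pCons)

section \<open>The curve\<close>

text \<open>
  The Taylor polynomial of \<open>(1 + 4w)^(9/2)\<close> of degree 5 in \<open>w = z/x\<close>, homogenized. The factor 4 makes
  its coefficients integers.
\<close>

definition puiseux_head :: "'a::comm_ring_1 \<Rightarrow> 'a \<Rightarrow> 'a" where
  "puiseux_head x z = x^5 + 18 * x^4 * z + 126 * x^3 * z^2 + 420 * x^2 * z^3 + 630 * x * z^4 + 252 * z^5"

text \<open>
  The quotient of \<open>puiseux_head x z ^ 2 - x * (x + 4 * z) ^ 9\<close> by \<open>z ^ 6\<close>.
\<close>

definition tail_form :: "'a::comm_ring_1 \<Rightarrow> 'a \<Rightarrow> 'a" where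
  "tail_form x z = 168 * x^4 + 2880 * x^3 * z + 18756 * x^2 * z^2 + 55376 * x * z^3 + 63504 * z^4"

text \<open>
  The equation of the curve, over an arbitrary commutative ring: the same expression serves for the form
  itself, for its values, for its local equations and for its pullback to the parameter line.
\<close>

definition octic :: "'a::comm_ring_1 \<Rightarrow> 'a \<Rightarrow> 'a \<Rightarrow> 'a" where
  "octic x y z = z^6 * y^2 - 2 * x^2 * puiseux_head x z * y + x^4 * tail_form x z"

definition param_y :: "'a::comm_ring_1 \<Rightarrow> 'a" where
  "param_y s = 2 + 24 * s + 114 * s^2 + 260 * s^3 + 252 * s^4"

lemma head_square:
  fixes x z :: "'a::idom"
  shows "puiseux_head x z ^ 2 = x * (x + 4 * z) ^ 9 + z ^ 6 * tail_form x z"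
  unfolding puiseux_head_def tail_form_def by algebra

lemma octic_times:
  fixes x y z :: "'a::idom"
  shows "z ^ 6 * octic x y z = (z^6 * y - x^2 * puiseux_head x z)^2 - x^5 * (x + 4 * z)^9"
  unfolding octic_def using head_square[of x z] by algebra

lemma octic_scale:
  fixes r x y z :: "'a::idom"
  shows "octic (r * x) (r * y) (r * z) = r ^ 8 * octic x y z"
  unfolding octic_def puiseux_head_def tail_form_def by algebra

lemma head_scale:
  fixes r x z :: "'a::idom"
  shows "puiseux_head (r * x) (r * z) = r ^ 5 * puiseux_head x z"
  unfolding puiseux_head_def by algebra

lemma param_y_eq:
  fixes s :: "'a::idom"
  shows "(s + 1) ^ 6 * param_y s = puiseux_head 1 (s * (s + 1)) + (1 + 2 * s) ^ 9"
  by (simp only: puiseux_head_def param_y_def power_one mult_1_left mult_1_right) algebra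

text \<open>
  On the curve, the quantity \<open>z^6 y - x^2 e(x, z)\<close> is the odd part in \<open>t = 1 + 2s\<close>. This identity
  proves that the parametrization lies on the curve, and later it expresses the parameter as a
  rational function on the curve.
\<close>

lemma param_parameter:
  fixes s :: "'a::idom"
  shows "(s ^ 7 * (s + 1)) ^ 6 * param_y s - (s ^ 6) ^ 2 * puiseux_head (s ^ 6) (s ^ 7 * (s + 1)) = s ^ 42 * (1 + 2 * s) ^ 9"
proof -
  have "puiseux_head (s ^ 6) (s ^ 7 * (s + 1)) = (s ^ 6) ^ 5 * puiseux_head 1 (s * (s + 1))"
  proof -
    have eq: "s ^ 6 * (s * (s + 1)) = s ^ 7 * (s + 1)" by algebra
    show ?thesis using head_scale[of "s ^ 6" 1 "s * (s + 1)"] unfolding eq by (simp only: mult_1_right)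
  qed
  then show ?thesis using param_y_eq[of s] by algebra
qed

lemma octic_param:
  fixes s :: "'a::idom"
  assumes "s \<noteq> 0" "s + 1 \<noteq> 0"
  shows "octic (s ^ 6) (param_y s) (s ^ 7 * (s + 1)) = 0"
proof -
  have "(s ^ 7 * (s + 1)) ^ 6 * octic (s ^ 6) (param_y s) (s ^ 7 * (s + 1))
    = (s ^ 42 * (1 + 2 * s) ^ 9) ^ 2 - (s ^ 6) ^ 5 * (s ^ 6 + 4 * (s ^ 7 * (s + 1))) ^ 9"
    by (simp only: octic_times param_parameter)
  also have "s ^ 6 + 4 * (s ^ 7 * (s + 1)) = s ^ 6 * (1 + 2 * s) ^ 2" by algebra
  also have "(s ^ 42 * (1 + 2 * s) ^ 9) ^ 2 - (s ^ 6) ^ 5 * (s ^ 6 * (1 + 2 * s) ^ 2) ^ 9 = 0"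
    by (simp add: power_mult_distrib flip: power_mult power_add)
  finally show ?thesis using assms by simp
qed

definition octic_form :: poly3 where "octic_form = octic varX varY varZ"

lemma ring_map_octic: "ring_map h \<Longrightarrow> h (octic x y z) = octic (h x) (h y) (h z)"
  by (simp add: octic_def puiseux_head_def tail_form_def ring_map_simps)

lemma eval3_octic: "ring_map e \<Longrightarrow> eval3 e octic_form x y z = octic x y z"
  unfolding octic_form_def by (subst ring_map_octic[OF ring_map_eval3]) (simp_all add: eval3_vars)

section \<open>Forms\<close>

lemma form_add: "form d F \<Longrightarrow> form d G \<Longrightarrow> form d (F + G)"
  unfolding form_def by (metis coeff_add add.right_neutral)

lemma form_uminus: "form d F \<Longrightarrow> form d (- F)"
  unfolding form_def by simp

lemma form_diff: "form d F \<Longrightarrow> form d G \<Longrightarrow> form d (F - G)"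
  using form_add[OF _ form_uminus, of d F G] by simp

lemma form_mult:
  assumes "form a F" "form b G" shows "form (a + b) (F * G)"
  unfolding form_def
proof (intro allI impI)
  fix i j k
  assume "coeff (coeff (coeff (F * G) k) j) i \<noteq> 0"
  then have "(\<Sum>k'\<le>k. \<Sum>j'\<le>j. \<Sum>i'\<le>i. coeff (coeff (coeff F k') j') i' * coeff (coeff (coeff G (k - k')) (j - j')) (i - i')) \<noteq> 0"
    by (simp add: coeff_mult coeff_sum)
  then obtain k' j' i' where *: "k' \<le> k" "j' \<le> j" "i' \<le> i"
    "coeff (coeff (coeff F k') j') i' \<noteq> 0" "coeff (coeff (coeff G (k - k')) (j - j')) (i - i') \<noteq> 0"
    by (auto elim!: sum.not_neutral_contains_not_neutral)
  then have "i' + j' + k' = a" "(i - i') + (j - j') + (k - k') = b"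
    using assms unfolding form_def by blast+
  then show "i + j + k = a + b" using * by linarith
qed

lemma form_const: "form 0 [:[:[:c:]:]:]"
  by (auto simp: form_def coeff_pCons split: nat.splits)

lemma form_1: "form 0 1"
  using form_const[of 1] by (simp add: one_pCons)

lemma form_numeral: "form 0 (numeral n)"
  using form_const[of "numeral n"] by (simp add: numeral_poly)

lemma form_power: "form a F \<Longrightarrow> form (a * n) (F ^ n)"
  by (induction n) (auto intro: form_mult form_1)

lemma form_vars: "form 1 varX" "form 1 varY" "form 1 varZ"
  by (auto simp: form_def varX_def varY_def varZ_def coeff_pCons split: nat.splits)

lemma form_eqI: "form a F \<Longrightarrow> a = b \<Longrightarrow> form b F" by simp

lemma form_head: "form 5 (puiseux_head varX varZ)"
  unfolding puiseux_head_def
  by (intro form_add; rule form_eqI, (rule form_mult form_power form_vars form_numeral)+; simp)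

lemma form_octic: "form 8 octic_form"
proof -
  have t: "form 4 (tail_form varX varZ)" unfolding tail_form_def
    by (intro form_add; rule form_eqI, (rule form_mult form_power form_vars form_numeral)+; simp)
  have "form (0 + 1 * 2 + 5 + 1) (2 * varX ^ 2 * puiseux_head varX varZ * varY)"
    "form (1 * 4 + 4) (varX ^ 4 * tail_form varX varZ)"
    by (intro form_mult form_power form_vars form_numeral form_head t)+
  moreover have "form (1 * 6 + 1 * 2) (varZ ^ 6 * varY ^ 2)"
    by (intro form_mult form_power form_vars)
  ultimately show ?thesis unfolding octic_form_def octic_def
    by (intro form_add form_diff) simp_all
qed

section \<open>The singular points\<close>

lemma rep_abs_cp2:
  assumes "(x, y, z) \<noteq> (0, 0, 0)"
  obtains c where "c \<noteq> 0" "rep_cp2 (abs_cp2 (x, y, z)) = (c * x, c * y, c * z)"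
proof -
  have "proj_rel (x, y, z) (x, y, z)" using assms by (auto intro!: exI[of _ 1])
  then have "proj_rel (x, y, z) (rep_cp2 (abs_cp2 (x, y, z)))"
    using Quotient3_rep_abs[OF Quotient3_cp2] Quotient3_rel[OF Quotient3_cp2]
    by (metis Quotient3_abs_rep Quotient3_cp2 Quotient3_rep_reflp)
  moreover obtain x' y' z' where "rep_cp2 (abs_cp2 (x, y, z)) = (x', y', z')" by (cases "rep_cp2 (abs_cp2 (x, y, z))")
  ultimately show ?thesis using that by auto
qed

lemma cp2_rep:
  obtains x y z where "rep_cp2 P = (x, y, z)" "(x, y, z) \<noteq> (0, 0, 0)" "P = abs_cp2 (x, y, z)"
proof -
  obtain x y z where r: "rep_cp2 P = (x, y, z)" by (cases "rep_cp2 P")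
  have "proj_rel (x, y, z) (x, y, z)" using Quotient3_rep_reflp[OF Quotient3_cp2, of P] r by simp
  moreover have "P = abs_cp2 (x, y, z)" using Quotient3_abs_rep[OF Quotient3_cp2, of P] r by simp
  ultimately show ?thesis using r that by auto
qed

lemma abs_cp2_eqI:
  assumes "(x, y, z) \<noteq> (0, 0, 0)" "c \<noteq> 0"
  shows "abs_cp2 (c * x, c * y, c * z) = abs_cp2 (x, y, z)"
proof -
  have "proj_rel (x, y, z) (c * x, c * y, c * z)" using assms by auto
  then show ?thesis using Quotient3_rel_abs[OF Quotient3_cp2] by metis
qed

definition P1 :: cp2 where "P1 = abs_cp2 (0, 1, 0)"
text \<open>
  On the line \<open>x = -4z\<close> the cusp is at \<open>y = x^2 e(x, 1)\<close> for \<open>x = -4\<close>.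
\<close>

definition P2 :: cp2 where "P2 = abs_cp2 (-4, -448, 1)"
definition P3 :: cp2 where "P3 = abs_cp2 (0, 0, 1)"

lemma rep_P:
  obtains a b c where "a \<noteq> 0" "rep_cp2 P1 = (0, a, 0)"
    "b \<noteq> 0" "rep_cp2 P2 = (- (4 * b), - (448 * b), b)" "c \<noteq> 0" "rep_cp2 P3 = (0, 0, c)"
proof -
  obtain a where a: "a \<noteq> 0" "rep_cp2 P1 = (a * 0, a * 1, a * 0)"
    unfolding P1_def by (rule rep_abs_cp2[of 0 1 0]) auto
  obtain b where b: "b \<noteq> 0" "rep_cp2 P2 = (b * (-4), b * (-448), b * 1)"
    unfolding P2_def by (rule rep_abs_cp2[of "-4" "-448" 1]) auto
  obtain c where c: "c \<noteq> 0" "rep_cp2 P3 = (c * 0, c * 0, c * 1)"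
    unfolding P3_def by (rule rep_abs_cp2[of 0 0 1]) auto
  show ?thesis using a b c by (intro that[of a b c]) (simp_all add: mult.commute)
qed

lemma distinct_P: "distinct [P1, P2, P3]"
proof -
  obtain a b c where "a \<noteq> 0" "rep_cp2 P1 = (0, a, 0)"
    "b \<noteq> 0" "rep_cp2 P2 = (- (4 * b), - (448 * b), b)" "c \<noteq> 0" "rep_cp2 P3 = (0, 0, c)"
    by (rule rep_P)
  then have "rep_cp2 P1 \<noteq> rep_cp2 P2" "rep_cp2 P1 \<noteq> rep_cp2 P3" "rep_cp2 P2 \<noteq> rep_cp2 P3" by auto
  then show ?thesis by auto
qed

lemma ring_map_id: "ring_map (\<lambda>c. c)" by (simp add: ring_map_def)

lemma partials_octic:
  fixes x y z :: complex
  shows "eval3 (\<lambda>c. c) (dx octic_form) x y z =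
      - 4 * x * puiseux_head x z * y
      - 2 * x^2 * (5 * x^4 + 72 * x^3 * z + 378 * x^2 * z^2 + 840 * x * z^3 + 630 * z^4) * y
      + 4 * x^3 * tail_form x z
      + x^4 * (672 * x^3 + 8640 * x^2 * z + 37512 * x * z^2 + 55376 * z^3)"
    "eval3 (\<lambda>c. c) (dy octic_form) x y z = 2 * (z^6 * y - x^2 * puiseux_head x z)"
    "eval3 (\<lambda>c. c) (dz octic_form) x y z = 6 * z^5 * y^2
      - 2 * x^2 * (18 * x^4 + 252 * x^3 * z + 1260 * x^2 * z^2 + 2520 * x * z^3 + 1260 * z^4) * y
      + x^4 * (2880 * x^3 + 37512 * x^2 * z + 166128 * x * z^2 + 254016 * z^3)"
  unfolding octic_form_def octic_def puiseux_head_def tail_form_def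
  by (simp_all add: derivationD[OF derivation_partial(1)] derivationD[OF derivation_partial(2)]
      derivationD[OF derivation_partial(3)] partial_vars eval3_simps[OF ring_map_id] eval_nat_numeral
      del: power_Suc)
     algebra+

text \<open>
  The vanishing of \<open>octic\<close> and of its derivative by \<open>y\<close> leaves, by \<open>octic_times\<close>, only the lines
  \<open>x = 0\<close> and \<open>x + 4z = 0\<close> of the pencil through \<open>P1\<close>, and on each of them one further point.
\<close>

lemma sing_octic: "sing octic_form = {P1, P2, P3}"
proof (intro equalityI subsetI)
  fix P assume P: "P \<in> sing octic_form"
  obtain x y z where r: "rep_cp2 P = (x, y, z)" "(x, y, z) \<noteq> (0, 0, 0)" "P = abs_cp2 (x, y, z)"
    by (rule cp2_rep)
  have F: "octic x y z = 0" and Fy: "z^6 * y = x^2 * puiseux_head x z"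
    using P r by (auto simp: sing_def vanishes_at_def eval3_octic[OF ring_map_id] partials_octic)
  have "x^5 * (x + 4 * z)^9 = 0" using octic_times[of z x y] F Fy by simp
  then consider "x = 0" | "x = -4 * z" by (auto simp: eq_neg_iff_add_eq_0)
  then show "P \<in> {P1, P2, P3}"
  proof cases
    case 1
    then have "z = 0 \<or> y = 0" using Fy by auto
    then show ?thesis
    proof
      assume "z = 0"
      then show ?thesis using r 1 abs_cp2_eqI[of 0 1 0 y] by (simp add: P1_def)
    next
      assume "y = 0"
      then show ?thesis using r 1 abs_cp2_eqI[of 0 0 1 z] by (simp add: P3_def)
    qed
  next
    case 2
    show ?thesis
    proof (cases "z = 0")
      case True
      then show ?thesis using r 2 abs_cp2_eqI[of 0 1 0 y] by (simp add: P1_def)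
    next
      case False
      have "z^6 * y = z^6 * (-448 * z)" using Fy unfolding 2 puiseux_head_def by algebra
      then have "y = -448 * z" using False by (simp only: mult_cancel_left power_eq_0_iff) simp
      then show ?thesis using r 2 False abs_cp2_eqI[of "-4" "-448" 1 z] by (simp add: P2_def mult.commute)
    qed
  qed
next
  obtain a b c where r: "a \<noteq> 0" "rep_cp2 P1 = (0, a, 0)"
    "b \<noteq> 0" "rep_cp2 P2 = (- (4 * b), - (448 * b), b)" "c \<noteq> 0" "rep_cp2 P3 = (0, 0, c)"
    by (rule rep_P)
  have "P1 \<in> sing octic_form" "P3 \<in> sing octic_form"
    by (simp_all add: sing_def vanishes_at_def eval3_octic[OF ring_map_id] partials_octic r
        octic_def puiseux_head_def tail_form_def)
  moreover have "P2 \<in> sing octic_form"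
    unfolding sing_def vanishes_at_def r mem_Collect_eq prod.case eval3_octic[OF ring_map_id]
      partials_octic octic_def puiseux_head_def tail_form_def
    by (intro conjI; algebra)
  moreover fix P assume "P \<in> {P1, P2, P3}"
  ultimately show "P \<in> sing octic_form" by blast
qed

section \<open>Double points and their multiplicity sequences\<close>

lemma fps_nonzeroI: "f $ 0 \<noteq> 0 \<Longrightarrow> f \<noteq> 0"
  by auto

lemma ring_map_fps_const: "ring_map fps_const"
  by (intro ring_mapI) auto

lemma ring_map_germ_const: "ring_map germ_const"
  by (intro ring_mapI) (auto simp: germ_const_def)

lemma ring_map_fps_nth_0: "ring_map (\<lambda>c. c $ 0)"
  by (intro ring_mapI) auto

lemma ring_map_compose: "c $ 0 = 0 \<Longrightarrow> ring_map (\<lambda>a. a oo (c :: 'a::idom fps))"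
  by (intro ring_mapI) (auto simp: fps_compose_add_distrib fps_compose_mult_distrib)

lemma ring_map_germ_subst: "\<alpha> $ 0 = 0 \<Longrightarrow> \<beta> $ 0 = 0 \<Longrightarrow> ring_map (germ_subst \<alpha> \<beta>)"
  by (intro ring_mapI) (auto simp: germ_subst_simps)

lemma ring_map_head: "ring_map h \<Longrightarrow> h (puiseux_head x z) = puiseux_head (h x) (h z)"
  by (simp add: puiseux_head_def ring_map_simps)

lemma germs_numeral: "numeral n \<in> germs"
  using germ_const_in_germs[of "numeral n"] by (simp add: ring_map_numeral[OF ring_map_germ_const])

lemma germs_fps_const_intros:
  "fps_const fps_X \<in> germs" "fps_const (numeral n) \<in> germs" "fps_const 1 \<in> germs"
  "fps_const a \<in> germs \<Longrightarrow> fps_const b \<in> germs \<Longrightarrow> fps_const (a + b) \<in> germs"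
  "fps_const a \<in> germs \<Longrightarrow> fps_const b \<in> germs \<Longrightarrow> fps_const (a - b) \<in> germs"
  "fps_const a \<in> germs \<Longrightarrow> fps_const b \<in> germs \<Longrightarrow> fps_const (a * b) \<in> germs"
  "fps_const a \<in> germs \<Longrightarrow> fps_const (a ^ m) \<in> germs"
  by (simp_all add: germs_u germs_numeral germs_1 ring_map_simps[OF ring_map_fps_const] germs_intros
      del: fps_const_add fps_const_sub fps_const_mult fps_const_power)

definition double_point :: "complex fps \<Rightarrow> complex fps \<Rightarrow> series2" where
  "double_point a b = (fps_X - fps_const a) ^ 2 - fps_const b"

text \<open>
  Here \<open>w = v - a\<close>, which becomes \<open>\<omega>\<close> along the branch.
\<close>

lemma double_point_branch:
  assumes germs: "fps_const a \<in> germs" "fps_const b \<in> germs" and zero: "a $ 0 = 0" "b $ 0 = 0"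
    and \<alpha>: "subdegree \<alpha> = 2" and \<omega>: "\<omega> ^ 2 = b oo \<alpha>" "odd (subdegree \<omega>)"
  shows "germ_irreducible (double_point a b)"
    "germ_semigroup (double_point a b) = generated2 2 (subdegree \<omega>)"
proof -
  define A where "A = fps_const (2 * a) * fps_X + fps_const (b - a ^ 2)"
  have eq: "double_point a b = fps_X ^ 2 - A"
    by (simp add: A_def double_point_def power2_eq_square algebra_simps numeral_fps_const
        flip: fps_const_mult fps_const_sub)
  have \<alpha>0: "\<alpha> $ 0 = 0" using \<alpha> by (auto intro: nth_less_subdegree_zero)
  have \<omega>0: "\<omega> $ 0 = 0" using \<omega>(2) by (intro nth_less_subdegree_zero) (auto intro: odd_pos)
  define \<beta> where "\<beta> = \<omega> + (a oo \<alpha>)"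
  have \<beta>0: "\<beta> $ 0 = 0" by (simp add: \<beta>_def \<omega>0 zero)
  note subst = germ_subst_simps[OF \<alpha>0 \<beta>0]
  interpret branch A "fps_X - fps_const a" 2 "subdegree \<omega>" \<alpha> \<beta>
  proof
    show "coprime 2 (subdegree \<omega>)" using \<omega>(2) by simp
    show "A \<in> germs" unfolding A_def by (intro germs_intros germs_fps_const_intros germs)
    show "A $ n = 0" if "n \<ge> 2" for n using that by (auto simp: A_def)
    show "A $ n $ 0 = 0" for n using zero by (auto simp: A_def power2_eq_square)
    show "germ_subst \<alpha> \<beta> (fps_X ^ 2 - A) = 0"
      unfolding eq[symmetric] double_point_def subst by (simp add: \<beta>_def \<omega>)
    show "fps_X - fps_const a \<in> germs" by (intro germs_intros germs)
    show "germ_subst \<alpha> \<beta> (fps_X - fps_const a) \<noteq> 0"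
      "subdegree (germ_subst \<alpha> \<beta> (fps_X - fps_const a)) = subdegree \<omega>"
      using \<omega>(2) unfolding subst by (auto simp: \<beta>_def)
    fix r :: series2 assume r: "r \<in> germs" "\<And>j. 2 \<le> j \<Longrightarrow> r $ j = 0"
    define \<rho> where "\<rho> i = (if i = 0 then r $ 0 + r $ 1 * a else if i = 1 then r $ 1 else 0)" for i :: nat
    have "fps_const (\<rho> i) \<in> germs" for i
      unfolding \<rho>_def by (auto intro!: germs_fps_const_intros germs germs_fps_const_nth r germs_0
          simp del: fps_const_add fps_const_mult)
    moreover have "r = (\<Sum>i<2. fps_const (\<rho> i) * (fps_X - fps_const a) ^ i)"
    proof -
      have "r = fps_const (r $ 0) + fps_const (r $ 1) * fps_X"
      proof (rule fps_ext)
        fix n show "r $ n = (fps_const (r $ 0) + fps_const (r $ 1) * fps_X) $ n"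
          using r(2)[of n] by (cases "n = 0"; cases "n = 1") auto
      qed
      also have "\<dots> = (\<Sum>i<2. fps_const (\<rho> i) * (fps_X - fps_const a) ^ i)"
        by (simp add: \<rho>_def numeral_2_eq_2 algebra_simps flip: fps_const_add fps_const_mult)
      finally show ?thesis .
    qed
    ultimately show "\<exists>\<rho>. (\<forall>i. fps_const (\<rho> i) \<in> germs) \<and> r = (\<Sum>i<2. fps_const (\<rho> i) * (fps_X - fps_const a) ^ i)"
      by blast
  qed (use \<alpha> \<beta>0 in auto)
  show "germ_irreducible (double_point a b)" "germ_semigroup (double_point a b) = generated2 2 (subdegree \<omega>)"
    unfolding eq using irreducible semigroup by auto
qed

lemma double_point_coeff:
  "germ_coeff (double_point a b) i j =
    (if j = 0 then (a ^ 2 - b) $ i else if j = 1 then - 2 * a $ i else if j = 2 \<and> i = 0 then 1 else 0)"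
proof -
  have eq: "double_point a b = fps_X ^ 2 - fps_const (2 * a) * fps_X + fps_const (a ^ 2 - b)"
    by (simp add: double_point_def power2_eq_square algebra_simps numeral_fps_const
        flip: fps_const_mult fps_const_sub)
  show ?thesis unfolding germ_coeff_def eq
    by (auto simp: fps_X_power_nth numeral_fps_const)
qed

lemma germ_multI:
  assumes "germ_coeff f i j \<noteq> 0" "\<And>i' j'. i' + j' < i + j \<Longrightarrow> germ_coeff f i' j' = 0"
  shows "germ_mult f = i + j"
  unfolding germ_mult_def using assms by (intro Least_equality) (auto simp: not_less[symmetric])

lemma double_point_mult_2:
  assumes "a $ 0 = 0" "b $ 0 = 0" "b $ 1 = 0"
  shows "germ_mult (double_point a b) = 2"
proof -
  have "germ_mult (double_point a b) = 0 + 2"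
  proof (rule germ_multI)
    fix i j :: nat assume "i + j < 0 + 2"
    then have "(i = 0 \<and> j = 0) \<or> (i = 1 \<and> j = 0) \<or> (i = 0 \<and> j = 1)" by linarith
    then show "germ_coeff (double_point a b) i j = 0"
      using assms by (auto simp: double_point_coeff power2_eq_square fps_mult_nth)
  qed (simp add: double_point_coeff)
  then show ?thesis by simp
qed

lemma blow_up_coeff:
  assumes "germ_mult f = m"
  shows "germ_coeff (blow_up c f) n k =
    (\<Sum>j\<le>n + m. germ_coeff f (n + m - j) j * of_nat (j choose k) * c ^ (j - k))"
  unfolding germ_coeff_def[of "blow_up c f"] by (simp add: blow_up_def assms)

text \<open>
  Blowing up in the direction of the tangent replaces \<open>a\<close> by \<open>a/u - a'(0)\<close> and \<open>b\<close> by \<open>b/u^2\<close>, so the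
  class of double points is preserved and the order of \<open>b\<close> drops by 2.
\<close>

lemma blow_up_double_point:
  assumes "a $ 0 = 0" "b $ 0 = 0" "b $ 1 = 0"
  shows "blow_up (a $ 1) (double_point a b) =
    double_point (fps_shift 1 a - fps_const (a $ 1)) (fps_shift 2 b)"
proof -
  let ?c = "a $ 1" and ?s = "fps_shift 1 a"
  have a: "a = fps_X * ?s" using assms(1) by (intro fps_ext) (auto simp: fps_X_mult_nth)
  have sq: "(a ^ 2) $ (n + 2) = (?s ^ 2) $ n" for n
    by (subst a) (simp add: power_mult_distrib fps_X_power_mult_nth)
  have "germ_coeff (blow_up ?c (double_point a b)) n k =
    germ_coeff (double_point (?s - fps_const ?c) (fps_shift 2 b)) n k" for n k
  proof -
    have "germ_coeff (blow_up ?c (double_point a b)) n k = (\<Sum>j\<le>n + 2.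
       germ_coeff (double_point a b) (n + 2 - j) j * of_nat (j choose k) * ?c ^ (j - k))"
      by (rule blow_up_coeff[OF double_point_mult_2[OF assms]])
    also have "\<dots> = (\<Sum>j\<le>2.
       germ_coeff (double_point a b) (n + 2 - j) j * of_nat (j choose k) * ?c ^ (j - k))"
      by (intro sum.mono_neutral_right) (auto simp: double_point_coeff)
    also have "\<dots> = germ_coeff (double_point (?s - fps_const ?c) (fps_shift 2 b)) n k"
    proof -
      have S: "(?s - fps_const ?c) ^ 2 = ?s ^ 2 - fps_const (2 * ?c) * ?s + fps_const (?c ^ 2)"
        by (simp add: power2_eq_square algebra_simps numeral_fps_const flip: fps_const_mult)
      have three: "(\<Sum>j\<le>2. t j) = t 0 + t 1 + t 2" for t :: "nat \<Rightarrow> complex"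
        by (simp add: numeral_2_eq_2)
      consider "k = 0" | "k = 1" | "k = 2" | "k > 2" by linarith
      then show ?thesis
        unfolding three by cases (auto simp: double_point_coeff S[unfolded One_nat_def] sq[simplified] binomial_eq_0)
    qed
    finally show ?thesis .
  qed
  then show ?thesis by (intro fps_ext) (simp add: germ_coeff_def)
qed

lemma double_point_multiplicity_sequence:
  assumes "a $ 0 = 0" "subdegree b = 2 * n + 1"
  shows "multiplicity_sequence (double_point a b) (replicate n 2)"
  using assms
proof (induction n arbitrary: a b)
  case 0
  have "b \<noteq> 0" using 0 by auto
  then have b: "b $ 0 = 0" "b $ 1 \<noteq> 0"
    using 0 nth_subdegree_nonzero[of b] by (auto intro: nth_less_subdegree_zero)
  have "germ_mult (double_point a b) = 1 + 0"
    using 0 b by (intro germ_multI) (auto simp: double_point_coeff power2_eq_square fps_mult_nth)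
  then show ?case by simp
next
  case (Suc n)
  have b: "b $ i = 0" if "i < 3" for i using Suc.prems(2) that by (intro nth_less_subdegree_zero) simp
  have mult: "germ_mult (double_point a b) = 2" using Suc.prems b by (intro double_point_mult_2) auto
  define f' where "f' = double_point (fps_shift 1 a - fps_const (a $ 1)) (fps_shift 2 b)"
  have "f' = blow_up (a $ 1) (double_point a b)"
    unfolding f'_def using Suc.prems b by (intro blow_up_double_point[symmetric]) auto
  moreover have "germ_coeff f' 0 0 = 0"
    using b[of 2] by (simp add: f'_def double_point_coeff power2_eq_square numeral_2_eq_2)
  ultimately have "strict_transform (double_point a b) f'" by (auto simp: strict_transform_def)
  moreover have "multiplicity_sequence f' (replicate n 2)"
    unfolding f'_def using Suc.prems by (intro Suc.IH) (auto simp: fps_shift_subdegree)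
  ultimately show ?case using mult by auto
qed

section \<open>The three cusps\<close>

lemma local_eq_P1: "local_eq octic_form P1 = octic (fps_const fps_X) 1 fps_X"
proof -
  obtain a where "a \<noteq> 0" "rep_cp2 P1 = (0, a, 0)" by (rule rep_P)
  then show ?thesis
    by (simp add: local_eq_def eval3_octic[OF ring_map_germ_const] ring_map_0[OF ring_map_germ_const])
qed

lemma octic_affine: "octic x y (1::'a::idom) = (y - x^2 * puiseux_head x 1)^2 - x^5 * (x + 4)^9"
  using octic_times[of 1 x y] by simp

lemma local_eq_P2: "local_eq octic_form P2 =
  double_point ((fps_X - 4)^2 * puiseux_head (fps_X - 4) 1 + 448) ((fps_X - 4)^5 * fps_X^9)"
proof -
  obtain b where b: "b \<noteq> 0" "rep_cp2 P2 = (- (4 * b), - (448 * b), b)" by (rule rep_P)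
  have c: "germ_const (-4) = -4" "germ_const (-448) = -448"
    by (simp_all only: ring_map_uminus[OF ring_map_germ_const] ring_map_numeral[OF ring_map_germ_const])
  have d: "fps_const (fps_X - 4) = -4 + fps_const (fps_X :: complex fps)"
    by (simp only: ring_map_simps[OF ring_map_fps_const]) simp
  have "local_eq octic_form P2 = octic (-4 + fps_const fps_X) (-448 + fps_X) 1"
    using b by (simp add: local_eq_def eval3_octic[OF ring_map_germ_const] c)
  also have "\<dots> = double_point ((fps_X - 4)^2 * puiseux_head (fps_X - 4) 1 + 448) ((fps_X - 4)^5 * fps_X^9)"
    unfolding octic_affine double_point_def
    by (simp only: ring_map_simps(1-5,7-8)[OF ring_map_fps_const] ring_map_head[OF ring_map_fps_const] d)
       (simp add: algebra_simps)
  finally show ?thesis .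
qed

lemma local_eq_P3: "local_eq octic_form P3 =
  double_point (fps_X^2 * puiseux_head fps_X 1) (fps_X^5 * (fps_X + 4)^9)"
proof -
  obtain c where c: "c \<noteq> 0" "rep_cp2 P3 = (0, 0, c)" by (rule rep_P)
  have "local_eq octic_form P3 = octic (fps_const fps_X) fps_X 1"
    using c by (simp add: local_eq_def eval3_octic[OF ring_map_germ_const] ring_map_0[OF ring_map_germ_const])
  also have "\<dots> = double_point (fps_X^2 * puiseux_head fps_X 1) (fps_X^5 * (fps_X + 4)^9)"
    unfolding octic_affine double_point_def
    by (simp only: ring_map_simps[OF ring_map_fps_const] ring_map_head[OF ring_map_fps_const])
  finally show ?thesis .
qed

lemma fps_const_head_germ: "fps_const a \<in> germs \<Longrightarrow> fps_const (puiseux_head a 1) \<in> germs"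
  unfolding puiseux_head_def by (intro germs_fps_const_intros)

text \<open>
  The parameter is \<open>t\<close> itself. With \<open>i = 1/(t^2 - 1)\<close> one has \<open>u = x/z + 4 = 4 t^2 i\<close> and
  \<open>u - 4 = 4 i\<close>, so \<open>b = (u - 4)^5 u^9\<close> is the square of \<open>4^7 t^9 i^7\<close>.
\<close>

lemma cusp_P2:
  "germ_irreducible (local_eq octic_form P2)"
  "cusp_semigroup octic_form P2 = generated2 2 9"
  "multiplicity_sequence (local_eq octic_form P2) [2, 2, 2, 2]"
proof -
  let ?a = "(fps_X - 4)^2 * puiseux_head (fps_X - 4) 1 + 448 :: complex fps"
  let ?b = "(fps_X - 4)^5 * fps_X^9 :: complex fps"
  have a0: "?a $ 0 = 0"
    by (simp add: ring_map_simps[OF ring_map_fps_nth_0] ring_map_head[OF ring_map_fps_nth_0])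
       (simp add: puiseux_head_def)
  have sub4: "subdegree ((fps_X :: complex fps) - 4) = 0" by (intro subdegree_eq_0) simp
  have nz4: "(fps_X :: complex fps) - 4 \<noteq> 0" by (rule fps_nonzeroI) simp
  have b: "subdegree ?b = 2 * 4 + 1" using sub4 nz4 by (simp add: subdegree_mult subdegree_power)
  have g: "fps_const ?a \<in> germs" "fps_const ?b \<in> germs"
    by (intro germs_fps_const_intros fps_const_head_germ)+
  define i where "i = inverse (fps_X^2 - 1 :: complex fps)"
  have i: "(fps_X^2 - 1) * i = 1" unfolding i_def by (intro inverse_mult_eq_1') simp
  have i0: "i $ 0 \<noteq> 0" "subdegree i = 0" "i \<noteq> 0" by (auto simp: i_def intro!: subdegree_eq_0)
  define \<alpha> where "\<alpha> = 4 * fps_X^2 * i"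
  define \<omega> where "\<omega> = 4^7 * fps_X^9 * i^7"
  have four: "subdegree (4 :: complex fps) = 0" by (intro subdegree_eq_0) simp
  have \<alpha>: "subdegree \<alpha> = 2" using i0 four by (simp add: \<alpha>_def subdegree_mult)
  have \<omega>: "subdegree \<omega> = 9" using i0 four by (simp add: \<omega>_def subdegree_mult subdegree_power)
  have \<alpha>0: "\<alpha> $ 0 = 0" using \<alpha> by (intro nth_less_subdegree_zero) simp
  have "?b oo \<alpha> = (\<alpha> - 4)^5 * \<alpha>^9"
    using \<alpha>0 by (simp add: ring_map_simps[OF ring_map_compose[OF \<alpha>0]])
  also have "\<dots> = \<omega> ^ 2" unfolding \<alpha>_def \<omega>_def using i by algebra
  finally have sq: "\<omega> ^ 2 = ?b oo \<alpha>" by simp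
  have "?b $ 0 = 0" by simp
  note * = double_point_branch[OF g a0 this \<alpha> sq]
  show "germ_irreducible (local_eq octic_form P2)" "cusp_semigroup octic_form P2 = generated2 2 9"
    using * unfolding local_eq_P2 cusp_semigroup_def \<omega> by auto
  have "[2, 2, 2, 2] = replicate 4 (2 :: nat)" by (simp add: eval_nat_numeral)
  then show "multiplicity_sequence (local_eq octic_form P2) [2, 2, 2, 2]"
    unfolding local_eq_P2 using double_point_multiplicity_sequence[OF a0 b] by (simp only:)
qed

text \<open>
  The parameter is \<open>1/t\<close>, again called \<open>t\<close> here, and in terms of it \<open>u = x/z\<close> and \<open>u + 4\<close> are \<open>4 t^2 i\<close> and \<open>4 i\<close> with
  \<open>i = 1/(1 - t^2)\<close>.
\<close>

lemma cusp_P3: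
  "germ_irreducible (local_eq octic_form P3)"
  "cusp_semigroup octic_form P3 = generated2 2 5"
  "multiplicity_sequence (local_eq octic_form P3) [2, 2]"
proof -
  let ?a = "fps_X^2 * puiseux_head fps_X 1 :: complex fps"
  let ?b = "fps_X^5 * (fps_X + 4)^9 :: complex fps"
  have a0: "?a $ 0 = 0" by simp
  have sub4: "subdegree ((fps_X :: complex fps) + 4) = 0" by (intro subdegree_eq_0) simp
  have nz4: "(fps_X :: complex fps) + 4 \<noteq> 0" by (rule fps_nonzeroI) simp
  have b: "subdegree ?b = 2 * 2 + 1" using sub4 nz4 by (simp add: subdegree_mult subdegree_power)
  have g: "fps_const ?a \<in> germs" "fps_const ?b \<in> germs"
    by (intro germs_fps_const_intros fps_const_head_germ)+
  define i where "i = inverse (1 - fps_X^2 :: complex fps)"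
  have i: "(1 - fps_X^2) * i = 1" unfolding i_def by (intro inverse_mult_eq_1') simp
  have i0: "i $ 0 \<noteq> 0" "subdegree i = 0" "i \<noteq> 0" by (auto simp: i_def intro!: subdegree_eq_0)
  define \<alpha> where "\<alpha> = 4 * fps_X^2 * i"
  define \<omega> where "\<omega> = 4^7 * fps_X^5 * i^7"
  have four: "subdegree (4 :: complex fps) = 0" by (intro subdegree_eq_0) simp
  have \<alpha>: "subdegree \<alpha> = 2" using i0 four by (simp add: \<alpha>_def subdegree_mult)
  have \<omega>: "subdegree \<omega> = 5" using i0 four by (simp add: \<omega>_def subdegree_mult subdegree_power)
  have \<alpha>0: "\<alpha> $ 0 = 0" using \<alpha> by (intro nth_less_subdegree_zero) simp
  have "?b oo \<alpha> = \<alpha>^5 * (\<alpha> + 4)^9"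
    using \<alpha>0 by (simp add: ring_map_simps[OF ring_map_compose[OF \<alpha>0]])
  also have "\<dots> = \<omega> ^ 2" unfolding \<alpha>_def \<omega>_def using i by algebra
  finally have sq: "\<omega> ^ 2 = ?b oo \<alpha>" by simp
  have "?b $ 0 = 0" by simp
  note * = double_point_branch[OF g a0 this \<alpha> sq]
  show "germ_irreducible (local_eq octic_form P3)" "cusp_semigroup octic_form P3 = generated2 2 5"
    using * unfolding local_eq_P3 cusp_semigroup_def \<omega> by auto
  have "[2, 2] = replicate 2 (2 :: nat)" by (simp add: eval_nat_numeral)
  then show "multiplicity_sequence (local_eq octic_form P3) [2, 2]"
    unfolding local_eq_P3 using double_point_multiplicity_sequence[OF a0 b] by (simp only:)
qed

text \<open>
  The coefficients of the powers of \<open>v\<close> in \<open>sextuple_tail\<close>. In the chart at \<open>P1\<close> the curve is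
  \<open>v^6 - sextuple_tail\<close>, and the term \<open>2u^7\<close> of the tail gives the type \<open>(6, 7)\<close>.
\<close>

definition sextuple_coeff :: "nat \<Rightarrow> complex fps" where
  "sextuple_coeff j = (if j = 0 then 2 * fps_X^7 - 168 * fps_X^8
     else if j = 1 then 36 * fps_X^6 - 2880 * fps_X^7
     else if j = 2 then 252 * fps_X^5 - 18756 * fps_X^6
     else if j = 3 then 840 * fps_X^4 - 55376 * fps_X^5
     else if j = 4 then 1260 * fps_X^3 - 63504 * fps_X^4
     else if j = 5 then 504 * fps_X^2 else 0)"

definition sextuple_tail :: series2 where "sextuple_tail = Abs_fps sextuple_coeff"

lemma fps_eq_sum:
  assumes "\<And>j. j \<ge> m \<Longrightarrow> r $ j = 0" shows "r = (\<Sum>i<m. fps_const (r $ i) * fps_X ^ i)"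
proof (rule fps_ext)
  fix n
  have "(\<Sum>i<m. fps_const (r $ i) * fps_X ^ i) $ n = (\<Sum>i<m. if i = n then r $ n else 0)"
    unfolding fps_sum_nth by (intro sum.cong) auto
  then show "r $ n = (\<Sum>i<m. fps_const (r $ i) * fps_X ^ i) $ n" using assms[of n] by simp
qed

lemma sextuple_tail_eq: "sextuple_tail = 2 * (fps_const fps_X)^2 * puiseux_head (fps_const fps_X) fps_X
      - (fps_const fps_X)^4 * tail_form (fps_const fps_X) fps_X"
proof -
  have "sextuple_tail = (\<Sum>i<6. fps_const (sextuple_coeff i) * fps_X ^ i)"
    using fps_eq_sum[of 6 sextuple_tail] by (simp add: sextuple_tail_def sextuple_coeff_def)
  also have "\<dots> = 2 * (fps_const fps_X)^2 * puiseux_head (fps_const fps_X) fps_X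
      - (fps_const fps_X)^4 * tail_form (fps_const fps_X) fps_X"
  proof -
    have six: "(\<Sum>i<6. t i) = t 0 + t 1 + t 2 + t 3 + t 4 + t 5" for t :: "nat \<Rightarrow> series2"
      by (simp add: eval_nat_numeral)
    have c: "sextuple_coeff 0 = 2 * fps_X^7 - 168 * fps_X^8" "sextuple_coeff 1 = 36 * fps_X^6 - 2880 * fps_X^7"
      "sextuple_coeff 2 = 252 * fps_X^5 - 18756 * fps_X^6" "sextuple_coeff 3 = 840 * fps_X^4 - 55376 * fps_X^5"
      "sextuple_coeff 4 = 1260 * fps_X^3 - 63504 * fps_X^4" "sextuple_coeff 5 = 504 * fps_X^2"
      by (simp_all only: sextuple_coeff_def) simp_all
    show ?thesis
      unfolding six c puiseux_head_def tail_form_def ring_map_simps[OF ring_map_fps_const]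
      by algebra
  qed
  finally show ?thesis .
qed

lemma sextuple_eq: "octic (fps_const fps_X) 1 fps_X = fps_X ^ 6 - sextuple_tail"
  unfolding octic_def sextuple_tail_eq by (simp add: algebra_simps)

lemma sextuple_coeff_low: "i + j < 7 \<Longrightarrow> sextuple_coeff j $ i = 0"
  by (auto simp: sextuple_coeff_def numeral_fps_const fps_X_power_nth)

text \<open>
  The parameter is \<open>s\<close>, and \<open>u\<close> and \<open>v\<close> are the given parametrization divided by \<open>param_y s\<close>, whose
  value at \<open>s = 0\<close> is 2. Along it, \<open>u\<close> and \<open>v\<close> have the orders 6 and 7. After one blow-up the strict
  transform has a linear term in \<open>u\<close>.
\<close>

lemma cusp_P1:
  "germ_irreducible (local_eq octic_form P1)"
  "cusp_semigroup octic_form P1 = generated2 6 7"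
  "multiplicity_sequence (local_eq octic_form P1) [6]"
proof -
  define p where "p = param_y (fps_X :: complex fps)"
  have p0: "p $ 0 = 2" by (simp add: p_def param_y_def)
  define i where "i = inverse p"
  have i: "p * i = 1" unfolding i_def by (intro inverse_mult_eq_1') (simp add: p0)
  have i0: "subdegree i = 0" "i \<noteq> 0" using p0 by (auto simp: i_def intro!: subdegree_eq_0)
  define \<alpha> where "\<alpha> = i * fps_X ^ 6"
  define \<beta> where "\<beta> = i * (fps_X ^ 7 * (fps_X + 1))"
  have X1: "subdegree ((fps_X :: complex fps) + 1) = 0" by (intro subdegree_eq_0) simp
  have nz: "(fps_X :: complex fps) + 1 \<noteq> 0" by (rule fps_nonzeroI) simp
  have \<alpha>: "subdegree \<alpha> = 6" using i0 by (simp add: \<alpha>_def subdegree_mult)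
  have \<beta>: "\<beta> \<noteq> 0" "subdegree \<beta> = 7" using i0 nz X1 by (simp_all add: \<beta>_def subdegree_mult)
  have \<alpha>0: "\<alpha> $ 0 = 0" using \<alpha> by (intro nth_less_subdegree_zero) simp
  have \<beta>0: "\<beta> $ 0 = 0" using \<beta> by (intro nth_less_subdegree_zero) simp
  note subst = germ_subst_simps[OF \<alpha>0 \<beta>0]
  interpret branch sextuple_tail fps_X 6 7 \<alpha> \<beta>
  proof
    show "coprime (6::nat) 7" by (rule coprimeI) (metis Suc_numeral semiring_norm coprime_Suc_right_nat coprime_def)
    show "sextuple_tail \<in> germs"
      unfolding sextuple_tail_eq puiseux_head_def tail_form_def by (intro germs_intros germs_numeral)
    show "sextuple_tail $ n = 0" if "n \<ge> 6" for n using that by (simp add: sextuple_tail_def sextuple_coeff_def)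
    show "sextuple_tail $ n $ 0 = 0" for n
      by (auto simp: sextuple_tail_def sextuple_coeff_def)
    show "germ_subst \<alpha> \<beta> (fps_X ^ 6 - sextuple_tail) = 0"
    proof -
      have "germ_subst \<alpha> \<beta> (octic (fps_const fps_X) 1 fps_X) = octic \<alpha> 1 \<beta>"
        using \<alpha>0 by (simp add: ring_map_octic[OF ring_map_germ_subst[OF \<alpha>0 \<beta>0]] subst)
      also have "\<dots> = octic (i * fps_X ^ 6) (i * p) (i * (fps_X ^ 7 * (fps_X + 1)))"
        using i by (simp add: \<alpha>_def \<beta>_def mult.commute)
      also have "\<dots> = 0" unfolding octic_scale p_def using nz by (simp add: octic_param)
      finally show ?thesis by (simp add: sextuple_eq)
    qed
    show "germ_subst \<alpha> \<beta> fps_X \<noteq> 0" "subdegree (germ_subst \<alpha> \<beta> fps_X) = 7"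
      using \<beta> by (simp_all add: subst)
    show "\<exists>\<rho>. (\<forall>i. fps_const (\<rho> i) \<in> germs) \<and> r = (\<Sum>i<6. fps_const (\<rho> i) * fps_X ^ i)"
      if "r \<in> germs" "\<And>j. 6 \<le> j \<Longrightarrow> r $ j = 0" for r
      using fps_eq_sum[of 6 r] that germs_fps_const_nth by blast
  qed (use \<alpha> \<beta>0 germs_X in auto)
  show "germ_irreducible (local_eq octic_form P1)" "cusp_semigroup octic_form P1 = generated2 6 7"
    unfolding local_eq_P1 sextuple_eq cusp_semigroup_def using irreducible semigroup by auto
  let ?f = "fps_X ^ 6 - sextuple_tail"
  have coeff: "germ_coeff ?f i j = (if i = 0 \<and> j = 6 then 1 else 0) - sextuple_coeff j $ i" for i j
    by (auto simp: germ_coeff_def sextuple_tail_def fps_X_power_nth)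
  have "germ_mult ?f = 0 + 6"
    by (intro germ_multI) (auto simp: coeff sextuple_coeff_low simp del: germ_coeff_simps)
  then have mult: "germ_mult ?f = 6" by simp
  define f' where "f' = blow_up 0 ?f"
  have f': "germ_coeff f' n 0 = germ_coeff ?f (n + 6) 0" for n
  proof -
    have "germ_coeff f' n 0 = (\<Sum>j\<le>n + 6. germ_coeff ?f (n + 6 - j) j * 0 ^ j)"
      by (simp add: f'_def blow_up_coeff[OF mult])
    also have "\<dots> = (\<Sum>j\<le>n + 6. if j = 0 then germ_coeff ?f (n + 6) 0 else 0)"
      by (intro sum.cong) auto
    finally show ?thesis by simp
  qed
  have f'00: "germ_coeff f' 0 0 = 0" unfolding f' by (simp add: coeff sextuple_coeff_low del: germ_coeff_simps)
  have f'10: "germ_coeff f' 1 0 \<noteq> 0" unfolding f' by (simp add: coeff sextuple_coeff_def numeral_fps_const fps_X_power_nth del: germ_coeff_simps)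
  have "germ_mult f' = 1 + 0" using f'00 f'10 by (intro germ_multI) auto
  then have "multiplicity_sequence f' []" by simp
  moreover have "strict_transform ?f f'" using f'00 by (auto simp: strict_transform_def f'_def)
  ultimately show "multiplicity_sequence (local_eq octic_form P1) [6]"
    unfolding local_eq_P1 sextuple_eq using mult by auto
qed

section \<open>The ideal of the curve\<close>

lemma ring_map_comp: "ring_map g \<Longrightarrow> ring_map h \<Longrightarrow> ring_map (\<lambda>a. g (h a))"
  by (simp add: ring_map_def)

lemma ring_map_pconst: "ring_map (\<lambda>c. [:c:])"
  by (intro ring_mapI) (auto simp: one_pCons)

lemma poly_map_poly_sum:
  fixes h :: "'a::zero \<Rightarrow> 'b::comm_ring_1"
  assumes "h 0 = 0"
  shows "poly (map_poly h P) x = (\<Sum>i\<le>degree P. h (coeff P i) * x ^ i)"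
proof -
  have "poly (map_poly h P) x = (\<Sum>i\<le>degree (map_poly h P). h (coeff P i) * x ^ i)"
    by (simp add: poly_altdef coeff_map_poly assms)
  also have "\<dots> = (\<Sum>i\<le>degree P. h (coeff P i) * x ^ i)"
  proof -
    have "degree (map_poly h P) \<le> degree P"
      by (intro degree_le) (auto simp: coeff_map_poly assms coeff_eq_0)
    then show ?thesis
    by (intro sum.mono_neutral_left) (auto simp: coeff_map_poly[of h, OF assms, symmetric] coeff_eq_0)
  qed
  finally show ?thesis .
qed

lemma eval3_sum:
  assumes "ring_map e"
  shows "eval3 e F x y z = (\<Sum>k\<le>degree F. \<Sum>j\<le>degree (coeff F k). \<Sum>i\<le>degree (coeff (coeff F k) j).
    e (coeff (coeff (coeff F k) j) i) * x ^ i * y ^ j * z ^ k)"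
  unfolding eval3_def
  by (simp add: poly_map_poly_sum ring_map_0[OF assms] sum_distrib_right)

lemma eval3_form_scale:
  assumes "ring_map e" "form n F"
  shows "eval3 e F (r * x) (r * y) (r * z) = r ^ n * eval3 e F x y z"
  unfolding eval3_sum[OF assms(1)] sum_distrib_left
proof (intro sum.cong refl)
  fix k j i
  show "e (coeff (coeff (coeff F k) j) i) * (r * x) ^ i * (r * y) ^ j * (r * z) ^ k =
    r ^ n * (e (coeff (coeff (coeff F k) j) i) * x ^ i * y ^ j * z ^ k)"
  proof (cases "coeff (coeff (coeff F k) j) i = 0")
    case False
    then have "n = i + j + k" using assms(2) by (auto simp: form_def)
    then show ?thesis by (simp add: power_mult_distrib power_add mult_ac)
  qed (simp add: ring_map_0[OF assms(1)])
qed

lemma ring_map_of_eval3: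
  assumes "ring_map e" "ring_map h"
  shows "h (eval3 e F x y z) = eval3 (\<lambda>c. h (e c)) F (h x) (h y) (h z)"
  unfolding eval3_sum[OF assms(1)] eval3_sum[OF ring_map_comp[OF assms(2,1)]]
  by (simp add: ring_map_sum[OF assms(2)] ring_map_simps[OF assms(2)])

text \<open>
  Restriction of a polynomial to the cone over the curve. The variable \<open>[:0, 1:]\<close> of the coefficients is
  the coordinate along the lines of the cone; it keeps the homogeneous components apart, so that
  arbitrary polynomials, and not only forms, can be treated.
\<close>

definition cone_pullback :: "poly3 \<Rightarrow> complex poly fps" where
  "cone_pullback G = (let r = fps_const [:0, 1:]; s = fps_X in
    eval3 (\<lambda>c. fps_const [:c:]) G (r * s ^ 6) (r * param_y s) (r * (s ^ 7 * (s + 1))))"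

definition pullback :: "poly3 \<Rightarrow> complex poly" where
  "pullback G = (let s = [:0, 1:] in eval3 (\<lambda>c. [:c:]) G (s ^ 6) (param_y s) (s ^ 7 * (s + 1)))"

lemma ring_map_cone_pullback: "ring_map cone_pullback"
  unfolding cone_pullback_def Let_def
  by (intro ring_map_eval3 ring_map_comp[OF ring_map_fps_const ring_map_pconst])

lemma ring_map_pullback: "ring_map pullback"
  unfolding pullback_def Let_def by (intro ring_map_eval3 ring_map_pconst)

lemma cone_pullback_octic: "cone_pullback octic_form = 0"
proof -
  have "(fps_X :: complex poly fps) + 1 \<noteq> 0" by (rule fps_nonzeroI) simp
  then show ?thesis unfolding cone_pullback_def Let_def
    by (simp add: eval3_octic[OF ring_map_comp[OF ring_map_fps_const ring_map_pconst]]
        octic_scale octic_param)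
qed

lemma ring_map_param_y: "ring_map h \<Longrightarrow> h (param_y s) = param_y (h s)"
  by (simp add: param_y_def ring_map_simps)

text \<open>
  For a form of degree \<open>n\<close> the restriction to the cone is the pullback to the parameter line times the
  \<open>n\<close>-th power of the cone coordinate.
\<close>

lemma cone_pullback_form:
  assumes "form n G" "pullback G = 0" shows "cone_pullback G = 0"
proof -
  let ?s = "[:0, 1:] :: complex poly"
  define l where "l p = fps_of_poly (map_poly (\<lambda>c. [:c:]) p)" for p :: "complex poly"
  have l: "ring_map l" unfolding l_def
    by (rule ring_map_comp[OF _ ring_map_map_poly[OF ring_map_pconst]])
       (auto intro!: ring_mapI simp: fps_of_poly_add fps_of_poly_mult)
  have l_c: "l [:c:] = fps_const [:c:]" for c
    by (cases "c = 0") (simp_all add: l_def map_poly_pCons fps_of_poly_const)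
  have l_s: "l ?s = fps_X" by (simp add: l_def map_poly_pCons fps_of_poly_pCons flip: one_pCons)
  have "cone_pullback G = fps_const [:0, 1:] ^ n *
      eval3 (\<lambda>c. fps_const [:c:]) G (fps_X ^ 6) (param_y fps_X) (fps_X ^ 7 * (fps_X + 1))"
    unfolding cone_pullback_def Let_def
    by (intro eval3_form_scale assms ring_map_comp[OF ring_map_fps_const ring_map_pconst])
  also have "eval3 (\<lambda>c. fps_const [:c:]) G (fps_X ^ 6) (param_y fps_X) (fps_X ^ 7 * (fps_X + 1)) = l (pullback G)"
    unfolding pullback_def Let_def ring_map_of_eval3[OF ring_map_pconst l] l_c
    by (simp only: ring_map_param_y[OF l] ring_map_simps[OF l] l_s)
  also have "\<dots> = 0" by (simp add: assms ring_map_0[OF l])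
  finally show ?thesis by simp
qed

text \<open>
  A polynomial in \<open>x\<close> and \<open>y\<close> alone has, at \<open>s = 0\<close>, six times its order in \<open>x\<close>: after
  the largest power of \<open>x\<close> is divided out, a nonzero polynomial in \<open>y\<close> remains at \<open>x = 0\<close>, and \<open>y\<close> is
  twice the cone coordinate at \<open>s = 0\<close>.
\<close>

lemma cone_pullback_const_order:
  fixes c :: "complex poly poly"
  assumes "c \<noteq> 0"
  obtains a where "cone_pullback [:c:] \<noteq> 0" "subdegree (cone_pullback [:c:]) = a * 6"
proof -
  have "\<exists>i j. coeff (coeff c j) i \<noteq> 0" using assms by (metis leading_coeff_0_iff)
  define a where "a = (LEAST i. \<exists>j. coeff (coeff c j) i \<noteq> 0)"
  have a: "\<exists>j. coeff (coeff c j) a \<noteq> 0" unfolding a_def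
    using \<open>\<exists>i j. _\<close> by (rule LeastI_ex)
  have low: "coeff (coeff c j) i = 0" if "i < a" for i j
    using not_less_Least[of i "\<lambda>i. \<exists>j. coeff (coeff c j) i \<noteq> 0"] that by (auto simp: a_def)
  define c' where "c' = map_poly (poly_shift a) c"
  have shift0: "poly_shift a 0 = (0 :: complex poly)" by (rule poly_eqI) (simp add: coeff_poly_shift)
  have c: "[:c:] = [:[:[:0, 1:]:]:] ^ a * [:c':]"
  proof -
    have c: "c = [:[:0, 1:]:] ^ a * c'"
    proof (intro poly_eqI)
      fix j i
      have "[:[:0, 1 :: complex:]:] ^ a = [:monom 1 a:]"
        by (simp add: ring_map_power[OF ring_map_pconst] monom_altdef)
      then show "coeff (coeff c j) i = coeff (coeff ([:[:0, 1:]:] ^ a * c') j) i"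
        by (simp add: c'_def coeff_map_poly[where f = "poly_shift a", OF shift0] coeff_monom_mult coeff_poly_shift low)
    qed
    show ?thesis using arg_cong[OF c, of "\<lambda>p. [:p:]"]
      by (simp only: ring_map_mult[OF ring_map_pconst] ring_map_power[OF ring_map_pconst])
  qed
  let ?r = "fps_const [:0, 1:] :: complex poly fps"
  have X: "cone_pullback [:[:[:0, 1:]:]:] = ?r * fps_X ^ 6"
    unfolding cone_pullback_def Let_def
    by (simp add: eval3_vars[OF ring_map_comp[OF ring_map_fps_const ring_map_pconst], unfolded varX_def])
  have "cone_pullback [:c':] $ 0 \<noteq> 0"
  proof -
    define d where "d = map_poly (\<lambda>H. coeff H 0) c'"
    have ring0: "ring_map (\<lambda>a :: complex poly fps. a $ 0)" by (intro ring_mapI) auto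
    have "cone_pullback [:c':] $ 0 = eval3 (\<lambda>c. [:c:]) [:c':] 0 [:0, 2:] 0"
      unfolding cone_pullback_def Let_def
        ring_map_of_eval3[OF ring_map_comp[OF ring_map_fps_const ring_map_pconst] ring0]
      by (simp add: param_y_def numeral_poly)
    also have "\<dots> = poly (map_poly (\<lambda>H. [:coeff H 0:]) c') [:0, 2:]"
      by (simp add: eval3_def map_poly_pCons poly_0_coeff_0 coeff_map_poly)
    also have "map_poly (\<lambda>H. [:coeff H 0:]) c' = map_poly (\<lambda>x. [:x:]) d"
      by (rule poly_eqI) (simp add: d_def coeff_map_poly)
    also have "poly (map_poly (\<lambda>x. [:x:]) d) [:0, 2:] = pcompose d [:0, 2:]"
      by (simp add: poly_map_poly_sum pcompose_altdef poly_altdef)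
    finally have eq: "cone_pullback [:c':] $ 0 = pcompose d [:0, 2:]" .
    obtain j where "coeff (coeff c j) a \<noteq> 0" using a by blast
    then have "coeff d j \<noteq> 0" by (simp add: d_def c'_def coeff_map_poly shift0 coeff_poly_shift)
    then have "d \<noteq> 0" by auto
    then show ?thesis unfolding eq using pcompose_eq_0[of d "[:0, 2:]"] by auto
  qed
  then have "cone_pullback [:c':] \<noteq> 0" "subdegree (cone_pullback [:c':]) = 0" by (auto intro: subdegree_eq_0)
  moreover have "?r ^ a \<noteq> 0" "subdegree (?r ^ a) = 0" by (auto simp: subdegree_power)
  moreover have "cone_pullback [:c:] = ?r ^ a * fps_X ^ (6 * a) * cone_pullback [:c':]"
    unfolding c ring_map_simps[OF ring_map_cone_pullback] X by (simp add: power_mult_distrib power_mult)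
  ultimately have "cone_pullback [:c:] \<noteq> 0 \<and> subdegree (cone_pullback [:c:]) = a * 6"
    by (simp add: subdegree_mult)
  then show ?thesis using that by blast
qed

text \<open>
  The terms \<open>c(x, y) * z^i\<close> with \<open>i < 6\<close> have orders congruent to \<open>7 i\<close>, hence to \<open>i\<close>, modulo 6.
\<close>

lemma cone_pullback_low_degree:
  assumes "degree R < 6" "cone_pullback R = 0" shows "R = 0"
proof (rule ccontr)
  assume "R \<noteq> 0"
  define I where "I = {i. i < 6 \<and> coeff R i \<noteq> 0}"
  define t where "t i = cone_pullback [:coeff R i:] * cone_pullback varZ ^ i" for i
  have "lead_coeff R \<noteq> 0" using \<open>R \<noteq> 0\<close> by simp
  then have I: "finite I" "I \<noteq> {}" using assms(1) by (auto simp: I_def)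
  have nz: "(fps_X :: complex poly fps) + 1 \<noteq> 0" by (rule fps_nonzeroI) simp
  have "subdegree ((fps_X :: complex poly fps) + 1) = 0" by (intro subdegree_eq_0) simp
  moreover have "cone_pullback varZ = fps_const [:0, 1:] * (fps_X ^ 7 * (fps_X + 1))"
    unfolding cone_pullback_def Let_def
    by (simp add: eval3_vars[OF ring_map_comp[OF ring_map_fps_const ring_map_pconst]])
  ultimately have Z: "cone_pullback varZ \<noteq> 0" "subdegree (cone_pullback varZ) = 7"
    using nz by (simp_all add: subdegree_mult)
  have "\<exists>a. t i \<noteq> 0 \<and> subdegree (t i) = a * 6 + i * 7" if i: "i \<in> I" for i
  proof -
    have "coeff R i \<noteq> 0" using i by (simp add: I_def)
    then obtain a where "cone_pullback [:coeff R i:] \<noteq> 0" "subdegree (cone_pullback [:coeff R i:]) = a * 6"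
      by (rule cone_pullback_const_order)
    then show ?thesis using Z by (intro exI[of _ a]) (simp add: t_def subdegree_mult subdegree_power)
  qed
  then obtain a where t: "\<And>i. i \<in> I \<Longrightarrow> t i \<noteq> 0" "\<And>i. i \<in> I \<Longrightarrow> subdegree (t i) = a i * 6 + i * 7" by metis
  have "inj_on (\<lambda>i. subdegree (t i)) I"
  proof (rule inj_onI)
    fix i j assume ij: "i \<in> I" "j \<in> I" "subdegree (t i) = subdegree (t j)"
    then have "a i * 6 + i * 7 = a j * 6 + j * 7" using t(2) by simp
    moreover have "i < 6" "j < 6" using ij(1,2) by (auto simp: I_def)
    ultimately show "i = j" by presburger
  qed
  then have nz: "(\<Sum>i\<in>I. t i) \<noteq> 0" using subdegree_sum_distinct[OF I, of t] t(1) by blast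
  have "R = (\<Sum>i<6. [:coeff R i:] * varZ ^ i)"
  proof (rule poly_eqI)
    fix n
    have "coeff (\<Sum>i<6. [:coeff R i:] * varZ ^ i) n = (\<Sum>i<6. if i = n then coeff R n else 0)"
      unfolding coeff_sum varZ_def by (intro sum.cong) (auto simp flip: monom_altdef)
    then show "coeff R n = coeff (\<Sum>i<6. [:coeff R i:] * varZ ^ i) n"
      using assms(1) by (auto simp: coeff_eq_0)
  qed
  then have "cone_pullback R = (\<Sum>i<6. t i)"
    by (metis (no_types, lifting) ring_map_mult[OF ring_map_cone_pullback] ring_map_power[OF ring_map_cone_pullback] ring_map_sum[OF ring_map_cone_pullback] sum.cong t_def)
  also have "\<dots> = (\<Sum>i\<in>I. t i)"
    by (intro sum.mono_neutral_right) (auto simp: I_def t_def ring_map_0[OF ring_map_cone_pullback])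
  finally show False using nz assms(2) by simp
qed

lemma octic_form_coeffs:
  defines "x \<equiv> [:[:0, 1:]:] :: complex poly poly" and "y \<equiv> [:0, 1:] :: complex poly poly"
  shows "octic_form = [:168 * x^8 - 2 * x^7 * y, 2880 * x^7 - 36 * x^6 * y, 18756 * x^6 - 252 * x^5 * y,
    55376 * x^5 - 840 * x^4 * y, 63504 * x^4 - 1260 * x^3 * y, - (504 * x^2 * y), y^2:]"
proof -
  have pCons: "pCons a p = [:a:] + varZ * p" for a :: "complex poly poly" and p by (simp add: varZ_def)
  have vars: "varX = [:x:]" "varY = [:y:]" by (simp_all add: varX_def varY_def x_def y_def)
  have "[:168 * x^8 - 2 * x^7 * y, 2880 * x^7 - 36 * x^6 * y, 18756 * x^6 - 252 * x^5 * y,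
    55376 * x^5 - 840 * x^4 * y, 63504 * x^4 - 1260 * x^3 * y, - (504 * x^2 * y), y^2:] =
    [:168 * x^8 - 2 * x^7 * y:] + varZ * ([:2880 * x^7 - 36 * x^6 * y:] + varZ * ([:18756 * x^6 - 252 * x^5 * y:]
     + varZ * ([:55376 * x^5 - 840 * x^4 * y:] + varZ * ([:63504 * x^4 - 1260 * x^3 * y:] + varZ *
      ([:- (504 * x^2 * y):] + varZ * [:y^2:])))))"
    by (simp add: varZ_def)
  also have "\<dots> = octic_form"
    unfolding octic_form_def octic_def puiseux_head_def tail_form_def ring_map_simps[OF ring_map_pconst]
      vars[symmetric] by algebra
  finally show ?thesis ..
qed

text \<open>
  The polynomial \<open>y\<close> is prime and does not divide the equation of the curve, whose value at \<open>y = 0\<close> has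
  the term \<open>168 x^8\<close>.
\<close>

lemma octic_dvd_cancel_y:
  assumes "octic_form dvd [:[:0, 1:] ^ k:] * G" shows "octic_form dvd G"
  using assms
proof (induction k arbitrary: G)
  case 0
  then show ?case by (simp flip: one_pCons)
next
  case (Suc k)
  let ?y = "[:[:0, 1:]:] :: poly3"
  have "[:[:0, 1:] ^ Suc k:] * G = [:[:0, 1:] ^ k:] * (?y * G)" by simp
  then have "octic_form dvd ?y * G" using Suc by (simp only:)
  then obtain Q where Q: "?y * G = octic_form * Q" by blast
  let ?h = "map_poly (\<lambda>p :: complex poly poly. coeff p 0)"
  have h: "ring_map ?h"
    by (intro ring_map_map_poly ring_mapI) (auto simp: coeff_mult)
  have "?h ?y * ?h G = ?h octic_form * ?h Q"
    using arg_cong[OF Q, of ?h] by (simp only: ring_map_mult[OF h])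
  moreover have "?h ?y = 0" by (simp add: map_poly_pCons)
  ultimately have "?h octic_form * ?h Q = 0" by simp
  moreover have "coeff (?h octic_form) 0 \<noteq> 0"
    by (simp add: octic_form_coeffs coeff_map_poly coeff_mult numeral_poly poly_const_pow)
  then have "?h octic_form \<noteq> 0" by auto
  ultimately have Q0: "?h Q = 0" by simp
  have shift0: "poly_shift (Suc 0) 0 = (0 :: complex poly poly)" by (rule poly_eqI) (simp add: coeff_poly_shift)
  define Q' where "Q' = map_poly (poly_shift (Suc 0)) Q"
  have "Q = ?y * Q'"
  proof (intro poly_eqI)
    fix n j i
    have "coeff (coeff Q n) 0 = 0" using arg_cong[OF Q0, of "\<lambda>p. coeff p n"] by (simp add: coeff_map_poly)
    then show "coeff (coeff (coeff Q n) j) i = coeff (coeff (coeff (?y * Q') n) j) i"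
      by (simp add: Q'_def coeff_map_poly[where f = "poly_shift (Suc 0)", OF shift0] coeff_pCons coeff_poly_shift split: nat.splits)
  qed
  then have "?y * G = ?y * (octic_form * Q')" using Q by (simp add: mult_ac)
  moreover have "?y \<noteq> 0" by simp
  ultimately have "G = octic_form * Q'" by (metis mult_left_cancel)
  then show ?case by simp
qed

text \<open>
  Pseudo-division with respect to \<open>z\<close> leaves a remainder of degree less than 6, which vanishes on
  the cone and so is 0. The leading coefficient \<open>y^2\<close> of the equation is cancelled afterwards.
\<close>

lemma cone_pullback_kernel:
  assumes "cone_pullback G = 0" shows "octic_form dvd G"
proof -
  obtain Q R where QR: "pseudo_divmod G octic_form = (Q, R)" by (cases "pseudo_divmod G octic_form")
  have deg: "degree octic_form = 6" and lead: "coeff octic_form 6 = [:0, 1:] ^ 2"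
    by (simp_all add: octic_form_coeffs eval_nat_numeral)
  have nz: "octic_form \<noteq> 0" using deg by auto
  define N where "N = Suc (degree G) - 6"
  have *: "smult (([:0, 1:] ^ 2) ^ N) G = octic_form * Q + R" "R = 0 \<or> degree R < 6"
    using pseudo_divmod[OF nz QR] by (simp_all add: deg lead N_def)
  have "cone_pullback ([:([:0, 1:] ^ 2) ^ N:] * G) = cone_pullback (octic_form * Q + R)"
    using *(1) by simp
  then have "cone_pullback R = 0"
    by (simp add: ring_map_simps[OF ring_map_cone_pullback] assms cone_pullback_octic del: mult_pCons_left)
  then have "R = 0" using *(2) cone_pullback_low_degree by blast
  then have "octic_form dvd [:[:0, 1:] ^ (2 * N):] * G" using *(1) by (simp add: power_mult)
  then show ?thesis by (rule octic_dvd_cancel_y)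
qed

lemma irreducible_octic: "irreducible octic_form"
proof (rule irreducibleI)
  show "octic_form \<noteq> 0" by (auto simp: octic_form_coeffs)
  show "\<not> octic_form dvd 1"
  proof
    assume "octic_form dvd 1"
    then obtain h where h: "1 = octic_form * h" by blast
    have "cone_pullback 1 = cone_pullback octic_form * cone_pullback h"
      using arg_cong[OF h, of cone_pullback] by (simp only: ring_map_mult[OF ring_map_cone_pullback])
    then show False by (simp add: cone_pullback_octic ring_map_1[OF ring_map_cone_pullback])
  qed
  have unit: "b dvd 1" if ab: "octic_form = a * b" "cone_pullback a = 0" for a b
  proof -
    obtain h where h: "a = octic_form * h" using cone_pullback_kernel[OF ab(2)] by blast
    have "octic_form * 1 = octic_form * (h * b)" using ab(1) h by (simp only: mult.assoc mult_1_right)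
    then have "1 = h * b" using \<open>octic_form \<noteq> 0\<close> by (metis mult_left_cancel)
    then show ?thesis by (metis dvd_triv_right)
  qed
  fix a b assume ab: "octic_form = a * b"
  then have "cone_pullback a * cone_pullback b = 0"
    by (metis ring_map_mult[OF ring_map_cone_pullback] cone_pullback_octic)
  then show "a dvd 1 \<or> b dvd 1" using unit[of a b] unit[of b a] ab by (auto simp: mult.commute)
qed

lemma pullback_eq_0_iff: "form n G \<Longrightarrow> pullback G = 0 \<longleftrightarrow> octic_form dvd G"
proof
  have "[:0, 1:] + 1 \<noteq> (0 :: complex poly)" by (simp add: one_pCons)
  then have oct: "pullback octic_form = 0"
    unfolding pullback_def Let_def by (subst eval3_octic[OF ring_map_pconst], intro octic_param) auto
  show "octic_form dvd G \<Longrightarrow> pullback G = 0"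
    by (auto simp: ring_map_mult[OF ring_map_pullback] oct)
qed (use cone_pullback_form cone_pullback_kernel in blast)

section \<open>Restriction of rational functions to the curve\<close>

text \<open>
  The residue map from the local ring of the plane along the curve to the function field of the
  parameter line.
\<close>

definition restrict_fun :: "poly3 fract \<Rightarrow> complex poly fract" where
  "restrict_fun a = (SOME q. \<exists>G H n. form n G \<and> form n H \<and> pullback H \<noteq> 0 \<and>
     a = Fract G H \<and> q = Fract (pullback G) (pullback H))"

lemma fun_ringI:
  "form n G \<Longrightarrow> form n H \<Longrightarrow> pullback H \<noteq> 0 \<Longrightarrow> Fract G H \<in> fun_ring octic_form"
  unfolding fun_ring_def using pullback_eq_0_iff by blast

lemma fun_ringE:
  assumes "a \<in> fun_ring octic_form"
  obtains G H n where "form n G" "form n H" "pullback H \<noteq> 0" "a = Fract G H"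
  using assms pullback_eq_0_iff unfolding fun_ring_def by blast

lemma restrict_fun_Fract:
  assumes "form n G" "form n H" "pullback H \<noteq> 0"
  shows "restrict_fun (Fract G H) = Fract (pullback G) (pullback H)"
proof -
  let ?P = "\<lambda>q. \<exists>G' H' n. form n G' \<and> form n H' \<and> pullback H' \<noteq> 0 \<and>
     Fract G H = Fract G' H' \<and> q = Fract (pullback G') (pullback H')"
  have "?P (restrict_fun (Fract G H))"
    unfolding restrict_fun_def by (rule someI[of ?P "Fract (pullback G) (pullback H)"]) (use assms in blast)
  then obtain G' H' where *: "pullback H' \<noteq> 0" "Fract G H = Fract G' H'"
    "restrict_fun (Fract G H) = Fract (pullback G') (pullback H')" by blast
  have "H \<noteq> 0" "H' \<noteq> 0" using *(1) assms(3) ring_map_0[OF ring_map_pullback] by auto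
  then have "G * H' = G' * H" using *(2) by (simp add: eq_fract)
  then have "pullback G * pullback H' = pullback G' * pullback H"
    by (metis ring_map_mult[OF ring_map_pullback])
  then show ?thesis using * assms(3) by (simp add: eq_fract)
qed

lemma nonzero_of_pullback: "pullback H \<noteq> 0 \<Longrightarrow> H \<noteq> 0"
  using ring_map_0[OF ring_map_pullback] by auto

lemma restrict_add:
  assumes "a \<in> fun_ring octic_form" "b \<in> fun_ring octic_form"
  shows "a + b \<in> fun_ring octic_form \<and> restrict_fun (a + b) = restrict_fun a + restrict_fun b"
proof -
  obtain G H n where a: "form n G" "form n H" "pullback H \<noteq> 0" "a = Fract G H"
    using assms(1) by (rule fun_ringE)
  obtain G' H' n' where b: "form n' G'" "form n' H'" "pullback H' \<noteq> 0" "b = Fract G' H'"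
    using assms(2) by (rule fun_ringE)
  have "a + b = Fract (G * H' + G' * H) (H * H')"
    using a b nonzero_of_pullback by simp
  moreover have f: "form (n + n') (G * H' + G' * H)" "form (n + n') (H * H')"
    using form_mult[OF a(1) b(2)] form_mult[OF b(1) a(2)] form_mult[OF a(2) b(2)]
    by (auto intro: form_add simp: add.commute)
  moreover have "pullback (H * H') \<noteq> 0" using a b by (simp add: ring_map_mult[OF ring_map_pullback])
  ultimately show ?thesis
    using fun_ringI restrict_fun_Fract[OF f] restrict_fun_Fract[OF a(1-3)] restrict_fun_Fract[OF b(1-3)] a b
    by (auto simp: ring_map_simps[OF ring_map_pullback])
qed

lemma restrict_mult:
  assumes "a \<in> fun_ring octic_form" "b \<in> fun_ring octic_form"
  shows "a * b \<in> fun_ring octic_form \<and> restrict_fun (a * b) = restrict_fun a * restrict_fun b"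
proof -
  obtain G H n where a: "form n G" "form n H" "pullback H \<noteq> 0" "a = Fract G H"
    using assms(1) by (rule fun_ringE)
  obtain G' H' n' where b: "form n' G'" "form n' H'" "pullback H' \<noteq> 0" "b = Fract G' H'"
    using assms(2) by (rule fun_ringE)
  have "a * b = Fract (G * G') (H * H')" using a b by simp
  moreover have f: "form (n + n') (G * G')" "form (n + n') (H * H')"
    using form_mult a b by auto
  moreover have "pullback (H * H') \<noteq> 0" using a b by (simp add: ring_map_mult[OF ring_map_pullback])
  ultimately show ?thesis
    using fun_ringI restrict_fun_Fract[OF f] restrict_fun_Fract[OF a(1-3)] restrict_fun_Fract[OF b(1-3)] a b
    by (auto simp: ring_map_simps[OF ring_map_pullback])
qed

lemma restrict_const: "fun_const c \<in> fun_ring octic_form \<and> restrict_fun (fun_const c) = Fract [:c:] 1"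
proof -
  have p: "pullback 1 = 1" "pullback [:[:[:c:]:]:] = [:c:]"
    by (simp_all add: ring_map_1[OF ring_map_pullback]) (simp add: pullback_def Let_def eval3_const[OF ring_map_pconst])
  then show ?thesis unfolding fun_const_def
    using fun_ringI[OF form_const form_1] restrict_fun_Fract[OF form_const form_1] by auto
qed

lemma fun_ideal_iff: "a \<in> fun_ideal octic_form \<longleftrightarrow> a \<in> fun_ring octic_form \<and> restrict_fun a = 0"
proof
  assume "a \<in> fun_ideal octic_form"
  then obtain G H n where a: "form n G" "form n H" "\<not> octic_form dvd H" "octic_form dvd G" "a = Fract G H"
    by (auto simp: fun_ideal_def)
  then have "pullback H \<noteq> 0" "pullback G = 0" using pullback_eq_0_iff by auto
  then show "a \<in> fun_ring octic_form \<and> restrict_fun a = 0"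
    using a fun_ringI restrict_fun_Fract[OF a(1,2)] by (auto simp: fract_collapse)
next
  assume a: "a \<in> fun_ring octic_form \<and> restrict_fun a = 0"
  then obtain G H n where b: "form n G" "form n H" "pullback H \<noteq> 0" "a = Fract G H"
    using fun_ringE by blast
  then have "Fract (pullback G) (pullback H) = 0" using a restrict_fun_Fract by auto
  then have "pullback G = 0" using b(3) by (simp add: Zero_fract_def eq_fract)
  then show "a \<in> fun_ideal octic_form" using b pullback_eq_0_iff unfolding fun_ideal_def by blast
qed

lemma restrict_inverse:
  assumes "a \<in> fun_ring octic_form" "restrict_fun a \<noteq> 0"
  shows "\<exists>b\<in>fun_ring octic_form. restrict_fun b = inverse (restrict_fun a)"
proof -
  obtain G H n where a: "form n G" "form n H" "pullback H \<noteq> 0" "a = Fract G H"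
    using assms(1) by (rule fun_ringE)
  have r: "restrict_fun a = Fract (pullback G) (pullback H)" using restrict_fun_Fract a by simp
  then have "pullback G \<noteq> 0" using assms(2) by (auto simp: fract_collapse)
  then show ?thesis using fun_ringI[OF a(2,1)] restrict_fun_Fract[OF a(2,1)] r by auto
qed

text \<open>
  By \<open>param_parameter\<close> the parameter \<open>t = 1 + 2s\<close> is the restriction of
  \<open>(z^6 y - x^2 e) / ((x + 4z)^4 x^3)\<close>, and it generates the field.
\<close>

lemma restrict_surj: "\<exists>a\<in>fun_ring octic_form. restrict_fun a = q"
proof -
  define Im where "Im = restrict_fun ` fun_ring octic_form"
  have add: "x + y \<in> Im" and mult: "x * y \<in> Im" if xy: "x \<in> Im" "y \<in> Im" for x y
  proof -
    obtain a b where ab: "a \<in> fun_ring octic_form" "b \<in> fun_ring octic_form"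
      "x = restrict_fun a" "y = restrict_fun b" using xy by (auto simp: Im_def)
    then have "x + y = restrict_fun (a + b)" "x * y = restrict_fun (a * b)"
      using restrict_add restrict_mult by simp_all
    then show "x + y \<in> Im" "x * y \<in> Im"
      using restrict_add[OF ab(1,2)] restrict_mult[OF ab(1,2)] unfolding Im_def by blast+
  qed
  have const: "Fract [:c:] 1 \<in> Im" for c
    using restrict_const[of c] unfolding Im_def by (metis imageI)
  have inv: "inverse x \<in> Im" if x: "x \<in> Im" for x
  proof (cases "x = 0")
    case False
    obtain a where "a \<in> fun_ring octic_form" "x = restrict_fun a" using x by (auto simp: Im_def)
    then obtain b where "b \<in> fun_ring octic_form" "restrict_fun b = inverse x"
      using False restrict_inverse[of a] by auto
    then show ?thesis unfolding Im_def by (metis imageI)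
  qed (use x in simp)
  let ?s = "[:0, 1:] :: complex poly"
  have t: "Fract (1 + 2 * ?s) 1 \<in> Im"
  proof -
    define G where "G = varZ^6 * varY - varX^2 * puiseux_head varX varZ"
    define H where "H = (varX + 4 * varZ)^4 * varX^3"
    have f1: "form 7 (varZ^6 * varY)"
      by (rule form_eqI[OF form_mult[OF form_power[OF form_vars(3)] form_vars(2)]]) simp
    have f2: "form 7 (varX^2 * puiseux_head varX varZ)"
      by (rule form_eqI[OF form_mult[OF form_power[OF form_vars(1)] form_head]]) simp
    have "form 1 (varX + 4 * varZ)"
      using form_mult[OF form_numeral form_vars(3)] by (intro form_add form_vars) simp
    then have f3: "form 7 H" unfolding H_def
      by (intro form_eqI[OF form_mult[OF form_power form_power[OF form_vars(1)]]]) simp_all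
    have v: "pullback varX = ?s ^ 6" "pullback varY = param_y ?s" "pullback varZ = ?s ^ 7 * (?s + 1)"
      by (simp_all only: pullback_def Let_def eval3_vars[OF ring_map_pconst])
    have pG: "pullback G = ?s ^ 42 * (1 + 2 * ?s) ^ 9"
      unfolding G_def ring_map_simps[OF ring_map_pullback] ring_map_head[OF ring_map_pullback] v
      by (rule param_parameter)
    have pH: "pullback H = ?s ^ 42 * (1 + 2 * ?s) ^ 8"
      unfolding H_def ring_map_simps[OF ring_map_pullback] v by algebra
    have nz: "1 + 2 * ?s \<noteq> 0" by (simp add: one_pCons numeral_poly)
    then have "pullback H \<noteq> 0" unfolding pH by simp
    then have "Fract G H \<in> fun_ring octic_form" "restrict_fun (Fract G H) = Fract (pullback G) (pullback H)"
      using form_diff[OF f1 f2] f3 by (auto simp: G_def[symmetric] intro: fun_ringI restrict_fun_Fract)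
    moreover have "Fract (pullback G) (pullback H) = Fract (1 + 2 * ?s) 1"
      unfolding pG pH using nz by (subst eq_fract) (auto simp: power_Suc mult_ac eval_nat_numeral)
    ultimately show ?thesis unfolding Im_def by (metis imageI)
  qed
  have s: "Fract ?s 1 \<in> Im"
  proof -
    have "Fract ?s 1 = Fract [:1/2:] 1 * (Fract (1 + 2 * ?s) 1 + Fract [:-1:] 1)"
      by (simp add: one_pCons numeral_poly)
    then show ?thesis using add mult const t by metis
  qed
  have poly: "Fract P 1 \<in> Im" for P
  proof (induction P)
    case 0
    then show ?case using const[of 0] by simp
  next
    case (pCons a P)
    have "Fract (pCons a P) 1 = Fract [:a:] 1 + Fract ?s 1 * Fract P 1" by simp
    then show ?case using add mult const s pCons.IH by metis
  qed
  obtain P Q where "q = Fract P Q" "Q \<noteq> 0" by (cases q)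
  then have "q = Fract P 1 * inverse (Fract Q 1)" by simp
  then have "q \<in> Im" using mult inv poly by metis
  then show ?thesis unfolding Im_def by auto
qed

section \<open>Valuations of the rational function field\<close>

text \<open>
  The points of the projective line are \<open>Some c\<close> for complex \<open>c\<close>, and \<open>None\<close> for infinity.
\<close>

definition poly_val :: "complex option \<Rightarrow> complex poly \<Rightarrow> int" where
  "poly_val p P = (case p of None \<Rightarrow> - int (degree P) | Some c \<Rightarrow> int (order c P))"

lemma poly_val_mult: "P \<noteq> 0 \<Longrightarrow> Q \<noteq> 0 \<Longrightarrow> poly_val p (P * Q) = poly_val p P + poly_val p Q"
  by (cases p) (auto simp: poly_val_def degree_mult_eq order_mult)

lemma poly_val_power: "P \<noteq> 0 \<Longrightarrow> poly_val p (P ^ n) = int n * poly_val p P"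
proof (induction n)
  case 0
  show ?case by (cases p) (auto simp: poly_val_def order_0I)
qed (simp add: poly_val_mult algebra_simps)

lemma poly_val_const: "c \<noteq> 0 \<Longrightarrow> poly_val p [:c:] = 0"
  by (cases p) (auto simp: poly_val_def order_0I)

lemma poly_val_linear:
  "poly_val (Some c) [:- d, 1:] = (if c = d then 1 else 0)" "poly_val None [:- d, 1:] = -1"
  using order_power_n_n[of d 1] by (auto simp: poly_val_def intro!: order_0I)

lemma poly_val_add:
  assumes "P \<noteq> 0" "Q \<noteq> 0" "P + Q \<noteq> 0"
  shows "min (poly_val p P) (poly_val p Q) \<le> poly_val p (P + Q)"
proof (cases p)
  case None
  then show ?thesis using degree_add_le_max[of P Q] by (auto simp: poly_val_def)
next
  case (Some c)
  let ?m = "min (order c P) (order c Q)"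
  have "[:- c, 1:] ^ ?m dvd P" "[:- c, 1:] ^ ?m dvd Q"
    by (meson order_1 power_le_dvd min.cobounded1 min.cobounded2)+
  then have "[:- c, 1:] ^ ?m dvd P + Q" by (rule dvd_add)
  then have "?m \<le> order c (P + Q)" using assms(3) by (simp add: order_divides)
  then show ?thesis using Some by (auto simp: poly_val_def)
qed

definition val :: "complex option \<Rightarrow> complex poly fract \<Rightarrow> int" where
  "val p q = (SOME n. \<exists>P Q. P \<noteq> 0 \<and> Q \<noteq> 0 \<and> q = Fract P Q \<and> n = poly_val p P - poly_val p Q)"

lemma val_Fract:
  assumes "P \<noteq> 0" "Q \<noteq> 0" shows "val p (Fract P Q) = poly_val p P - poly_val p Q"
proof -
  let ?P = "\<lambda>n. \<exists>P' Q'. P' \<noteq> 0 \<and> Q' \<noteq> 0 \<and> Fract P Q = Fract P' Q' \<and> n = poly_val p P' - poly_val p Q'"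
  have "?P (val p (Fract P Q))" unfolding val_def by (rule someI[of ?P]) (use assms in blast)
  then obtain P' Q' where *: "P' \<noteq> 0" "Q' \<noteq> 0" "Fract P Q = Fract P' Q'"
    "val p (Fract P Q) = poly_val p P' - poly_val p Q'" by blast
  then have "P * Q' = P' * Q" using assms by (simp add: eq_fract)
  then have "poly_val p P + poly_val p Q' = poly_val p P' + poly_val p Q"
    using assms * poly_val_mult by metis
  then show ?thesis using * by simp
qed

lemma nonzero_fract_cases:
  fixes q :: "complex poly fract"
  assumes "q \<noteq> 0" obtains P Q where "P \<noteq> 0" "Q \<noteq> 0" "q = Fract P Q"
proof -
  obtain P Q where *: "q = Fract P Q" "Q \<noteq> 0" by (cases q)
  then have "P \<noteq> 0" using assms by (auto simp: fract_collapse)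
  then show ?thesis using * that by blast
qed

definition valuation :: "(complex poly fract \<Rightarrow> int) \<Rightarrow> bool" where
  "valuation W \<longleftrightarrow> (\<forall>a b. a \<noteq> 0 \<longrightarrow> b \<noteq> 0 \<longrightarrow> W (a * b) = W a + W b) \<and>
    (\<forall>a b. a \<noteq> 0 \<longrightarrow> b \<noteq> 0 \<longrightarrow> a + b \<noteq> 0 \<longrightarrow> min (W a) (W b) \<le> W (a + b)) \<and>
    (\<forall>c. c \<noteq> 0 \<longrightarrow> W (Fract [:c:] 1) = 0) \<and> (\<exists>q. q \<noteq> 0 \<and> W q = 1)"

lemma val_mult: "a \<noteq> 0 \<Longrightarrow> b \<noteq> 0 \<Longrightarrow> val p (a * b) = val p a + val p b"
  by (elim nonzero_fract_cases) (simp add: val_Fract poly_val_mult)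

lemma val_linear: "val (Some c) (Fract [:- d, 1:] 1) = (if c = d then 1 else 0)"
  "val None (Fract [:- d, 1:] 1) = -1"
  using poly_val_linear poly_val_const[of 1] by (simp_all add: val_Fract one_pCons)

lemma valuation_val: "valuation (val p)"
  unfolding valuation_def
proof (intro conjI allI impI)
  fix a b :: "complex poly fract" assume "a \<noteq> 0" "b \<noteq> 0"
  then show "val p (a * b) = val p a + val p b" by (rule val_mult)
next
  fix a b :: "complex poly fract" assume nz: "a \<noteq> 0" "b \<noteq> 0" "a + b \<noteq> 0"
  obtain P Q where a: "P \<noteq> 0" "Q \<noteq> 0" "a = Fract P Q" using nz(1) by (rule nonzero_fract_cases)
  obtain P' Q' where b: "P' \<noteq> 0" "Q' \<noteq> 0" "b = Fract P' Q'" using nz(2) by (rule nonzero_fract_cases)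
  have ab: "a + b = Fract (P * Q' + P' * Q) (Q * Q')" using a b by simp
  then have "P * Q' + P' * Q \<noteq> 0" using nz(3) by (auto simp: fract_collapse)
  then show "min (val p a) (val p b) \<le> val p (a + b)"
    using poly_val_add[of "P * Q'" "P' * Q" p] a b by (simp add: ab val_Fract poly_val_mult)
next
  fix c :: complex assume "c \<noteq> 0"
  then show "val p (Fract [:c:] 1) = 0" using poly_val_const[of 1] by (simp add: val_Fract poly_val_const one_pCons)
next
  show "\<exists>q. q \<noteq> 0 \<and> val p q = 1"
  proof (cases p)
    case None
    have "Fract 1 [:-0, 1 :: complex:] \<noteq> 0" by (simp add: Zero_fract_def eq_fract)
    moreover have "val None (Fract 1 [:-0, 1:]) = 1"
      using poly_val_linear(2)[of 0] poly_val_const[of 1] by (simp add: val_Fract one_pCons)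
    ultimately show ?thesis using None by blast
  next
    case (Some c)
    have "Fract [:-c, 1:] 1 \<noteq> 0" by (simp add: Zero_fract_def eq_fract)
    then show ?thesis using Some val_linear(1)[of c c] by auto
  qed
qed

text \<open>
  Over the complex numbers the linear polynomials and the constants generate all others.
\<close>

lemma poly_multiplicative_eq:
  fixes f g :: "complex poly \<Rightarrow> int"
  assumes f: "\<And>P Q. P \<noteq> 0 \<Longrightarrow> Q \<noteq> 0 \<Longrightarrow> f (P * Q) = f P + f Q"
    and g: "\<And>P Q. P \<noteq> 0 \<Longrightarrow> Q \<noteq> 0 \<Longrightarrow> g (P * Q) = g P + g Q"
    and const: "\<And>c. c \<noteq> 0 \<Longrightarrow> f [:c:] = g [:c:]" and linear: "\<And>c. f [:- c, 1:] = g [:- c, 1:]"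
    and "P \<noteq> 0"
  shows "f P = g P"
  using \<open>P \<noteq> 0\<close>
proof (induction "degree P" arbitrary: P)
  case 0
  then obtain c where "P = [:c:]" by (metis degree_eq_zeroE)
  then show ?case using const 0 by auto
next
  case (Suc n)
  then have "\<not> constant (poly P)" by (simp add: constant_degree)
  then obtain z where "poly P z = 0" using fundamental_theorem_of_algebra by blast
  then obtain Q where Q: "P = [:- z, 1:] * Q" by (auto simp: poly_eq_0_iff_dvd)
  then have "Q \<noteq> 0" using Suc.prems by auto
  moreover from this have "degree P = 1 + degree Q" unfolding Q by (subst degree_mult_eq) auto
  ultimately show ?case using Suc linear f[of "[:- z, 1:]" Q] g[of "[:- z, 1:]" Q] unfolding Q by auto
qed

text \<open>
  If \<open>W\<close> is not 0 at \<open>s - c\<close>, then the strict triangle inequality determines it at all other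
  \<open>s - d\<close>: its value there is 0 in case of a zero at \<open>c\<close>, and the same negative number in case of a
  pole. So \<open>W\<close> is a multiple of the valuation at \<open>c\<close> or at infinity, and normalized.
\<close>

lemma valuation_classification:
  assumes "valuation W" shows "\<exists>p. \<forall>q. q \<noteq> 0 \<longrightarrow> W q = val p q"
proof -
  have mult: "\<And>a b. a \<noteq> 0 \<Longrightarrow> b \<noteq> 0 \<Longrightarrow> W (a * b) = W a + W b"
    and add: "\<And>a b. a \<noteq> 0 \<Longrightarrow> b \<noteq> 0 \<Longrightarrow> a + b \<noteq> 0 \<Longrightarrow> min (W a) (W b) \<le> W (a + b)"
    and const: "\<And>c. c \<noteq> 0 \<Longrightarrow> W (Fract [:c:] 1) = 0" and one: "\<exists>q. q \<noteq> 0 \<and> W q = 1"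
    using assms by (auto simp: valuation_def)
  have uminus: "W (- b) = W b" if "b \<noteq> 0" for b
  proof -
    have m1: "Fract [:-1:] 1 = (- 1 :: complex poly fract)"
      by (simp add: One_fract_def one_pCons)
    show ?thesis using mult[of "-1" b] const[of "-1"] that by (simp add: m1)
  qed
  have strict_less: "W (a + b) = W a" if "a \<noteq> 0" "b \<noteq> 0" "a + b \<noteq> 0" "W a < W b" for a b
  proof -
    have "min (W a) (W b) \<le> W (a + b)" using add that by blast
    moreover have "min (W (a + b)) (W (- b)) \<le> W ((a + b) + - b)" using that by (intro add) auto
    ultimately show ?thesis using that uminus[OF that(2)] by auto
  qed
  have strict: "W (a + b) = min (W a) (W b)" if "a \<noteq> 0" "b \<noteq> 0" "a + b \<noteq> 0" "W a \<noteq> W b" for a b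
    using strict_less[of a b] strict_less[of b a] that by (cases "W a < W b") (auto simp: add.commute)
  define w where "w P = W (Fract P 1)" for P
  have w_mult: "w (P * Q) = w P + w Q" if "P \<noteq> 0" "Q \<noteq> 0" for P Q
    using mult[of "Fract P 1" "Fract Q 1"] that by (simp add: w_def Zero_fract_def eq_fract)
  have W_Fract: "W (Fract P Q) = w P - w Q" if "P \<noteq> 0" "Q \<noteq> 0" for P Q
  proof -
    have eq: "Fract P 1 = Fract P Q * Fract Q 1" using that by (simp add: eq_fract)
    have "w P = W (Fract P Q) + w Q" unfolding w_def
      by (subst eq, rule mult) (use that in \<open>auto simp: Zero_fract_def eq_fract\<close>)
    then show ?thesis by simp
  qed
  have w_other: "w [:- d, 1:] = min (w [:- c, 1:]) 0" if "w [:- c, 1:] \<noteq> 0" "d \<noteq> c" for c d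
  proof -
    have "Fract [:- d, 1:] 1 = Fract [:- c, 1:] 1 + Fract [:c - d:] 1" by simp
    moreover have "W (Fract [:c - d:] 1) = 0" using that by (intro const) auto
    ultimately show ?thesis using strict[of "Fract [:- c, 1:] 1" "Fract [:c - d:] 1"] that
      by (simp add: w_def Zero_fract_def eq_fract)
  qed
  have "\<exists>c. w [:- c, 1:] \<noteq> 0"
  proof (rule ccontr)
    assume "\<nexists>c. w [:- c, 1:] \<noteq> 0"
    then have zero: "w P = 0" if "P \<noteq> 0" for P
      using poly_multiplicative_eq[of w "\<lambda>_. 0" P] w_mult const that by (auto simp: w_def)
    obtain q where q: "q \<noteq> 0" "W q = 1" using one by blast
    obtain P Q where "P \<noteq> 0" "Q \<noteq> 0" "q = Fract P Q" using q(1) by (rule nonzero_fract_cases)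
    then show False using W_Fract zero q(2) by simp
  qed
  then obtain c where c: "w [:- c, 1:] \<noteq> 0" by blast
  define k where "k = \<bar>w [:- c, 1:]\<bar>"
  define p where "p = (if w [:- c, 1:] > 0 then Some c else None)"
  have linear: "w [:- d, 1:] = k * poly_val p [:- d, 1:]" for d
    using c w_other[OF c, of d] by (auto simp: k_def p_def poly_val_linear)
  have w_eq: "w P = k * poly_val p P" if "P \<noteq> 0" for P
  proof (rule poly_multiplicative_eq[of w "\<lambda>P. k * poly_val p P"])
    show "w (P * Q) = w P + w Q" if "P \<noteq> 0" "Q \<noteq> 0" for P Q using that by (rule w_mult)
    show "k * poly_val p (P * Q) = k * poly_val p P + k * poly_val p Q" if "P \<noteq> 0" "Q \<noteq> 0" for P Q
      using that by (simp add: poly_val_mult distrib_left)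
    show "w [:c:] = k * poly_val p [:c:]" if "c \<noteq> 0" for c
      using const[OF that] poly_val_const[OF that] by (simp add: w_def)
    show "w [:- d, 1:] = k * poly_val p [:- d, 1:]" for d by (rule linear)
  qed (rule that)
  have W_eq: "W q = k * val p q" if nz: "q \<noteq> 0" for q
  proof -
    obtain P Q where "P \<noteq> 0" "Q \<noteq> 0" "q = Fract P Q" using nz by (rule nonzero_fract_cases)
    then show ?thesis by (simp add: W_Fract w_eq val_Fract algebra_simps)
  qed
  obtain q where "q \<noteq> 0" "W q = 1" using one by blast
  then have "k * val p q = 1" using W_eq by simp
  then have "k = 1" using c by (auto simp: zmult_eq_1_iff k_def)
  then show ?thesis using W_eq by auto
qed

text \<open>
  Each root of the denominator is a root of the numerator, and the common factor can be cancelled.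
\<close>

lemma polynomial_if_no_finite_poles:
  assumes "x \<noteq> 0" "\<And>c. val (Some c) x \<ge> 0"
  obtains P where "P \<noteq> 0" "x = Fract P 1"
proof -
  have "\<exists>P'. P' \<noteq> 0 \<and> Fract P Q = Fract P' 1"
    if "P \<noteq> 0" "Q \<noteq> 0" "\<And>c. order c Q \<le> order c P" for P Q :: "complex poly"
    using that
  proof (induction "degree Q" arbitrary: P Q)
    case 0
    then obtain c where c: "Q = [:c:]" "c \<noteq> 0" by (metis degree_eq_zeroE pCons_0_0)
    then have "Fract P Q = Fract (smult (1 / c) P) 1" by (simp add: eq_fract)
    then show ?case using 0 c by (intro exI[of _ "smult (1 / c) P"]) auto
  next
    case (Suc n)
    then have "\<not> constant (poly Q)" by (simp add: constant_degree)
    then obtain z where z: "poly Q z = 0" using fundamental_theorem_of_algebra by blast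
    then obtain Q' where Q: "Q = [:- z, 1:] * Q'" by (auto simp: poly_eq_0_iff_dvd)
    have "order z Q \<noteq> 0" using z Suc.prems by (simp add: order_root)
    then have "order z P \<noteq> 0" using Suc.prems(3)[of z] by linarith
    then have "poly P z = 0" using Suc.prems by (simp add: order_root)
    then obtain P' where P: "P = [:- z, 1:] * P'" by (auto simp: poly_eq_0_iff_dvd)
    have nz: "P' \<noteq> 0" "Q' \<noteq> 0" using Suc.prems P Q by auto
    have "degree Q = 1 + degree Q'" using nz unfolding Q by (subst degree_mult_eq) auto
    then have deg: "n = degree Q'" using Suc.hyps(2) by simp
    have ord: "order c Q' \<le> order c P'" for c
      using Suc.prems(3)[of c] Suc.prems(1,2) unfolding P Q by (simp add: order_mult del: mult_pCons_left)
    obtain P'' where "P'' \<noteq> 0" "Fract P' Q' = Fract P'' 1"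
      using Suc.hyps(1)[OF deg nz ord] by blast
    moreover have "Fract P Q = Fract P' Q'" unfolding P Q by (rule mult_fract_cancel) simp
    ultimately show ?case by auto
  qed
  moreover obtain P Q where "P \<noteq> 0" "Q \<noteq> 0" "x = Fract P Q" using assms(1) by (rule nonzero_fract_cases)
  moreover from this have "order c Q \<le> order c P" for c
    using assms(2)[of c] by (simp add: val_Fract poly_val_def)
  ultimately show ?thesis using that by metis
qed

text \<open>
  On the affine line every divisor is principal; the point at infinity takes up the degree.
\<close>

lemma exists_with_divisor:
  fixes n :: "complex \<Rightarrow> int"
  assumes "finite T"
  shows "\<exists>E. E \<noteq> 0 \<and> (\<forall>c. val (Some c) E = (if c \<in> T then n c else 0)) \<and> val None E = - (\<Sum>c\<in>T. n c)"
  using assms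
proof (induction T rule: finite_induct)
  case empty
  have "val p 1 = 0" for p using valuation_val[of p] by (simp add: valuation_def One_fract_def one_pCons)
  then show ?case by (intro exI[of _ 1]) auto
next
  case (insert d T)
  then obtain E where E: "E \<noteq> 0" "\<And>c. val (Some c) E = (if c \<in> T then n c else 0)"
    "val None E = - (\<Sum>c\<in>T. n c)" by blast
  define e where "e = Fract ([:- d, 1:] ^ nat (n d)) ([:- d, 1:] ^ nat (- n d))"
  have e: "e \<noteq> 0" by (simp add: e_def Zero_fract_def eq_fract)
  have "val p e = n d * poly_val p [:- d, 1:]" for p
    unfolding e_def by (simp add: val_Fract poly_val_power algebra_simps)
  then show ?case using insert.hyps E e
    by (intro exI[of _ "E * e"]) (auto simp: val_mult poly_val_linear)
qed

section \<open>The places of the curve and its genus\<close>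

abbreviation "\<O> \<equiv> fun_ring octic_form"

lemma restrict_diff:
  assumes "a \<in> \<O>" "b \<in> \<O>"
  shows "a - b \<in> \<O> \<and> restrict_fun (a - b) = restrict_fun a - restrict_fun b"
proof -
  have m1: "fun_const (-1) = -1" "Fract [:-1:] 1 = (- 1 :: complex poly fract)"
    by (simp_all add: fun_const_def One_fract_def one_pCons)
  have eq: "a - b = a + fun_const (-1) * b" by (simp add: m1)
  show ?thesis unfolding eq
    using restrict_const[of "-1"] restrict_mult[of "fun_const (-1)" b] restrict_add[of a "fun_const (-1) * b"] assms
    by (simp add: m1(2))
qed

lemma restrict_sum:
  assumes "\<And>i. i \<in> I \<Longrightarrow> a i \<in> \<O>"
  shows "sum a I \<in> \<O> \<and> restrict_fun (sum a I) = (\<Sum>i\<in>I. restrict_fun (a i))"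
proof -
  have 0: "0 \<in> \<O> \<and> restrict_fun 0 = 0"
    using restrict_const[of 0] by (simp add: fun_const_def fract_collapse)
  show ?thesis using assms
    by (induction I rule: infinite_finite_induct) (auto simp: 0 restrict_add)
qed

definition place :: "complex option \<Rightarrow> poly3 fract \<Rightarrow> int" where
  "place p a = (if a \<in> \<O> \<and> restrict_fun a \<noteq> 0 then val p (restrict_fun a) else 0)"

lemma unit_set: "\<O> - fun_ideal octic_form = {a \<in> \<O>. restrict_fun a \<noteq> 0}"
  using fun_ideal_iff by auto

lemma place_in_places: "place p \<in> places octic_form"
proof -
  have v: "\<And>a b. a \<noteq> 0 \<Longrightarrow> b \<noteq> 0 \<Longrightarrow> val p (a * b) = val p a + val p b"
    "\<And>a b. a \<noteq> 0 \<Longrightarrow> b \<noteq> 0 \<Longrightarrow> a + b \<noteq> 0 \<Longrightarrow> min (val p a) (val p b) \<le> val p (a + b)"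
    "\<And>c. c \<noteq> 0 \<Longrightarrow> val p (Fract [:c:] 1) = 0" "\<exists>q. q \<noteq> 0 \<and> val p q = 1"
    using valuation_val[of p] by (auto simp: valuation_def)
  obtain q where q: "q \<noteq> 0" "val p q = 1" using v(4) by blast
  obtain a where a: "a \<in> \<O>" "restrict_fun a = q" using restrict_surj[of q] by blast
  show ?thesis unfolding places_def Let_def unit_set
  proof (intro CollectI conjI)
    show "\<forall>a\<in>{a \<in> \<O>. restrict_fun a \<noteq> 0}. \<forall>b\<in>{a \<in> \<O>. restrict_fun a \<noteq> 0}.
      a - b \<in> fun_ideal octic_form \<longrightarrow> place p a = place p b"
      using restrict_diff by (auto simp: fun_ideal_iff place_def)
    show "\<exists>a\<in>{a \<in> \<O>. restrict_fun a \<noteq> 0}. place p a = 1"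
      using a q by (intro bexI[of _ a]) (auto simp: place_def)
    show "\<forall>c. c \<noteq> 0 \<longrightarrow> place p (fun_const c) = 0"
      using restrict_const v(3) by (auto simp: place_def)
  qed (use restrict_mult restrict_add v in \<open>auto simp: place_def\<close>)
qed

text \<open>
  A place is carried over to the field of rational functions in the parameter by choosing preimages;
  the choice does not matter as places are constant modulo the ideal of the curve.
\<close>

lemma places_subset: assumes "w \<in> places octic_form" shows "w \<in> range place"
proof -
  have w: "\<And>a. \<not> (a \<in> \<O> \<and> restrict_fun a \<noteq> 0) \<Longrightarrow> w a = 0"
    "\<And>a b. a \<in> \<O> \<Longrightarrow> restrict_fun a \<noteq> 0 \<Longrightarrow> b \<in> \<O> \<Longrightarrow> restrict_fun b \<noteq> 0 \<Longrightarrow>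
      a - b \<in> fun_ideal octic_form \<Longrightarrow> w a = w b"
    "\<And>a b. a \<in> \<O> \<Longrightarrow> restrict_fun a \<noteq> 0 \<Longrightarrow> b \<in> \<O> \<Longrightarrow> restrict_fun b \<noteq> 0 \<Longrightarrow> w (a * b) = w a + w b"
    "\<And>a b. a \<in> \<O> \<Longrightarrow> restrict_fun a \<noteq> 0 \<Longrightarrow> b \<in> \<O> \<Longrightarrow> restrict_fun b \<noteq> 0 \<Longrightarrow>
      a + b \<in> \<O> \<Longrightarrow> restrict_fun (a + b) \<noteq> 0 \<Longrightarrow> min (w a) (w b) \<le> w (a + b)"
    "\<And>c. c \<noteq> 0 \<Longrightarrow> w (fun_const c) = 0" "\<exists>a. a \<in> \<O> \<and> restrict_fun a \<noteq> 0 \<and> w a = 1"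
    using assms unfolding places_def Let_def unit_set by auto
  define rep where "rep q = (SOME a. a \<in> \<O> \<and> restrict_fun a = q)" for q
  have rep: "rep q \<in> \<O>" "restrict_fun (rep q) = q" for q
    using someI_ex[of "\<lambda>a. a \<in> \<O> \<and> restrict_fun a = q"] restrict_surj[of q] by (auto simp: rep_def)
  define W where "W q = w (rep q)" for q
  have W: "W (restrict_fun a) = w a" if "a \<in> \<O>" "restrict_fun a \<noteq> 0" for a
    unfolding W_def using that rep restrict_diff[of "rep (restrict_fun a)" a]
    by (intro w(2)) (auto simp: fun_ideal_iff)
  have "valuation W" unfolding valuation_def
  proof (intro conjI allI impI)
    fix a b :: "complex poly fract" assume "a \<noteq> 0" "b \<noteq> 0"
    then show "W (a * b) = W a + W b"
      using W[of "rep a * rep b"] w(3)[of "rep a" "rep b"] restrict_mult[of "rep a" "rep b"] rep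
      by (auto simp: W_def[of a] W_def[of b])
  next
    fix a b :: "complex poly fract" assume "a \<noteq> 0" "b \<noteq> 0" "a + b \<noteq> 0"
    then show "min (W a) (W b) \<le> W (a + b)"
      using W[of "rep a + rep b"] w(4)[of "rep a" "rep b"] restrict_add[of "rep a" "rep b"] rep
      by (auto simp: W_def[of a] W_def[of b])
  next
    fix c :: complex assume "c \<noteq> 0"
    moreover from this have "Fract [:c:] 1 \<noteq> 0" by (simp add: Zero_fract_def eq_fract)
    ultimately show "W (Fract [:c:] 1) = 0" using W[of "fun_const c"] restrict_const[of c] w(5) by auto
  next
    show "\<exists>q. q \<noteq> 0 \<and> W q = 1" using w(6) W by auto
  qed
  then obtain p where p: "\<And>q. q \<noteq> 0 \<Longrightarrow> W q = val p q" using valuation_classification by blast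
  have "w = place p"
  proof
    fix a show "w a = place p a" using w(1)[of a] W[of a] p by (auto simp: place_def)
  qed
  then show ?thesis by blast
qed

lemma places_octic: "places octic_form = range place"
  using place_in_places places_subset by blast

lemma inj_place: "inj place"
proof (rule injI)
  fix p p' assume eq: "place p = place p'"
  have val_eq: "val p q = val p' q" if "q \<noteq> 0" for q
  proof -
    obtain a where "a \<in> \<O>" "restrict_fun a = q" using restrict_surj[of q] by blast
    then show ?thesis using fun_cong[OF eq, of a] that by (auto simp: place_def)
  qed
  have nz: "Fract [:- c, 1:] 1 \<noteq> 0" for c :: complex by (simp add: Zero_fract_def eq_fract)
  show "p = p'"
    using val_eq[OF nz[of "the p"]] val_eq[OF nz[of "the p'"]]
    by (cases p; cases p') (auto simp: val_linear split: if_splits)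
qed

text \<open>
  Multiplication by a function \<open>E\<close> whose divisor is that of \<open>D\<close> on the affine line turns the space
  of \<open>D\<close> into the space of polynomials of degree at most \<open>deg D\<close>. For negative \<open>deg D\<close> this is 0,
  and so is the truncated dimension.
\<close>

lemma riemann_roch_rational:
  assumes D: "D \<in> divisors octic_form"
  shows "quotient_dim fun_const (riemann_roch_space octic_form D) (fun_ideal octic_form)
    (nat (divisor_degree D + 1))"
proof -
  define S where "S = {p. D (place p) \<noteq> 0}"
  have supp: "{w. D w \<noteq> 0} = place ` S" "finite {w. D w \<noteq> 0}"
    using D unfolding divisors_def places_octic S_def by auto
  have injS: "inj_on place S" using inj_place by (rule inj_on_subset) simp
  have S: "finite S" using supp injS by (metis finite_image_iff)
  define N where "N = divisor_degree D"
  have N: "N = (\<Sum>p\<in>S. D (place p))"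
    unfolding N_def divisor_degree_def supp(1) by (simp add: sum.reindex[OF injS])
  define T where "T = {c. Some c \<in> S}"
  have T: "finite T" using finite_vimageI[OF S, of Some] by (simp add: T_def vimage_def)
  have N_T: "N = D (place None) + (\<Sum>c\<in>T. D (place (Some c)))"
  proof -
    have "N = (\<Sum>p\<in>insert None (Some ` T). D (place p))" unfolding N
      using T by (intro sum.mono_neutral_left) (auto simp: T_def S_def image_iff, metis option.exhaust)
    also have "\<dots> = D (place None) + (\<Sum>c\<in>T. D (place (Some c)))"
      using T by (simp add: sum.reindex)
    finally show ?thesis .
  qed
  obtain E where E: "E \<noteq> 0" "\<And>c. val (Some c) E = D (place (Some c))"
    "val None E = D (place None) - N"
  proof -
    obtain E where "E \<noteq> 0" "\<forall>c. val (Some c) E = (if c \<in> T then D (place (Some c)) else 0)"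
      "val None E = - (\<Sum>c\<in>T. D (place (Some c)))"
      using exists_with_divisor[OF T, of "\<lambda>c. D (place (Some c))"] by blast
    moreover have "(if c \<in> T then D (place (Some c)) else 0) = D (place (Some c))" for c
      by (auto simp: T_def S_def)
    ultimately show ?thesis using that N_T by auto
  qed
  define n where "n = nat (N + 1)"
  let ?V = "riemann_roch_space octic_form D"
  have mem: "a \<in> ?V \<longleftrightarrow> a \<in> \<O> \<and> (\<exists>P. restrict_fun a * E = Fract P 1 \<and> (\<forall>i\<ge>n. coeff P i = 0))" for a
  proof (cases "a \<in> \<O> \<and> restrict_fun a \<noteq> 0")
    case False
    have "a \<in> ?V \<longleftrightarrow> a \<in> \<O>" using False by (auto simp: riemann_roch_space_def fun_ideal_iff)
    moreover have "\<exists>P. restrict_fun a * E = Fract P 1 \<and> (\<forall>i\<ge>n. coeff P i = 0)" if "a \<in> \<O>"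
      using that False by (intro exI[of _ 0]) (simp add: fract_collapse)
    ultimately show ?thesis by blast
  next
    case True
    let ?x = "restrict_fun a * E"
    have x: "?x \<noteq> 0" using True E by simp
    have "a \<in> ?V \<longleftrightarrow> (\<forall>p. val p (restrict_fun a) + D (place p) \<ge> 0)"
      using True by (auto simp: riemann_roch_space_def fun_ideal_iff places_octic place_def)
    also have "\<dots> \<longleftrightarrow> (\<forall>c. val (Some c) ?x \<ge> 0) \<and> val None ?x + N \<ge> 0"
    proof -
      have "val (Some c) ?x = val (Some c) (restrict_fun a) + D (place (Some c))" for c
        using True E by (simp add: val_mult)
      moreover have "val None ?x + N = val None (restrict_fun a) + D (place None)"
        using True E by (simp add: val_mult)
      ultimately show ?thesis by (metis not_None_eq)
    qed
    also have "\<dots> \<longleftrightarrow> (\<exists>P. ?x = Fract P 1 \<and> (\<forall>i\<ge>n. coeff P i = 0))"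
    proof
      assume *: "(\<forall>c. val (Some c) ?x \<ge> 0) \<and> val None ?x + N \<ge> 0"
      obtain P where P: "P \<noteq> 0" "?x = Fract P 1" using polynomial_if_no_finite_poles[OF x] * by blast
      then have "val None ?x = - int (degree P)" by (simp add: val_Fract poly_val_def)
      then have "degree P < n" using * unfolding n_def by linarith
      then show "\<exists>P. ?x = Fract P 1 \<and> (\<forall>i\<ge>n. coeff P i = 0)"
        using P by (intro exI[of _ P]) (auto intro!: coeff_eq_0)
    next
      assume "\<exists>P. ?x = Fract P 1 \<and> (\<forall>i\<ge>n. coeff P i = 0)"
      then obtain P where P: "?x = Fract P 1" "\<forall>i\<ge>n. coeff P i = 0" by blast
      have "P \<noteq> 0" using x P(1) by (auto simp: fract_collapse)
      then have "degree P < n" using P(2) by (metis leading_coeff_0_iff not_le)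
      then show "(\<forall>c. val (Some c) ?x \<ge> 0) \<and> val None ?x + N \<ge> 0"
        using \<open>P \<noteq> 0\<close> unfolding P(1) by (auto simp: val_Fract poly_val_def n_def order_0I)
    qed
    finally show ?thesis using True by blast
  qed
  have "\<forall>i. \<exists>a. a \<in> \<O> \<and> restrict_fun a = Fract (monom 1 i) 1 / E" using restrict_surj by blast
  then obtain b where b: "\<And>i. b i \<in> \<O>" "\<And>i. restrict_fun (b i) = Fract (monom 1 i) 1 / E" by metis
  have inj_b: "inj_on b {..<n}"
  proof (rule inj_onI)
    fix i j assume "b i = b j"
    then have "Fract (monom 1 i) 1 / E = Fract (monom 1 j) 1 / E" by (metis b(2))
    then have "monom 1 i = (monom 1 j :: complex poly)" using E(1) by (simp add: eq_fract)
    then show "i = j" by (metis degree_monom_eq zero_neq_one)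
  qed
  define B where "B = b ` {..<n}"
  have B_V: "B \<subseteq> ?V" unfolding B_def using b E(1)
    by (auto simp: mem intro!: exI[of _ "monom 1 _"])
  have combination: "v - (\<Sum>x\<in>B. fun_const (c x) * x) \<in> fun_ideal octic_form \<longleftrightarrow> (\<forall>i<n. c (b i) = coeff P i)"
    if v: "v \<in> \<O>" "restrict_fun v * E = Fract P 1" "\<forall>i\<ge>n. coeff P i = 0" for v c P
  proof -
    let ?s = "\<Sum>i<n. fun_const (c (b i)) * b i"
    have sumB: "(\<Sum>x\<in>B. fun_const (c x) * x) = ?s"
      unfolding B_def by (simp add: sum.reindex[OF inj_b])
    have summand: "fun_const (c (b i)) * b i \<in> \<O> \<and>
        restrict_fun (fun_const (c (b i)) * b i) = Fract (monom (c (b i)) i) 1 / E" for i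
      using restrict_const[of "c (b i)"] restrict_mult[of "fun_const (c (b i))" "b i"] b
      by (simp add: smult_monom)
    have s: "?s \<in> \<O>" "restrict_fun ?s = (\<Sum>i<n. Fract (monom (c (b i)) i) 1 / E)"
      using restrict_sum[of "{..<n}" "\<lambda>i. fun_const (c (b i)) * b i"] summand by auto
    have fsum: "(\<Sum>i<k. Fract (p i) 1) = Fract (\<Sum>i<k. p i) 1" for p :: "nat \<Rightarrow> complex poly" and k
      by (induction k) (simp_all add: fract_collapse)
    have "v - ?s \<in> fun_ideal octic_form \<longleftrightarrow> restrict_fun v - restrict_fun ?s = 0"
      using restrict_diff[OF v(1) s(1)] by (simp add: fun_ideal_iff)
    also have "\<dots> \<longleftrightarrow> restrict_fun v * E = restrict_fun ?s * E" using E(1) by simp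
    also have "restrict_fun ?s * E = Fract (\<Sum>i<n. monom (c (b i)) i) 1"
      unfolding s(2) using E(1) by (simp add: sum_distrib_right fsum flip: fsum)
    also have "restrict_fun v * E = \<dots> \<longleftrightarrow> P = (\<Sum>i<n. monom (c (b i)) i)"
      unfolding v(2) by (simp add: eq_fract)
    also have "\<dots> \<longleftrightarrow> (\<forall>i<n. c (b i) = coeff P i)"
    proof -
      have "coeff (\<Sum>i<n. monom (c (b i)) i) j = (if j < n then c (b j) else 0)" for j
        by (simp add: coeff_sum)
      then show ?thesis using v(3) by (auto simp: poly_eq_iff not_less)
    qed
    finally show ?thesis unfolding sumB .
  qed
  have basis: "\<exists>!c. c \<in> B \<rightarrow>\<^sub>E UNIV \<and> v - (\<Sum>x\<in>B. fun_const (c x) * x) \<in> fun_ideal octic_form" if vV: "v \<in> ?V" for v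
  proof -
    obtain P where v: "v \<in> \<O>" "restrict_fun v * E = Fract P 1" "\<forall>i\<ge>n. coeff P i = 0"
      using vV mem by blast
    note comb = combination[OF v]
    define c where "c = restrict (\<lambda>x. coeff P (the_inv_into {..<n} b x)) B"
    have "c (b i) = coeff P i" if "i < n" for i
      using that the_inv_into_f_f[OF inj_b, of i] by (auto simp: c_def B_def)
    then have "c \<in> B \<rightarrow>\<^sub>E UNIV \<and> v - (\<Sum>x\<in>B. fun_const (c x) * x) \<in> fun_ideal octic_form"
      unfolding comb by (auto simp: c_def)
    moreover have "x = y" if "x \<in> B \<rightarrow>\<^sub>E UNIV \<and> v - (\<Sum>b\<in>B. fun_const (x b) * b) \<in> fun_ideal octic_form"
      "y \<in> B \<rightarrow>\<^sub>E UNIV \<and> v - (\<Sum>b\<in>B. fun_const (y b) * b) \<in> fun_ideal octic_form" for x y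
      using that unfolding comb by (intro PiE_ext[of x B _ y]) (auto simp: B_def)
    ultimately show ?thesis by blast
  qed
  have "finite B" "card B = n" by (auto simp: B_def card_image[OF inj_b])
  then show ?thesis unfolding quotient_dim_def N_def[symmetric] n_def[symmetric]
    by (intro exI[of _ B] conjI ballI B_V basis)
qed

lemma genus_octic: "geometric_genus octic_form 0"
  unfolding geometric_genus_def Let_def
proof (intro conjI ballI)
  fix D assume "D \<in> divisors octic_form"
  then show "\<exists>n. quotient_dim fun_const (riemann_roch_space octic_form D) (fun_ideal octic_form) n \<and>
      divisor_degree D + 1 - int n \<le> 0"
    using riemann_roch_rational by (intro exI[of _ "nat (divisor_degree D + 1)"]) auto
next
  have D: "(\<lambda>_. 0) \<in> divisors octic_form" by (simp add: divisors_def)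
  show "\<exists>D\<in>divisors octic_form. \<exists>n. quotient_dim fun_const (riemann_roch_space octic_form D) (fun_ideal octic_form) n \<and>
      divisor_degree D + 1 - int n = 0"
    using riemann_roch_rational[OF D] D
    by (intro bexI[of _ "\<lambda>_. 0"] exI[of _ 1]) (auto simp: divisor_degree_def)
qed

section \<open>The three Alexander polynomials\<close>

definition semigroup_series :: "nat set \<Rightarrow> 'a::comm_ring_1 fps" where
  "semigroup_series S = Abs_fps (\<lambda>k. if k \<in> S then 1 else 0)"

lemma mem_generated2_6_7: "n \<in> generated2 6 7 \<longleftrightarrow>
  n \<in> {0, 6, 7, 12, 13, 14, 18, 19, 20, 21, 24, 25, 26, 27, 28} \<or> 30 \<le> n"
  unfolding generated2_def by simp presburger

lemma mem_generated2_2_9: "n \<in> generated2 2 9 \<longleftrightarrow> even n \<or> 8 \<le> n"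
  unfolding generated2_def by simp presburger

lemma mem_generated2_2_5: "n \<in> generated2 2 5 \<longleftrightarrow> even n \<or> 4 \<le> n"
  unfolding generated2_def by simp presburger

lemma one_minus_X_mult_nth: "((1 - fps_X) * f) $ n = f $ n - (if n = 0 then 0 else (f :: 'a::comm_ring_1 fps) $ (n - 1))"
  by (simp add: left_diff_distrib fps_X_mult_nth)

lemma alexander_6_7: "(1 - fps_X) * semigroup_series (generated2 6 7) =
  (1 - fps_X + fps_X^6 - fps_X^8 + fps_X^12 - fps_X^15 + fps_X^18 - fps_X^22 + fps_X^24 - fps_X^29 + fps_X^30
    :: 'a::comm_ring_1 fps)"
proof (rule fps_ext)
  fix n
  show "((1 - fps_X) * semigroup_series (generated2 6 7)) $ n =
    (1 - fps_X + fps_X^6 - fps_X^8 + fps_X^12 - fps_X^15 + fps_X^18 - fps_X^22 + fps_X^24 - fps_X^29 + fps_X^30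
    :: 'a fps) $ n"
  proof (cases "n < 31")
    case True
    then have "n = 0 \<or> n = 1 \<or> n = 2 \<or> n = 3 \<or> n = 4 \<or> n = 5 \<or> n = 6 \<or> n = 7 \<or> n = 8 \<or> n = 9 \<or> n = 10
      \<or> n = 11 \<or> n = 12 \<or> n = 13 \<or> n = 14 \<or> n = 15 \<or> n = 16 \<or> n = 17 \<or> n = 18 \<or> n = 19 \<or> n = 20
      \<or> n = 21 \<or> n = 22 \<or> n = 23 \<or> n = 24 \<or> n = 25 \<or> n = 26 \<or> n = 27 \<or> n = 28 \<or> n = 29 \<or> n = 30"
      by presburger
    then show ?thesis unfolding one_minus_X_mult_nth semigroup_series_def fps_nth_Abs_fps mem_generated2_6_7
      by (elim disjE) (simp_all add: fps_X_power_nth)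
  next
    case False
    then have "30 \<le> n" "30 \<le> n - 1" by auto
    then show ?thesis unfolding one_minus_X_mult_nth semigroup_series_def fps_nth_Abs_fps mem_generated2_6_7
      using False by (simp add: fps_X_power_nth)
  qed
qed

lemma alexander_2_9: "(1 - fps_X) * semigroup_series (generated2 2 9) =
  (1 - fps_X + fps_X^2 - fps_X^3 + fps_X^4 - fps_X^5 + fps_X^6 - fps_X^7 + fps_X^8 :: 'a::comm_ring_1 fps)"
proof (rule fps_ext)
  fix n
  show "((1 - fps_X) * semigroup_series (generated2 2 9)) $ n =
    (1 - fps_X + fps_X^2 - fps_X^3 + fps_X^4 - fps_X^5 + fps_X^6 - fps_X^7 + fps_X^8 :: 'a fps) $ n"
  proof (cases "n < 9")
    case True
    then have "n = 0 \<or> n = 1 \<or> n = 2 \<or> n = 3 \<or> n = 4 \<or> n = 5 \<or> n = 6 \<or> n = 7 \<or> n = 8" by presburger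
    then show ?thesis unfolding one_minus_X_mult_nth semigroup_series_def fps_nth_Abs_fps mem_generated2_2_9
      by (elim disjE) (simp_all add: fps_X_power_nth)
  next
    case False
    then show ?thesis unfolding one_minus_X_mult_nth semigroup_series_def fps_nth_Abs_fps mem_generated2_2_9
      by (auto simp: fps_X_power_nth)
  qed
qed

lemma alexander_2_5: "(1 - fps_X) * semigroup_series (generated2 2 5) =
  (1 - fps_X + fps_X^2 - fps_X^3 + fps_X^4 :: 'a::comm_ring_1 fps)"
proof (rule fps_ext)
  fix n
  show "((1 - fps_X) * semigroup_series (generated2 2 5)) $ n =
    (1 - fps_X + fps_X^2 - fps_X^3 + fps_X^4 :: 'a fps) $ n"
  proof (cases "n < 5")
    case True
    then have "n = 0 \<or> n = 1 \<or> n = 2 \<or> n = 3 \<or> n = 4" by presburger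
    then show ?thesis unfolding one_minus_X_mult_nth semigroup_series_def fps_nth_Abs_fps mem_generated2_2_5
      by (elim disjE) (simp_all add: fps_X_power_nth)
  next
    case False
    then show ?thesis unfolding one_minus_X_mult_nth semigroup_series_def fps_nth_Abs_fps mem_generated2_2_5
      by (auto simp: fps_X_power_nth)
  qed
qed

text \<open>
  The polynomial \<open>Q\<close> in \<open>\<Delta>(t) = 1 + \<delta> (t - 1) + (t - 1)^2 Q(t)\<close>, with \<open>\<delta> = 21\<close>.
\<close>

definition q_poly :: "'a::comm_ring_1 \<Rightarrow> 'a" where
  "q_poly t = 21 + 18 * t + 20 * t^2 + 15 * t^3 + 19 * t^4 + 13 * t^5 + 18 * t^6 + 11 * t^7 + 16 * t^8
    + 10 * t^9 + 13 * t^10 + 10 * t^11 + 11 * t^12 + 9 * t^13 + 10 * t^14 + 7 * t^15 + 9 * t^16 + 5 * t^17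
    + 9 * t^18 + 3 * t^19 + 9 * t^20 + 2 * t^21 + 7 * t^22 + 2 * t^23 + 5 * t^24 + 2 * t^25 + 4 * t^26
    + 2 * t^27 + 3 * t^28 + t^29 + 3 * t^30 - t^31 + 4 * t^32 - 2 * t^33 + 4 * t^34 - 2 * t^35 + 3 * t^36
    - 2 * t^37 + 2 * t^38 - t^39 + t^40"

lemma alexander_product:
  fixes t :: "'a::idom"
  shows "(1 - t + t^6 - t^8 + t^12 - t^15 + t^18 - t^22 + t^24 - t^29 + t^30) *
    ((1 - t + t^2 - t^3 + t^4 - t^5 + t^6 - t^7 + t^8) * (1 - t + t^2 - t^3 + t^4)) =
    21 * t - 20 + (1 - t)^2 * q_poly t"
  unfolding q_poly_def by algebra

text \<open>
  The generating function of \<open>n + 1 - \<delta>\<close>, which is the expansion of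
  \<open>(1 + \<delta> (t - 1)) / (1 - t)^2\<close>.
\<close>

definition linear_series :: "'a::comm_ring_1 fps" where
  "linear_series = Abs_fps (\<lambda>n. of_nat n - 20)"

lemma linear_series_eq: "(1 - fps_X)^2 * linear_series = (21 * fps_X - 20 :: 'a::comm_ring_1 fps)"
proof -
  have "(1 - fps_X) * linear_series = (Abs_fps (\<lambda>n. if n = 0 then -20 else 1) :: 'a fps)"
    by (rule fps_ext, subst one_minus_X_mult_nth) (simp add: linear_series_def of_nat_diff)
  moreover have "(1 - fps_X) * (Abs_fps (\<lambda>n. if n = 0 then -20 else 1)) = (21 * fps_X - 20 :: 'a fps)"
    by (rule fps_ext, subst one_minus_X_mult_nth) (auto simp: numeral_fps_const)
  ultimately show ?thesis by (simp add: power2_eq_square mult.assoc)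
qed

text \<open>
  The expansion of \<open>\<Delta>(t) / (1 - t)^2\<close>. Its coefficients are the values of \<open>F\<close>, and those with index
  divisible by 8 enter \<open>R\<close>.
\<close>

definition count_series :: "'a::comm_ring_1 fps" where
  "count_series = q_poly fps_X + linear_series"

abbreviation "cusp_semigroups \<equiv> [generated2 6 7, generated2 2 9, generated2 2 5]"

lemma alexander_product_series:
  "(1 - fps_X) * semigroup_series (generated2 6 7) * ((1 - fps_X) * semigroup_series (generated2 2 9) *
    ((1 - fps_X) * semigroup_series (generated2 2 5))) = (1 - fps_X)^2 * (count_series :: 'a::idom fps)"
  unfolding alexander_6_7 alexander_2_9 alexander_2_5 alexander_product count_series_def
  by (simp only: distrib_left linear_series_eq add.commute)

lemma q_poly_nth:
  "(q_poly fps_X :: 'a::comm_ring_1 fps) $ n = (if n \<le> 40 then of_int ([21, 18, 20, 15, 19, 13, 18, 11, 16,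
    10, 13, 10, 11, 9, 10, 7, 9, 5, 9, 3, 9, 2, 7, 2, 5, 2, 4, 2, 3, 1, 3, -1, 4, -2, 4, -2, 3, -2, 2, -1, 1] ! n) else 0)"
proof (cases "n \<le> 40")
  case False
  then show ?thesis by (simp add: q_poly_def numeral_fps_const fps_X_power_nth)
next
  case True
  then have "n = 0 \<or> n = 1 \<or> n = 2 \<or> n = 3 \<or> n = 4 \<or> n = 5 \<or> n = 6 \<or> n = 7 \<or> n = 8 \<or> n = 9 \<or> n = 10
      \<or> n = 11 \<or> n = 12 \<or> n = 13 \<or> n = 14 \<or> n = 15 \<or> n = 16 \<or> n = 17 \<or> n = 18 \<or> n = 19 \<or> n = 20
      \<or> n = 21 \<or> n = 22 \<or> n = 23 \<or> n = 24 \<or> n = 25 \<or> n = 26 \<or> n = 27 \<or> n = 28 \<or> n = 29 \<or> n = 30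
      \<or> n = 31 \<or> n = 32 \<or> n = 33 \<or> n = 34 \<or> n = 35 \<or> n = 36 \<or> n = 37 \<or> n = 38 \<or> n = 39 \<or> n = 40"
    by presburger
  then show ?thesis
    by (elim disjE) (simp_all add: q_poly_def numeral_fps_const fps_X_power_nth)
qed

section \<open>The counting function\<close>

lemma second_difference_h_seq:
  "diff_seq (diff_seq (h_seq S)) = fps_nth ((1 - fps_X) * semigroup_series S)"
proof -
  have h: "diff_seq (h_seq S) j = (if j \<in> S then 1 else 0)" for j
  proof -
    have "{s \<in> S. s < Suc j} = (if j \<in> S then insert j {s \<in> S. s < j} else {s \<in> S. s < j})"
      by (auto simp: less_Suc_eq)
    moreover have "finite {s \<in> S. s < j}" by simp
    ultimately have "h_seq S j = int (semigroup_count S j) + (if j \<in> S then 1 else 0)"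
      by (simp add: h_seq_def semigroup_count_def)
    then show ?thesis by (cases j) (auto simp: diff_seq_def h_seq_def semigroup_count_def)
  qed
  show ?thesis
    by (rule ext) (simp add: diff_seq_def[of "diff_seq (h_seq S)"] h one_minus_X_mult_nth semigroup_series_def)
qed

lemma conv_fps_nth: "conv (fps_nth f) (fps_nth g) = fps_nth (f * g)"
  by (rule ext) (simp add: conv_def fps_mult_nth atMost_atLeast0)

lemma sum_seq_fps: "(1 - fps_X) * Abs_fps (sum_seq a) = Abs_fps a"
proof (rule fps_ext)
  fix n show "((1 - fps_X) * Abs_fps (sum_seq a)) $ n = Abs_fps a $ n"
    by (cases n) (simp_all add: one_minus_X_mult_nth sum_seq_def)
qed

lemma F_fun_eq: "F_fun cusp_semigroups j = count_series $ j"
proof -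
  have unit: "(\<lambda>j. if j = 0 then 1 else 0) = fps_nth (1 :: int fps)" by auto
  have fold: "foldr conv (map (\<lambda>S. diff_seq (diff_seq (h_seq S))) cusp_semigroups) (\<lambda>j. if j = 0 then 1 else 0)
     = fps_nth ((1 - fps_X)^2 * count_series)"
    unfolding unit by (simp add: second_difference_h_seq conv_fps_nth flip: alexander_product_series)
  let ?a = "fps_nth ((1 - fps_X)^2 * count_series :: int fps)"
  have "(1 - fps_X)^2 * Abs_fps (sum_seq (sum_seq ?a)) = (1 - fps_X) * Abs_fps (sum_seq ?a)"
    by (simp add: power2_eq_square mult.assoc sum_seq_fps)
  also have "\<dots> = (1 - fps_X)^2 * count_series" by (simp only: sum_seq_fps fps_nth_inverse)
  finally have "(1 - fps_X)^2 * Abs_fps (sum_seq (sum_seq ?a)) = (1 - fps_X)^2 * count_series" .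
  moreover have "(1 - fps_X :: int fps)^2 \<noteq> 0" by (rule fps_nonzeroI) simp
  ultimately have "Abs_fps (sum_seq (sum_seq ?a)) = count_series" by (metis mult_left_cancel)
  then show ?thesis unfolding F_fun_def fold by (metis fps_nth_Abs_fps)
qed

lemma F_fun_values: "F_fun cusp_semigroups 8 = 4" "F_fun cusp_semigroups 32 = 16"
  by (simp_all add: F_fun_eq count_series_def linear_series_def q_poly_nth)

section \<open>The polynomial R\<close>

text \<open>
  If \<open>d\<close> does not divide \<open>n\<close>, some \<open>d\<close>-th root of unity \<open>\<omega>\<close> has \<open>\<omega>^n \<noteq> 1\<close>, for otherwise all \<open>d\<close> of them
  would be roots of unity of the smaller order \<open>n mod d\<close>. Multiplication by \<open>\<omega>\<close> permutes the roots and
  multiplies the sum by \<open>\<omega>^n\<close>.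
\<close>

lemma sum_roots_of_unity_power:
  fixes d n :: nat
  assumes "d > 0"
  shows "(\<Sum>\<xi> | \<xi> ^ d = (1 :: complex). \<xi> ^ n) = (if d dvd n then of_nat d else 0)"
proof (cases "d dvd n")
  case True
  then have "\<xi> ^ n = 1" if "\<xi> ^ d = 1" for \<xi> :: complex using that by (auto simp: power_mult)
  then have "(\<Sum>\<xi> | \<xi> ^ d = (1 :: complex). \<xi> ^ n) = of_nat (card {\<xi> :: complex. \<xi> ^ d = 1})" by simp
  then show ?thesis using True assms by (simp add: card_roots_unity_eq)
next
  case False
  let ?Z = "{\<xi> :: complex. \<xi> ^ d = 1}"
  have "\<exists>\<omega>\<in>?Z. \<omega> ^ n \<noteq> 1"
  proof (rule ccontr)
    assume "\<not> (\<exists>\<omega>\<in>?Z. \<omega> ^ n \<noteq> 1)"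
    then have *: "\<omega> ^ n = 1" if "\<omega> ^ d = 1" for \<omega> :: complex using that by blast
    have pos: "0 < n mod d" using False by (simp add: dvd_eq_mod_eq_0)
    have "\<omega> ^ (n mod d) = 1" if "\<omega> ^ d = 1" for \<omega> :: complex
    proof -
      have "\<omega> ^ n = \<omega> ^ (d * (n div d) + n mod d)" by simp
      also have "\<dots> = \<omega> ^ (n mod d)" by (simp only: power_add power_mult that power_one mult_1_left)
      finally show ?thesis using *[OF that] by simp
    qed
    then have "card ?Z \<le> card {\<omega> :: complex. \<omega> ^ (n mod d) = 1}"
      using pos by (intro card_mono finite_roots_unity) auto
    then have "d \<le> n mod d" using card_roots_unity_eq[of d] card_roots_unity_eq[of "n mod d"] assms pos by simp
    then show False using assms by (meson mod_less_divisor not_le)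
  qed
  then obtain \<omega> :: complex where \<omega>: "\<omega> ^ d = 1" "\<omega> ^ n \<noteq> 1" by auto
  have nz: "\<omega> \<noteq> 0" using \<omega>(1) assms by (auto simp: power_0_left)
  have "bij_betw ((*) \<omega>) ?Z ?Z"
    by (rule bij_betwI[of _ _ _ "\<lambda>\<xi>. \<xi> / \<omega>"]) (use \<omega> nz in \<open>auto simp: power_mult_distrib power_divide\<close>)
  then have "(\<Sum>\<xi>\<in>?Z. \<xi> ^ n) = (\<Sum>\<xi>\<in>?Z. (\<omega> * \<xi>) ^ n)" by (rule sum.reindex_bij_betw[symmetric])
  also have "\<dots> = \<omega> ^ n * (\<Sum>\<xi>\<in>?Z. \<xi> ^ n)" by (simp add: power_mult_distrib sum_distrib_left)
  finally have "(1 - \<omega> ^ n) * (\<Sum>\<xi>\<in>?Z. \<xi> ^ n) = 0" by (simp add: left_diff_distrib)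
  then show ?thesis using \<omega>(2) False by simp
qed

definition multisection :: "nat \<Rightarrow> 'a::comm_ring_1 fps \<Rightarrow> 'a fps" where
  "multisection d f = Abs_fps (\<lambda>n. if d dvd n then f $ n else 0)"

text \<open>
  Substituting \<open>\<xi> t\<close> multiplies the \<open>n\<close>-th coefficient by \<open>\<xi>^n\<close>, and the average over \<open>\<xi>\<close> retains the
  multiples of \<open>d\<close>.
\<close>

lemma root_average:
  assumes "d > 0" "prod_list (map alexander Ss) = (1 - fps_X)^2 * c"
  shows "fps_const (1 / of_nat d) * (\<Sum>\<xi> | \<xi> ^ d = (1::complex).
      fps_compose (prod_list (map alexander Ss)) (fps_const \<xi> * fps_X) / (1 - fps_const \<xi> * fps_X) ^ 2)
    = multisection d c"
proof (rule fps_ext)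
  fix n
  have "fps_compose (prod_list (map alexander Ss)) (fps_const \<xi> * fps_X) / (1 - fps_const \<xi> * fps_X) ^ 2
      = Abs_fps (\<lambda>n. \<xi> ^ n * c $ n)" for \<xi> :: complex
  proof -
    have z: "(fps_const \<xi> * fps_X) $ 0 = 0" by simp
    have nz: "(1 - fps_const \<xi> * fps_X) ^ 2 \<noteq> 0" by (rule fps_nonzeroI) simp
    have "fps_compose (prod_list (map alexander Ss)) (fps_const \<xi> * fps_X) =
      (1 - fps_const \<xi> * fps_X)^2 * fps_compose c (fps_const \<xi> * fps_X)"
      unfolding assms(2) by (simp add: ring_map_simps[OF ring_map_compose[OF z]] z)
    also have "\<dots> / (1 - fps_const \<xi> * fps_X)^2 = fps_compose c (fps_const \<xi> * fps_X)"
      using nz by (rule nonzero_mult_div_cancel_left)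
    finally show ?thesis by (simp add: fps_compose_linear)
  qed
  then show "(fps_const (1 / of_nat d) * (\<Sum>\<xi> | \<xi> ^ d = (1::complex).
      fps_compose (prod_list (map alexander Ss)) (fps_const \<xi> * fps_X) / (1 - fps_const \<xi> * fps_X) ^ 2)) $ n
    = multisection d c $ n"
    using sum_roots_of_unity_power[OF assms(1), of n] assms(1)
    by (simp add: fps_sum_nth multisection_def flip: sum_distrib_right)
qed

text \<open>
  This is \<open>R(t) = t^8 - t^16 - t^24 + t^32\<close> with the denominator \<open>(1 - t^8)^3\<close> cleared. The linear part
  of \<open>count_series\<close> contributes \<open>(28 t^8 - 20) / (1 - t^8)^2\<close>.
\<close>

lemma multisection_count_series:
  "(1 - fps_X ^ 8)^3 * multisection 8 count_series =
    (1 - fps_X ^ 64) + (1 - fps_X ^ 8)^3 * (fps_X^8 - fps_X^16 - fps_X^24 + fps_X^32 :: 'a::idom fps)"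
proof -
  let ?T = "fps_X ^ 8 :: 'a fps"
  have T: "((1 - ?T) * f) $ n = f $ n - (if n < 8 then 0 else f $ (n - 8))" for f n
    by (simp add: left_diff_distrib fps_X_power_mult_nth)
  have add: "multisection 8 (f + g) = multisection 8 f + multisection 8 g" for f g :: "'a fps"
    by (rule fps_ext) (simp add: multisection_def)
  have q: "multisection 8 (q_poly fps_X) = 21 + 16 * ?T + 9 * ?T^2 + 5 * ?T^3 + 4 * ?T^4 + ?T^5"
  proof (rule fps_ext)
    fix n
    show "multisection 8 (q_poly fps_X) $ n = (21 + 16 * ?T + 9 * ?T^2 + 5 * ?T^3 + 4 * ?T^4 + ?T^5) $ n"
    proof (cases "8 dvd n")
      case False
      then have "n \<noteq> 0" "n \<noteq> 8" "n \<noteq> 16" "n \<noteq> 24" "n \<noteq> 32" "n \<noteq> 40"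
        by (intro notI; simp)+
      then show ?thesis using False
        by (simp add: multisection_def numeral_fps_const fps_X_power_nth flip: power_mult)
    next
      case True
      then obtain j where j: "n = 8 * j" by blast
      consider "j = 0" | "j = 1" | "j = 2" | "j = 3" | "j = 4" | "j = 5" | "j > 5" by linarith
      then show ?thesis unfolding j
        by cases (simp_all add: multisection_def q_poly_nth numeral_fps_const fps_X_power_nth flip: power_mult)
    qed
  qed
  have small: "8 dvd n \<longleftrightarrow> n = 0" if "n < 8" for n :: nat using that by (auto dest: dvd_imp_le)
  have shift: "8 dvd n - 8 \<longleftrightarrow> 8 dvd n" if "\<not> n < 8" for n :: nat
    using that by (auto simp: dvd_minus_self)
  have "(1 - ?T) * multisection 8 linear_series = Abs_fps (\<lambda>n. if n = 0 then -20 else if 8 dvd n then 8 else 0)"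
  proof (rule fps_ext)
    fix n
    show "((1 - ?T) * multisection 8 linear_series) $ n = Abs_fps (\<lambda>n. if n = 0 then -20 else if 8 dvd n then 8 else 0) $ n"
      unfolding T using small[of n] shift[of n]
      by (cases "n < 8") (auto simp: multisection_def linear_series_def of_nat_diff)
  qed
  moreover have "(1 - ?T) * Abs_fps (\<lambda>n. if n = 0 then -20 else if 8 dvd n then 8 else 0) = 28 * ?T - 20"
  proof (rule fps_ext)
    fix n
    show "((1 - ?T) * Abs_fps (\<lambda>n. if n = 0 then -20 else if 8 dvd n then 8 else 0)) $ n = (28 * ?T - 20) $ n"
      unfolding T using small[of n] shift[of n]
      by (cases "n < 8") (auto simp: numeral_fps_const fps_X_power_nth)
  qed
  ultimately have lin: "(1 - ?T)^2 * multisection 8 linear_series = 28 * ?T - 20"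
    by (simp add: power2_eq_square mult.assoc)
  have "fps_X ^ 64 = ?T ^ 8" "fps_X ^ 16 = ?T ^ 2" "fps_X ^ 24 = ?T ^ 3" "fps_X ^ 32 = ?T ^ 4"
    by (simp_all flip: power_mult)
  then show ?thesis unfolding count_series_def add q using lin by algebra
qed

lemma is_R_poly_cusps:
  "is_R_poly 8 cusp_semigroups ([:0, 1:] ^ 8 - [:0, 1:] ^ 16 - [:0, 1:] ^ 24 + [:0, 1:] ^ 32)"
proof -
  let ?p = "[:0, 1:] ^ 8 - [:0, 1:] ^ 16 - [:0, 1:] ^ 24 + [:0, 1:] ^ 32 :: real poly"
  let ?P = "fps_X^8 - fps_X^16 - fps_X^24 + fps_X^32 :: complex fps"
  have "alexander S = (1 - fps_X) * semigroup_series S" for S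
    by (simp add: alexander_def semigroup_series_def)
  then have "prod_list (map alexander cusp_semigroups) = (1 - fps_X)^2 * count_series"
    by (simp flip: alexander_product_series)
  note average = root_average[OF _ this, of 8]
  have nz: "(1 - fps_X ^ 8 :: complex fps)^3 \<noteq> 0" by (rule fps_nonzeroI) simp
  have "(1 - fps_X ^ 64 :: complex fps) = (1 - fps_X ^ 8)^3 * (multisection 8 count_series - ?P)"
    using multisection_count_series[where 'a = complex] by (simp add: right_diff_distrib)
  then have "(1 - fps_X ^ 64) / (1 - fps_X ^ 8)^3 = multisection 8 count_series - ?P"
    using nz by (metis nonzero_mult_div_cancel_left)
  then have R: "R_series 8 cusp_semigroups = ?P"
    unfolding R_series_def using average by simp
  define h where "h p = fps_of_poly (map_poly complex_of_real p)" for p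
  have h: "ring_map h" unfolding h_def
    by (rule ring_map_comp[OF _ ring_map_map_poly])
       (auto intro!: ring_mapI simp: fps_of_poly_add fps_of_poly_mult)
  have "h [:0, 1:] = fps_X" by (simp add: h_def map_poly_pCons fps_of_poly_pCons)
  then have "h ?p = ?P" by (simp add: ring_map_simps[OF h])
  then show ?thesis unfolding is_R_poly_def R h_def .
qed

lemma not_R_nonpositive: "\<not> (\<forall>n. coeff ([:0, 1:] ^ 8 - [:0, 1:] ^ 16 - [:0, 1:] ^ 24 + [:0, 1:] ^ 32 :: real poly) n \<le> 0)"
proof -
  have X: "[:0, 1:] ^ n = (monom 1 n :: real poly)" for n by (simp add: monom_altdef)
  have "coeff ([:0, 1:] ^ 8 - [:0, 1:] ^ 16 - [:0, 1:] ^ 24 + [:0, 1:] ^ 32 :: real poly) 8 = 1"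
    unfolding X by simp
  then show ?thesis by (metis not_one_le_zero)
qed

section \<open>The counterexample\<close>

lemma rational_cuspidal_octic: "rational_cuspidal_curve 8 octic_form"
  unfolding rational_cuspidal_curve_def sing_octic
  using form_octic irreducible_octic genus_octic cusp_P1(1) cusp_P2(1) cusp_P3(1) by auto

theorem mainTheorem1:
  shows "(\<exists>(C :: poly3) (P1 :: cp2) (P2 :: cp2) (P3 :: cp2).
            rational_cuspidal_curve 8 C \<and>
            sing C = {P1, P2, P3} \<and> distinct [P1, P2, P3] \<and>
            cusp_semigroup C P1 = generated2 6 7 \<and>
            cusp_semigroup C P2 = generated2 2 9 \<and>
            cusp_semigroup C P3 = generated2 2 5 \<and>
            multiplicity_sequence (local_eq C P1) [6] \<and>
            multiplicity_sequence (local_eq C P2) [2, 2, 2, 2] \<and>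
            multiplicity_sequence (local_eq C P3) [2, 2] \<and>
            (let Ss = map (cusp_semigroup C) [P1, P2, P3] in
              (\<forall>j\<in>{1, 4}. \<not> F_fun Ss (j * 8) \<le> (int j + 1) * (int j + 2) div 2) \<and>
              F_fun Ss 8 = 4 \<and> F_fun Ss 32 = 16 \<and>
              (\<exists>p. is_R_poly 8 Ss p \<and> \<not> (\<forall>n. coeff p n \<le> 0)))) \<and>
         \<not> (\<forall>d C Ps p. rational_cuspidal_curve d C \<and> distinct Ps \<and> set Ps = sing C \<and>
                is_R_poly d (map (cusp_semigroup C) Ps) p \<longrightarrow> (\<forall>n. coeff p n \<le> 0))"
proof -
  let ?p = "[:0, 1:] ^ 8 - [:0, 1:] ^ 16 - [:0, 1:] ^ 24 + [:0, 1:] ^ 32 :: real poly"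
  have Ss: "map (cusp_semigroup octic_form) [P1, P2, P3] = cusp_semigroups"
    by (simp add: cusp_P1(2) cusp_P2(2) cusp_P3(2))
  have "let Ss = map (cusp_semigroup octic_form) [P1, P2, P3] in
      (\<forall>j\<in>{1, 4}. \<not> F_fun Ss (j * 8) \<le> (int j + 1) * (int j + 2) div 2) \<and>
      F_fun Ss 8 = 4 \<and> F_fun Ss 32 = 16 \<and> (\<exists>p. is_R_poly 8 Ss p \<and> \<not> (\<forall>n. coeff p n \<le> 0))"
    unfolding Let_def Ss
    by (intro conjI exI[of _ ?p] is_R_poly_cusps not_R_nonpositive F_fun_values) (simp add: F_fun_values)
  moreover have "rational_cuspidal_curve 8 octic_form \<and> distinct [P1, P2, P3] \<and> set [P1, P2, P3] = sing octic_form \<and>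
      is_R_poly 8 (map (cusp_semigroup octic_form) [P1, P2, P3]) ?p \<and> \<not> (\<forall>n. coeff ?p n \<le> 0)"
    unfolding Ss sing_octic
    using rational_cuspidal_octic distinct_P is_R_poly_cusps not_R_nonpositive by simp
  ultimately show ?thesis
    using rational_cuspidal_octic sing_octic distinct_P cusp_P1(2,3) cusp_P2(2,3) cusp_P3(2,3) by blast
qed

end
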